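(* Let $(C,d)$ be an equitising $\zeta$-regular ultrametric Cantor set whose Connes measure $\mu_\tau$ has support $C$ and is an equity measure, and let $s\in\mathbb{R}$. The semigroup $e^{-t\mathcal{D}^s}$, $t\ge0$, generated by the Vladimirov-Pearson operator and acting on $W^{1,2}(C)$ has a kernel representation $p_t(x,\cdot)$ for $t\ge0$, $x\in C$; that is, the map $A\mapsto p_t(x,A)$ is a Borel measure on $C$ and \[ \int_C p_t(x,dy)\,f(y)=e^{-t\mathcal{D}^s}f(x) \] for $f\in W^{1,2}(C)$ and $x\in C$.
   Context: A Cantor set is a totally disconnected compact metrisable space without isolated points. A regular ultrametric Cantor set $(C,d)$ is a Cantor set $C$ with an ultrametric $d$ generating its topology. Its Michon tree $T(C)$ is the rooted tree whose vertices $v\in V$ are in bijection with the balls (discs) $[v]\subseteq C$ for $d$; the root is $C$, and the children of $v$ are the maximal balls properly contained in $[v]$ (finitely many, at least two). $\mathcal{D}(C)$ is the space of test functions, i.e. locally constant functions $C\to\mathbb{C}$. $(C,d)$ is equitising if all children $u$ of any given vertex have the same $\operatorname{diam}([u])$. Dirac operator and zeta function. On $\mathcal{H}=\ell^2(V)\otimes\mathbb{C}^2$ put $D\psi(v)=\operatorname{diam}([v])^{-1}\sigma_1\psi(v)$ with $\sigma_1=\begin{pmatrix}0&1\\1&0\end{pmatrix}$, so $|D|\psi(v)=\operatorname{diam}([v])^{-1}\psi(v)$, and $\zeta(s)=\frac12\operatorname{Tr}(|D|^{-s})=\sum_{v\in V}\operatorname{diam}([v])^s$. A choice function is a map $\tau=(\tau_+,\tau_-):V\to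 C\times C$ with $\tau(v)\in[v]\times[v]$ and $d(\tau_+(v),\tau_-(v))=\operatorname{diam}([v])$; the set of choice functions is $\Upsilon(C)$. For $f$ continuous on $C$, $\pi_\tau(f)\psi(v)=\operatorname{diag}(f(\tau_+(v)),f(\tau_-(v)))\psi(v)$. $(C,d)$ is $\zeta$-regular if $\zeta(s)$ has an abscissa of convergence $s_0\in\mathbb{R}$ (converges for $\Re(s)>s_0$) and $\lim_{s\downarrow s_0}(s-s_0)\operatorname{Tr}(|D|^{-s}\pi_\tau(f))$ exists for all continuous $f$ and all $\tau\in\Upsilon(C)$. Connes measure. For $\zeta$-regular $(C,d)$, the Connes measure $\mu_\tau$ is the Borel probability measure on $C$ (independent of $\tau$) given by $\int_C f\,d\mu_\tau=\lim_{s\downarrow s_0}\operatorname{Tr}(|D|^{-s}\pi_\tau(f))/\operatorname{Tr}(|D|^{-s})$ for continuous $f$. It is an equity measure if for every vertex $v_0$ the value $\mu_\tau([v])$ is the same for all children $v$ of $v_0$. Vladimirov-Pearson operator. Assume $\operatorname{supp}\mu_\tau=C$. Identify $\Upsilon(C)=\prod_{v\in V}\Upsilon_v$ with $\Upsilon_v=\{(x,y)\in[v]^2: d(x,y)=\operatorname{diam}([v])\}$, and let $\nu$ be the product of the probability measures obtained by normalising the restriction of $\mu_\tau\times\mu_\tau$ to $\Upsilon_v$. For $s\in\mathbb{R}$ and $f,g\in\mathcal{D}(C)$ let \[Q_s(f,g)=\tfrac12\int_{\Upsilon(C)}\operatorname{Tr}\{|D|^{-s}[D,\pi_\tau(f)]^*[D,\pi_\tau(g)]\}\,d\nu(\tau),\]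 a closable Dirichlet form on $L^2(C,\mu_\tau)$, and let $\Delta_s$ be the associated self-adjoint non-positive operator, $\langle-\Delta_sf,g\rangle=Q_s(f,g)$ in $L^2(C,\mu_\tau)$. The Vladimirov-Pearson operator is \[\mathcal{D}^sf(z)=\tfrac12\lim_{v\to z}\mu_\tau([v])^{-1}\langle 1_{[v]},-\Delta_sf\rangle,\quad f\in\mathcal{D}(C),\] where $v\to z$ means that $[v]$ runs through the discs containing $z$, shrinking to $\{z\}$. As an operator on $L^2(C,\mu_\tau)$, $\mathcal{D}^s$ is understood as the closure of this operator with initial domain $\mathcal{D}(C)$; $e^{-t\mathcal{D}^s}$ is the semigroup with infinitesimal generator $-\mathcal{D}^s$. Sobolev space. For fixed $s\in\mathbb{R}$, $W^{1,2}(C)=\{f\in L^2(C,\mu_\tau):\|\mathcal{D}^sf\|_{L^2(C,\mu_\tau)}<\infty\}$, i.e. the domain of $\mathcal{D}^s$ on $L^2(C,\mu_\tau)$, with norm $\|f\|_{W^{1,2}(C)}=\left(\|f\|_{L^2(C,\mu_\tau)}^2+\|\mathcal{D}^sf\|_{L^2(C,\mu_\tau)}^2\right)^{1/2}$. Its elements are classes of functions up to $\mu_\tau$-null sets. *)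

theory Defs
  imports "HOL-Probability.Probability"
begin

section \<open>Ultrametric Cantor sets and their Michon tree\<close>

text \<open>
  The Cantor set $C$ is the universe of the type, and its topology is the one generated by
  the ultrametric \<^const>\<open>dist\<close>. Total disconnectedness follows from the ultrametric inequality,
  and the absence of isolated points is the axiom of \<^class>\<open>perfect_space\<close>.
\<close>

class ultrametric_cantor_set = metric_space + perfect_space +
  assumes compact_space: "compact (UNIV :: 'a set)"
    and ultrametric: "dist x z \<le> max (dist x y) (dist y z)"

text \<open>
  A vertex of the Michon tree is represented by its disc $[v]$. The radii are positive, so points
  are not discs; as there are no isolated points, open and closed balls of positive radius form
  the same family of sets.
\<close>

definition discs :: "'a::ultrametric_cantor_set set set" where
  "discs = {cball x r |x r. 0 < r}"

definition children :: "'a::ultrametric_cantor_set set \<Rightarrow> 'a set set" where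
  "children v = {u \<in> discs. u \<subset> v \<and> (\<forall>w\<in>discs. u \<subseteq> w \<and> w \<subset> v \<longrightarrow> w = u)}"

definition equitising :: "'a::ultrametric_cantor_set itself \<Rightarrow> bool" where
  "equitising (_ :: 'a itself) \<longleftrightarrow>
     (\<forall>v \<in> (discs :: 'a set set). \<forall>u \<in> children v. \<forall>u' \<in> children v. diameter u = diameter u')"

definition test_functions :: "('a::ultrametric_cantor_set \<Rightarrow> complex) set" where
  "test_functions = {f. \<forall>x. eventually (\<lambda>y. f y = f x) (nhds x)}"


section \<open>The Dirac operator, zeta function and choice functions\<close>

text \<open>
  On $\ell^2(V) \otimes \mathbf{C}^2$, all operators $T$ considered act fibrewise,
  $T\psi(v) = T_v \psi(v)$ with $2 \times 2$ matrices $T_v$, and are represented by the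
  family of these matrices. Products, commutators and adjoints are then taken fibrewise and the
  trace is the sum of the traces of the blocks.
\<close>

type_synonym 'a block_operator = "'a set \<Rightarrow> complex^2^2"

definition block_mult :: "'a block_operator \<Rightarrow> 'a block_operator \<Rightarrow> 'a block_operator"
    (infixl "\<odot>" 70) where
  "A \<odot> B = (\<lambda>v. A v ** B v)"

definition block_commutator :: "'a block_operator \<Rightarrow> 'a block_operator \<Rightarrow> 'a block_operator" where
  "block_commutator A B = (\<lambda>v. A v ** B v - B v ** A v)"

definition block_adjoint :: "'a block_operator \<Rightarrow> 'a block_operator" where
  "block_adjoint A = (\<lambda>v. \<chi> i j. cnj (A v $ j $ i))"

definition Tr :: "'a::ultrametric_cantor_set block_operator \<Rightarrow> complex" where
  "Tr A = (\<Sum>\<^sub>\<infinity>v\<in>discs. trace (A v))"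

definition dirac :: "'a::ultrametric_cantor_set block_operator" where
  "dirac v = (1 / diameter v) *\<^sub>R vector [vector [0, 1], vector [1, 0]]"

text \<open>The power $|D|^z$; recall that $|D|_v = \mathrm{diam}([v])^{-1}$.\<close>

definition abs_dirac_powr :: "complex \<Rightarrow> 'a::ultrametric_cantor_set block_operator" where
  "abs_dirac_powr z v = mat (complex_of_real (1 / diameter v) powr z)"

definition choices :: "'a::ultrametric_cantor_set set \<Rightarrow> ('a \<times> 'a) set" where
  "choices v = {(x, y). x \<in> v \<and> y \<in> v \<and> dist x y = diameter v}"

definition choice_functions :: "('a::ultrametric_cantor_set set \<Rightarrow> 'a \<times> 'a) set" where
  "choice_functions = (\<Pi>\<^sub>E v\<in>discs. choices v)"

definition rep :: "('a::ultrametric_cantor_set set \<Rightarrow> 'a \<times> 'a) \<Rightarrow> ('a \<Rightarrow> complex) \<Rightarrow> 'a block_operator" where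
  "rep \<tau> f v = vector [vector [f (fst (\<tau> v)), 0], vector [0, f (snd (\<tau> v))]]"

text \<open>
  Convergence of $\zeta(s) = \frac12 \mathrm{Tr}(|D|^{-s})$ is summability of the unordered
  series over $V$.
\<close>

definition zeta_abscissa :: "'a::ultrametric_cantor_set itself \<Rightarrow> real \<Rightarrow> bool" where
  "zeta_abscissa (_ :: 'a itself) s\<^sub>0 \<longleftrightarrow>
     (\<forall>s. (s\<^sub>0 < Re s \<longrightarrow> (\<lambda>v :: 'a set. trace (abs_dirac_powr (- s) v)) summable_on discs) \<and>
          (Re s < s\<^sub>0 \<longrightarrow> \<not> (\<lambda>v :: 'a set. trace (abs_dirac_powr (- s) v)) summable_on discs))"

definition zeta_regular :: "'a::ultrametric_cantor_set itself \<Rightarrow> bool" where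
  "zeta_regular (_ :: 'a itself) \<longleftrightarrow>
     (\<exists>s\<^sub>0. zeta_abscissa TYPE('a) s\<^sub>0 \<and>
       (\<forall>f :: 'a \<Rightarrow> complex. continuous_on UNIV f \<longrightarrow>
         (\<forall>\<tau> \<in> choice_functions. \<exists>l.
           ((\<lambda>s :: real. of_real (s - s\<^sub>0) * Tr (abs_dirac_powr (- of_real s) \<odot> rep \<tau> f))
             \<longlongrightarrow> l) (at_right s\<^sub>0))))"


section \<open>The Connes measure\<close>

definition connes_measure :: "'a::ultrametric_cantor_set measure \<Rightarrow> bool" where
  "connes_measure \<mu> \<longleftrightarrow> sets \<mu> = sets borel \<and> prob_space \<mu> \<and>
     (\<exists>s\<^sub>0. zeta_abscissa TYPE('a) s\<^sub>0 \<and>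
       (\<forall>f :: 'a \<Rightarrow> complex. continuous_on UNIV f \<longrightarrow>
         (\<forall>\<tau> \<in> choice_functions.
           ((\<lambda>s :: real. Tr (abs_dirac_powr (- of_real s) \<odot> rep \<tau> f)
                / Tr (abs_dirac_powr (- of_real s) :: 'a block_operator))
             \<longlongrightarrow> (LINT x|\<mu>. f x)) (at_right s\<^sub>0))))"

definition measure_support :: "'a::topological_space measure \<Rightarrow> 'a set" where
  "measure_support \<mu> = {x. \<forall>U. open U \<and> x \<in> U \<longrightarrow> 0 < emeasure \<mu> U}"

definition equity_measure :: "'a::ultrametric_cantor_set measure \<Rightarrow> bool" where
  "equity_measure \<mu> \<longleftrightarrow>
     (\<forall>v \<in> discs. \<forall>u \<in> children v. \<forall>u' \<in> children v. measure \<mu> u = measure \<mu> u')"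


section \<open>The space \<open>L\<^sup>2\<close> and unbounded operators on it\<close>

text \<open>
  Elements of $L^2(C,\mu)$ are represented by square integrable functions, without passing to
  classes; an unbounded operator is represented by its graph, which has to be read modulo
  $\mu$-null sets in both components.
\<close>

definition L2 :: "'a measure \<Rightarrow> ('a \<Rightarrow> complex) set" where
  "L2 \<mu> = {f \<in> borel_measurable \<mu>. integrable \<mu> (\<lambda>x. (cmod (f x))\<^sup>2)}"

definition L2_inner :: "'a measure \<Rightarrow> ('a \<Rightarrow> complex) \<Rightarrow> ('a \<Rightarrow> complex) \<Rightarrow> complex" where
  "L2_inner \<mu> f g = (LINT x|\<mu>. cnj (f x) * g x)"

definition L2_norm :: "'a measure \<Rightarrow> ('a \<Rightarrow> complex) \<Rightarrow> real" where
  "L2_norm \<mu> f = sqrt (LINT x|\<mu>. (cmod (f x))\<^sup>2)"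

type_synonym 'a operator_graph = "(('a \<Rightarrow> complex) \<times> ('a \<Rightarrow> complex)) set"

definition operator_closure :: "'a measure \<Rightarrow> 'a operator_graph \<Rightarrow> 'a operator_graph" where
  "operator_closure \<mu> A = {(f, g). f \<in> L2 \<mu> \<and> g \<in> L2 \<mu> \<and>
     (\<exists>F G. (\<forall>n. (F n, G n) \<in> A \<and> F n \<in> L2 \<mu> \<and> G n \<in> L2 \<mu>) \<and>
       (\<lambda>n. L2_norm \<mu> (\<lambda>x. F n x - f x)) \<longlonglongrightarrow> 0 \<and>
       (\<lambda>n. L2_norm \<mu> (\<lambda>x. G n x - g x)) \<longlonglongrightarrow> 0)}"


section \<open>The Pearson--Bellissard Dirichlet form and its operator\<close>

definition choice_measure ::
    "'a::ultrametric_cantor_set measure \<Rightarrow> ('a set \<Rightarrow> 'a \<times> 'a) measure" where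
  "choice_measure \<mu> =
     (\<Pi>\<^sub>M v\<in>discs. restrict_space (uniform_measure (\<mu> \<Otimes>\<^sub>M \<mu>) (choices v)) (choices v))"

definition pb_form ::
    "'a::ultrametric_cantor_set measure \<Rightarrow> real \<Rightarrow> ('a \<Rightarrow> complex) \<Rightarrow> ('a \<Rightarrow> complex) \<Rightarrow> complex" where
  "pb_form \<mu> s f g = 1/2 * (LINT \<tau>|choice_measure \<mu>.
     Tr (abs_dirac_powr (- of_real s) \<odot> block_adjoint (block_commutator dirac (rep \<tau> f))
           \<odot> block_commutator dirac (rep \<tau> g)))"

text \<open>
  The sequence $F$ of test functions exhibits $f$ as an element of the domain of the closure
  of the form $Q_s$: it converges to $f$ in $L^2$ and is Cauchy in the form seminorm.
\<close>

definition form_approximates ::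
    "'a::ultrametric_cantor_set measure \<Rightarrow> real \<Rightarrow> (nat \<Rightarrow> 'a \<Rightarrow> complex) \<Rightarrow> ('a \<Rightarrow> complex) \<Rightarrow> bool" where
  "form_approximates \<mu> s F f \<longleftrightarrow> f \<in> L2 \<mu> \<and> (\<forall>n. F n \<in> test_functions) \<and>
     (\<lambda>n. L2_norm \<mu> (\<lambda>x. F n x - f x)) \<longlonglongrightarrow> 0 \<and>
     (\<forall>e>0. \<exists>N. \<forall>m\<ge>N. \<forall>n\<ge>N.
        cmod (pb_form \<mu> s (\<lambda>x. F m x - F n x) (\<lambda>x. F m x - F n x)) < e)"

text \<open>
  The graph of $-\Delta_s$, the operator associated with the closure $\overline{Q_s}$:
  $f$ is in the domain of $\overline{Q_s}$ and $\overline{Q_s}(f,g) = \langle h, g\rangle$ for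
  all $g$ in that domain, where $\overline{Q_s}(f,g) = \lim_n Q_s(F_n,G_n)$ for any approximating
  sequences.
\<close>

definition neg_laplacian :: "'a::ultrametric_cantor_set measure \<Rightarrow> real \<Rightarrow> 'a operator_graph" where
  "neg_laplacian \<mu> s = {(f, h). h \<in> L2 \<mu> \<and> (\<exists>F. form_approximates \<mu> s F f) \<and>
     (\<forall>F g G. form_approximates \<mu> s F f \<longrightarrow> form_approximates \<mu> s G g \<longrightarrow>
        (\<lambda>n. pb_form \<mu> s (F n) (G n)) \<longlonglongrightarrow> L2_inner \<mu> h g)}"


section \<open>The Vladimirov--Pearson operator, Sobolev space and semigroup\<close>

text \<open>The filter $v \to z$ on the discs containing $z$, as they shrink to $\{z\}$.\<close>

definition discs_at :: "'a::ultrametric_cantor_set \<Rightarrow> 'a set filter" where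
  "discs_at z = (INF e\<in>{0<..}. principal {v \<in> discs. z \<in> v \<and> diameter v < e})"

definition vp_initial :: "'a::ultrametric_cantor_set measure \<Rightarrow> real \<Rightarrow> 'a operator_graph" where
  "vp_initial \<mu> s = {(f, g). f \<in> test_functions \<and>
     (\<exists>h. (f, h) \<in> neg_laplacian \<mu> s \<and>
       (\<forall>z. ((\<lambda>v. 1/2 * (L2_inner \<mu> (indicator v) h / of_real (measure \<mu> v))) \<longlongrightarrow> g z)
              (discs_at z)))}"

definition vladimirov_pearson ::
    "'a::ultrametric_cantor_set measure \<Rightarrow> real \<Rightarrow> 'a operator_graph" where
  "vladimirov_pearson \<mu> s = operator_closure \<mu> (vp_initial \<mu> s)"

definition sobolev :: "'a::ultrametric_cantor_set measure \<Rightarrow> real \<Rightarrow> ('a \<Rightarrow> complex) set" where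
  "sobolev \<mu> s = {f \<in> L2 \<mu>. \<exists>g. (f, g) \<in> vladimirov_pearson \<mu> s}"

text \<open>
  Strongly continuous semigroups of bounded linear operators on $L^2$. Linearity
  and boundedness imply that these operators are well-defined on classes modulo null sets.
\<close>

definition L2_semigroup ::
    "'a measure \<Rightarrow> (real \<Rightarrow> ('a \<Rightarrow> complex) \<Rightarrow> 'a \<Rightarrow> complex) \<Rightarrow> bool" where
  "L2_semigroup \<mu> T \<longleftrightarrow>
     (\<forall>t\<ge>0. \<forall>f\<in>L2 \<mu>. T t f \<in> L2 \<mu>) \<and>
     (\<forall>t\<ge>0. \<forall>f\<in>L2 \<mu>. \<forall>g\<in>L2 \<mu>. \<forall>a b.
        AE x in \<mu>. T t (\<lambda>y. a * f y + b * g y) x = a * T t f x + b * T t g x) \<and>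
     (\<forall>t\<ge>0. \<exists>K. \<forall>f\<in>L2 \<mu>. L2_norm \<mu> (T t f) \<le> K * L2_norm \<mu> f) \<and>
     (\<forall>f\<in>L2 \<mu>. AE x in \<mu>. T 0 f x = f x) \<and>
     (\<forall>t\<ge>0. \<forall>t'\<ge>0. \<forall>f\<in>L2 \<mu>. AE x in \<mu>. T (t + t') f x = T t (T t' f) x) \<and>
     (\<forall>f\<in>L2 \<mu>. ((\<lambda>t. L2_norm \<mu> (\<lambda>x. T t f x - f x)) \<longlongrightarrow> 0) (at_right 0))"

definition generator ::
    "'a measure \<Rightarrow> (real \<Rightarrow> ('a \<Rightarrow> complex) \<Rightarrow> 'a \<Rightarrow> complex) \<Rightarrow> 'a operator_graph" where
  "generator \<mu> T = {(f, g). f \<in> L2 \<mu> \<and> g \<in> L2 \<mu> \<and>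
     ((\<lambda>t. L2_norm \<mu> (\<lambda>x. (T t f x - f x) / of_real t - g x)) \<longlongrightarrow> 0) (at_right 0)}"

text \<open>
  $e^{-t\mathcal{D}^s}$: the strongly continuous semigroup with infinitesimal generator
  $-\mathcal{D}^s$. Such a semigroup is unique modulo null sets; the choice operator only picks
  representatives.
\<close>

definition vp_semigroup ::
    "'a::ultrametric_cantor_set measure \<Rightarrow> real \<Rightarrow> real \<Rightarrow> ('a \<Rightarrow> complex) \<Rightarrow> 'a \<Rightarrow> complex" where
  "vp_semigroup \<mu> s = (SOME T. L2_semigroup \<mu> T \<and>
     generator \<mu> T = {(f, g). (f, \<lambda>x. - g x) \<in> vladimirov_pearson \<mu> s})"

text \<open>
  The kernels $p(x, \cdot)$ represent the operator $S$ on the space $W$ of classes of functions: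
  for every representative $f$ of a class in $W$, the function $x \mapsto \int f(y)\,p(x,dy)$ is a
  representative of $S f$. In addition the identity holds at every point $x$ whenever both $f$ and
  $S f$ have canonical pointwise values, i.e. are (represented by) continuous functions.
\<close>

definition kernel_represents ::
    "'a::ultrametric_cantor_set measure \<Rightarrow> ('a \<Rightarrow> 'a measure) \<Rightarrow> ('a \<Rightarrow> complex) set \<Rightarrow>
      (('a \<Rightarrow> complex) \<Rightarrow> 'a \<Rightarrow> complex) \<Rightarrow> bool" where
  "kernel_represents \<mu> p W S \<longleftrightarrow>
     (\<forall>f\<in>W. AE x in \<mu>. integrable (p x) f \<and> (LINT y|p x. f y) = S f x) \<and>
     (\<forall>f\<in>W. \<forall>g. continuous_on UNIV f \<and> continuous_on UNIV g \<and> (AE x in \<mu>. S f x = g x) \<longrightarrow>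
        (\<forall>x. integrable (p x) f \<and> (LINT y|p x. f y) = g x))"

end

theory Submission
  imports Defs
begin

text \<open>
  On test functions the trace defining the form splits over the vertices of the tree. A vertex v
  contributes the product of the differences of f and g, averaged over the pairs of points of v at
  maximal distance. Since every pair of distinct points belongs to exactly one vertex in this way, the
  form is a jump form with a symmetric kernel \<open>jump_kernel x y\<close> depending only on the smallest disc
  containing x and y (\<open>pb_form_eq_grad\<close>). Consequently the Vladimirov-Pearson operator acts on test functions
  as \<open>jump_op f x\<close>, the integral of \<open>jump_kernel x y * (f x - f y)\<close> over y (\<open>vp_initial_eq\<close>).

  This operator respects every scale: it maps functions constant on the balls of radius r to such
  functions. For a disc u with parent v, the indicator of u minus a multiple of that of v is an
  eigenfunction, so test functions are finite sums of eigenfunctions (\<open>eigenfunction_induct\<close>). The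
  exponential series \<open>exp_op t\<close> therefore converges on test functions, is a symmetric semigroup
  and fixes constants. At a fixed scale the operator is a bounded jump operator, so
  \<open>exp_op t\<close> preserves non-negative functions (\<open>exp_op_nonneg\<close>).

  Hence its values at x on indicators of clopen sets form a finitely additive set function, which extends to a
  probability measure \<open>heat_kernel t x\<close> because, by compactness, a decreasing
  sequence of clopen sets with empty intersection is eventually empty (\<open>kernel_exists\<close>). Integration against this kernel is a
  strongly continuous contraction semigroup \<open>heat\<close> on L2, because symmetry makes the measure
  invariant. Its generator is exactly minus the closure of the operator on test functions
  (\<open>generator_heat\<close>): the contraction property bounds the motion of a test function by the
  norm of its image under the operator, which lets derivatives pass to the closure; conversely,
  averages over balls of radius r are test functions that approximate an element of the domain
  together with its image.

  The semigroup of the statement is only known to be some strongly continuous semigroup with this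
  generator. It agrees with \<open>heat\<close> on eigenfunctions, where it has to solve a scalar
  equation (\<open>L2_semigroup_unique\<close>). The point is that right derivatives alone do not determine a
  function, and a bound on the operators on some time interval is needed, which Baire's theorem
  provides. Finally, \<open>heat\<close> maps continuous functions to continuous functions, and continuous
  functions that agree almost everywhere are equal because the measure has full support. This
  gives the pointwise part of the representation.
\<close>

section \<open>Ultrametric geometry\<close>

lemma cball_eq_of_dist_le:
  fixes x y :: "'a::ultrametric_cantor_set"
  assumes "dist x y \<le> r"
  shows "cball x r = cball y r"
proof -
  have "dist y z \<le> r" if "dist x z \<le> r" for z
    using ultrametric[of y z x] that assms by (auto simp: dist_commute max_def split: if_splits)
  moreover have "dist x z \<le> r" if "dist y z \<le> r" for z
    using ultrametric[of x z y] that assms by (auto simp: dist_commute max_def split: if_splits)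
  ultimately show ?thesis by auto
qed

lemma dist_eq_of_perturbation:
  fixes x y :: "'a::ultrametric_cantor_set"
  assumes "dist x x' \<le> r" "dist y y' \<le> r" "r < dist x y"
  shows "dist x' y' = dist x y"
proof (rule antisym)
  have "dist x y \<le> max (dist x x') (max (dist x' y') (dist y' y))"
    using ultrametric[of x y x'] ultrametric[of x' y y'] by linarith
  then show "dist x y \<le> dist x' y'"
    using assms by (auto simp: dist_commute max_def split: if_splits)
  have "dist x' y' \<le> max (dist x' x) (max (dist x y) (dist y y'))"
    using ultrametric[of x' y' x] ultrametric[of x y' y] by linarith
  then show "dist x' y' \<le> dist x y"
    using assms by (auto simp: dist_commute max_def split: if_splits)
qed

lemma open_of_scale:
  fixes S :: "'a::ultrametric_cantor_set set"
  assumes "0 < r" "\<And>x y. x \<in> S \<Longrightarrow> dist x y \<le> r \<Longrightarrow> y \<in> S"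
  shows "open S"
  unfolding open_dist using assms by (metis dist_commute less_imp_le)

lemma finite_cballs:
  assumes "0 < r"
  shows "finite (range (\<lambda>x::'a::ultrametric_cantor_set. cball x r))"
proof -
  have op: "open (cball x r)" for x :: 'a
    by (rule open_of_scale[OF assms]) (metis cball_eq_of_dist_le mem_cball)
  obtain D :: "'a set" where D: "finite D" "UNIV \<subseteq> (\<Union>y\<in>D. cball y r)"
  proof (rule compactE_image[OF compact_space, of UNIV "\<lambda>y::'a. cball y r"])
    show "UNIV \<subseteq> (\<Union>y::'a. cball y r)" using assms by fastforce
  qed (use op in auto)
  have "range (\<lambda>x::'a. cball x r) \<subseteq> (\<lambda>y. cball y r) ` D"
  proof clarify
    fix x :: 'a
    obtain y where y: "y \<in> D" "x \<in> cball y r" using D(2) by blast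
    then have "cball x r = cball y r" using cball_eq_of_dist_le[of y x r] by simp
    then show "cball x r \<in> (\<lambda>y. cball y r) ` D" using y(1) by blast
  qed
  then show ?thesis using D(1) finite_subset by blast
qed

text \<open>
  A choice of one point in each ball of radius r. Through it a function that is constant on these
  balls factors through a finite set, which replaces countability arguments about the topology.
\<close>

definition center :: "real \<Rightarrow> 'a::ultrametric_cantor_set \<Rightarrow> 'a" where
  "center r x = (SOME y. y \<in> cball x r)"

lemma dist_center: "0 \<le> r \<Longrightarrow> dist x (center r x) \<le> r"
  unfolding center_def by (metis centre_in_cball mem_cball someI)

lemma center_cong: "dist x y \<le> r \<Longrightarrow> center r x = center r y"
  unfolding center_def using cball_eq_of_dist_le by metis

lemma finite_range_center:
  assumes "0 < r"
  shows "finite (range (center r :: 'a::ultrametric_cantor_set \<Rightarrow> 'a))"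
proof -
  have "range (center r :: 'a \<Rightarrow> 'a) = (\<lambda>B. SOME y. y \<in> B) ` range (\<lambda>x. cball x r)"
    by (auto simp: center_def image_image)
  then show ?thesis using finite_imageI[OF finite_cballs[OF assms]] by metis
qed

definition const_at_scale :: "real \<Rightarrow> ('a::ultrametric_cantor_set \<Rightarrow> 'b) \<Rightarrow> bool" where
  "const_at_scale r f \<longleftrightarrow> (\<forall>x y. dist x y \<le> r \<longrightarrow> f x = f y)"

lemma const_at_scaleD: "const_at_scale r f \<Longrightarrow> dist x y \<le> r \<Longrightarrow> f x = f y"
  by (simp add: const_at_scale_def)

lemma const_at_scale_mono: "const_at_scale r f \<Longrightarrow> q \<le> r \<Longrightarrow> const_at_scale q f"
  by (auto simp: const_at_scale_def)

lemma const_at_scale_center: "const_at_scale r f \<Longrightarrow> 0 \<le> r \<Longrightarrow> f (center r x) = f x"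
  by (metis const_at_scaleD dist_center)

lemma const_at_scale_comp:
  "const_at_scale r f \<Longrightarrow> const_at_scale r (\<lambda>x. h (f x))"
  "const_at_scale r f \<Longrightarrow> const_at_scale r g \<Longrightarrow> const_at_scale r (\<lambda>x. k (f x) (g x))"
  by (auto simp: const_at_scale_def)

lemma const_at_scale_finite_range:
  fixes f :: "'a::ultrametric_cantor_set \<Rightarrow> 'b"
  assumes "const_at_scale r f" "0 < r"
  shows "finite (range f)"
proof -
  have "range f = f ` range (center r :: 'a \<Rightarrow> 'a)"
    using const_at_scale_center[OF assms(1) less_imp_le[OF assms(2)]]
    by (metis (mono_tags, lifting) image_cong image_image)
  then show ?thesis using finite_imageI[OF finite_range_center[OF assms(2)]] by metis
qed

lemma const_at_scale_indicator_cball: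
  "q \<le> r \<Longrightarrow> const_at_scale q (\<lambda>y. a * indicator (cball x r) y :: complex)"
  unfolding const_at_scale_def
proof clarify
  fix y z :: 'a assume "q \<le> r" "dist y z \<le> q"
  then have "y \<in> cball x r \<longleftrightarrow> z \<in> cball x r"
    using cball_eq_of_dist_le[of y z r] by (metis dist_commute mem_cball order_trans)
  then show "a * indicator (cball x r) y = (a * indicator (cball x r) z :: complex)"
    by (simp add: indicator_def)
qed

lemma const_at_scale_measurable:
  assumes "const_at_scale r f" "0 < r"
  shows "f \<in> measurable borel (count_space UNIV)"
proof (rule measurableI)
  fix A
  have "open (f -` A)"
    by (rule open_of_scale[OF assms(2)]) (metis assms(1) const_at_scaleD vimage_eq)
  then show "f -` A \<inter> space borel \<in> sets borel" by simp
qed auto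

lemma const_at_scale_continuous:
  fixes f :: "'a::ultrametric_cantor_set \<Rightarrow> 'b::topological_space"
  assumes "const_at_scale r f" "0 < r"
  shows "continuous_on UNIV f"
  unfolding continuous_on_open_vimage[OF open_UNIV]
proof clarify
  fix B :: "'b set" assume "open B"
  have "open (f -` B)"
    by (rule open_of_scale[OF assms(2)]) (metis assms(1) const_at_scaleD vimage_eq)
  then show "open (f -` B \<inter> UNIV)" by simp
qed

text \<open>
  Open subsets of the product need not a priori belong to the product of the Borel
  \<open>\<sigma>\<close>-algebras. A function that is constant at a fixed scale in both variables
  factors through a finite product of finite sets, so its measurability is elementary.
\<close>

lemma const_at_scale_measurable_pair:
  fixes F :: "'a::ultrametric_cantor_set \<Rightarrow> 'a \<Rightarrow> 'b::topological_space"
  assumes "0 < r" "\<And>x x' y y'. dist x x' \<le> r \<Longrightarrow> dist y y' \<le> r \<Longrightarrow> F x y = F x' y'"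
  shows "case_prod F \<in> borel_measurable (borel \<Otimes>\<^sub>M borel)"
proof -
  let ?K = "range (center r :: 'a \<Rightarrow> 'a)"
  have c: "const_at_scale r (center r :: 'a \<Rightarrow> 'a)"
    using center_cong by (auto simp: const_at_scale_def)
  have m: "(center r :: 'a \<Rightarrow> 'a) \<in> measurable borel (count_space ?K)"
    using const_at_scale_measurable[OF c assms(1)]
    by (simp add: measurable_count_space_eq2_countable measurable_def)
  have "(\<lambda>z. (center r (fst z), center r (snd z))) \<in>
      measurable (borel \<Otimes>\<^sub>M borel) (count_space ?K \<Otimes>\<^sub>M count_space ?K)"
    using m by measurable
  then have "(\<lambda>z. (center r (fst z), center r (snd z))) \<in>
      measurable (borel \<Otimes>\<^sub>M borel) (count_space (?K \<times> ?K))"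
    by (simp add: pair_measure_countable finite_range_center[OF assms(1)] countable_finite)
  moreover have "case_prod F \<in> measurable (count_space (?K \<times> ?K)) borel"
    by simp
  ultimately have "(\<lambda>z. case_prod F (center r (fst z), center r (snd z))) \<in>
      borel_measurable (borel \<Otimes>\<^sub>M borel)"
    by (rule measurable_compose)
  also have "(\<lambda>z. case_prod F (center r (fst z), center r (snd z))) = case_prod F"
    using assms(2)[OF dist_center dist_center, symmetric] assms(1) by (auto simp: fun_eq_iff)
  finally show ?thesis .
qed

subsection \<open>Discs\<close>

lemma bounded_space: "bounded (v :: 'a::ultrametric_cantor_set set)"
  using compact_imp_bounded[OF compact_space] bounded_subset by blast

lemma compact_disc: "compact (cball (x::'a::ultrametric_cantor_set) r)"
  using compact_Int_closed[OF compact_space closed_cball] by (metis inf_top.left_neutral)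

text \<open>
  Every point of a disc is a center, and the diameter is the smallest admissible radius. Hence a
  disc is recovered from any of its points and its diameter.
\<close>

lemma disc_eq_cball:
  assumes "v \<in> discs" "x \<in> v"
  shows "v = cball x (diameter v)"
proof -
  obtain c r where v: "v = cball c r" "0 < r" using assms(1) by (auto simp: discs_def)
  then have "v = cball x r" using assms(2) cball_eq_of_dist_le by auto
  have "dist x y \<le> diameter v" if "y \<in> v" for y
    using diameter_bounded_bound[OF bounded_space] assms(2) that by blast
  moreover have "diameter v \<le> r"
  proof -
    have "\<exists>y\<in>v. \<exists>z\<in>v. dist y z = diameter v"
      using diameter_compact_attained[of v] v compact_disc assms(2) by blast
    then obtain y z where yz: "y \<in> v" "z \<in> v" "dist y z = diameter v" by blast
    then have "cball c r = cball y r" using v cball_eq_of_dist_le by auto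
    then show ?thesis using yz v by auto
  qed
  ultimately show ?thesis using \<open>v = cball x r\<close> by auto
qed

lemma disc_nonempty: "v \<in> discs \<Longrightarrow> v \<noteq> {}"
  by (auto simp: discs_def)

lemma disc_diameter_attained:
  assumes "v \<in> discs"
  shows "\<exists>x\<in>v. \<exists>y\<in>v. dist x y = diameter v"
  using diameter_compact_attained[of v] disc_nonempty[OF assms] assms compact_disc
  by (auto simp: discs_def)

lemma disc_diameter_pos:
  assumes "v \<in> discs"
  shows "0 < diameter v"
proof -
  obtain c r where v: "v = cball c r" "0 < r" using assms(1) by (auto simp: discs_def)
  have "c islimpt UNIV" by (simp add: islimpt_UNIV)
  then obtain y where "y \<noteq> c" "dist y c < r"
    using v(2) by (auto simp: islimpt_approachable)
  then have "y \<in> v" "c \<in> v" using v by (auto simp: dist_commute)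
  then show ?thesis
    using diameter_bounded_bound[OF bounded_space, of y v c] \<open>y \<noteq> c\<close>
    by (smt (verit) zero_less_dist_iff)
qed

text \<open>
  The smallest disc containing two distinct points x and y is the ball around x of radius
  \<open>dist x y\<close>; its vertex is the join of x and y in the tree.
\<close>

lemma disc_join:
  fixes x y :: "'a::ultrametric_cantor_set"
  assumes "x \<noteq> y"
  shows "cball x (dist x y) \<in> discs" "diameter (cball x (dist x y)) = dist x y"
proof -
  show d: "cball x (dist x y) \<in> discs"
    unfolding discs_def using assms zero_less_dist_iff by blast
  show "diameter (cball x (dist x y)) = dist x y"
  proof (rule antisym)
    show "dist x y \<le> diameter (cball x (dist x y))"
      using diameter_bounded_bound[OF bounded_space, of x "cball x (dist x y)" y] by auto
    obtain p q where "p \<in> cball x (dist x y)" "q \<in> cball x (dist x y)"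
      "dist p q = diameter (cball x (dist x y))"
      using disc_diameter_attained[OF d] by blast
    then show "diameter (cball x (dist x y)) \<le> dist x y"
      using cball_eq_of_dist_le[of x p "dist x y"] by auto
  qed
qed

lemma disc_unique_join:
  assumes "v \<in> discs" "(x, y) \<in> choices v"
  shows "v = cball x (dist x y)" "x \<noteq> y"
  using assms disc_eq_cball[of v x] disc_diameter_pos[OF assms(1)] by (auto simp: choices_def)

lemma in_choices_join:
  assumes "x \<noteq> y"
  shows "(x, y) \<in> choices (cball x (dist x y))"
  using disc_join(2)[OF assms] by (auto simp: choices_def)

lemma finite_large_discs:
  assumes "0 < r"
  shows "finite {v \<in> (discs :: 'a::ultrametric_cantor_set set set). r < diameter v}"
proof -
  let ?K = "range (center r :: 'a \<Rightarrow> 'a)"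
  have "{v \<in> (discs :: 'a set set). r < diameter v} \<subseteq> (\<lambda>(x, y). cball x (dist x y)) ` (?K \<times> ?K)"
  proof clarify
    fix v :: "'a set" assume v: "v \<in> discs" "r < diameter v"
    obtain p q where pq: "p \<in> v" "q \<in> v" "dist p q = diameter v"
      using disc_diameter_attained[OF v(1)] by blast
    have d: "dist p (center r p) \<le> r" "dist q (center r q) \<le> r"
      using dist_center[OF less_imp_le[OF assms]] by blast+
    have "dist (center r p) (center r q) = diameter v"
      using dist_eq_of_perturbation[OF d] pq v by simp
    moreover have "v = cball (center r p) (diameter v)"
      using disc_eq_cball[OF v(1) pq(1)] cball_eq_of_dist_le[of p "center r p" "diameter v"] d v
      by simp
    ultimately show "v \<in> (\<lambda>(x, y). cball x (dist x y)) ` (?K \<times> ?K)"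
      by (intro image_eqI[of _ _ "(center r p, center r q)"]) auto
  qed
  moreover have "finite (?K \<times> ?K)" using finite_range_center[OF assms] by blast
  ultimately show ?thesis using finite_surj by blast
qed

lemma disc_subset_diameter:
  assumes "u \<in> discs" "v \<in> discs" "u \<subset> v"
  shows "diameter u < diameter v"
proof (rule ccontr)
  assume "\<not> ?thesis"
  moreover obtain x where "x \<in> u" using disc_nonempty[OF assms(1)] by auto
  ultimately have "v \<subseteq> u"
    using disc_eq_cball[OF assms(1)] disc_eq_cball[OF assms(2)] assms(3)
        by (metis dual_order.strict_iff_not linorder_not_less psubsetD subset_cball)
  then show False using assms(3) by auto
qed

lemma UNIV_disc: "(UNIV :: 'a::ultrametric_cantor_set set) \<in> discs"
proof -
  obtain x :: 'a where True by blast
  have "(UNIV :: 'a set) = cball x (diameter (UNIV :: 'a set) + 1)"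
    using diameter_bounded_bound[OF bounded_space, of x "UNIV :: 'a set"]
    by auto (smt (verit))
  moreover have "0 \<le> diameter (UNIV :: 'a set)" by (simp add: bounded_space diameter_ge_0)
  ultimately show ?thesis unfolding discs_def by (smt (verit) mem_Collect_eq)
qed

text \<open>
  A disc of larger diameter than u is one of finitely many, so among the discs strictly containing
  u one has the smallest diameter. The join of a point of u with a point outside u also contains u
  strictly, which pins down its distance.
\<close>

lemma disc_parent:
  fixes u :: "'a::ultrametric_cantor_set set"
  assumes "u \<in> discs" "u \<noteq> UNIV"
  shows "\<exists>v\<in>discs. u \<subset> v \<and> (\<forall>x\<in>u. \<forall>y\<in>v - u. dist x y = diameter v)"
proof -
  let ?W = "{w \<in> discs. u \<subset> w}"
  have "?W \<subseteq> {w \<in> discs. diameter u < diameter w}"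
    using disc_subset_diameter[OF assms(1)] by auto
  then have fin: "finite ?W"
    using finite_large_discs[OF disc_diameter_pos[OF assms(1)]] finite_subset by blast
  moreover have "?W \<noteq> {}" using UNIV_disc assms by auto
  ultimately obtain v where v: "v \<in> ?W" "\<And>w. w \<in> ?W \<Longrightarrow> diameter v \<le> diameter w"
    using ex_min_if_finite[of "diameter ` ?W"] by (metis (no_types, lifting) arg_min_if_finite(1) arg_min_least)
  have "dist x y = diameter v" if "x \<in> u" "y \<in> v - u" for x y
  proof (rule antisym)
    show "dist x y \<le> diameter v"
      using diameter_bounded_bound[OF bounded_space, of x v y] that v by auto
    have "diameter u < dist x y"
      using disc_eq_cball[OF assms(1) that(1)] that(2) by (metis DiffD2 mem_cball not_le)
    moreover have "x \<noteq> y" using that by auto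
    ultimately have "cball x (dist x y) \<in> ?W"
      using disc_eq_cball[OF assms(1) that(1)] disc_join(1)[of x y] that
      by (smt (verit) DiffD2 mem_Collect_eq mem_cball psubsetI subset_cball)
    then show "diameter v \<le> dist x y" using v(2) disc_join(2)[OF \<open>x \<noteq> y\<close>] by fastforce
  qed
  then show ?thesis using v(1) by (intro bexI[of _ v]) auto
qed

text \<open>
  Induction from the root of the tree to its leaves, along parents.
\<close>

lemma disc_induct [consumes 1, case_names root step]:
  fixes u :: "'a::ultrametric_cantor_set set"
  assumes "u \<in> discs" and root: "P UNIV"
    and step: "\<And>u v. u \<in> discs \<Longrightarrow> v \<in> discs \<Longrightarrow> u \<subset> v \<Longrightarrow>
      (\<And>x y. x \<in> u \<Longrightarrow> y \<in> v - u \<Longrightarrow> dist x y = diameter v) \<Longrightarrow> P v \<Longrightarrow> P u"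
  shows "P u"
  using assms(1)
proof (induction "card {w \<in> discs. u \<subset> w}" arbitrary: u rule: less_induct)
  case less
  show ?case
  proof (cases "u = UNIV")
    case False
    then obtain v where v: "v \<in> discs" "u \<subset> v" "\<forall>x\<in>u. \<forall>y\<in>v - u. dist x y = diameter v"
      using disc_parent[OF less.prems] by blast
    have "{w \<in> discs. u \<subset> w} \<subseteq> {w \<in> discs. diameter u < diameter w}"
      using disc_subset_diameter[OF less.prems] by auto
    then have fin: "finite {w \<in> discs. u \<subset> w}"
      using finite_large_discs[OF disc_diameter_pos[OF less.prems]] finite_subset by blast
    have "{w \<in> discs. v \<subset> w} \<subset> {w \<in> discs. u \<subset> w}" using v(1,2) by auto
    then have "P v" using less.hyps[OF psubset_card_mono[OF fin] v(1)] by metis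
    moreover have "dist x y = diameter v" if "x \<in> u" "y \<in> v - u" for x y
      using v(3) that by metis
    ultimately show ?thesis using step[OF less.prems v(1,2)] by metis
  qed (simp add: root)
qed

section \<open>Test functions\<close>

text \<open>
  Compactness makes local constancy uniform: a finite subcover by balls of constancy has a
  smallest radius.
\<close>

lemma test_function_iff: "f \<in> test_functions \<longleftrightarrow> (\<exists>r>0. const_at_scale r f)"
proof
  assume f: "f \<in> test_functions"
  then have "\<exists>e>0. \<forall>y. dist y x < e \<longrightarrow> f y = f x" for x
    by (auto simp: test_functions_def eventually_nhds_metric)
  then obtain e where e: "\<And>x. 0 < e x" "\<And>x y. dist y x < e x \<Longrightarrow> f y = f x" by metis
  obtain D where D: "finite D" "UNIV \<subseteq> (\<Union>x\<in>D. ball x (e x))"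
  proof (rule compactE_image[OF compact_space, of UNIV "\<lambda>x. ball x (e x)"])
    show "UNIV \<subseteq> (\<Union>x. ball x (e x))" using e(1) by fastforce
  qed auto
  define r where "r = Min (insert 1 ((\<lambda>x. e x / 2) ` D))"
  have r: "0 < r" "\<And>x. x \<in> D \<Longrightarrow> r < e x"
  proof -
    show "0 < r" unfolding r_def using D(1) e(1) by auto
    fix x assume "x \<in> D"
    then have "r \<le> e x / 2" unfolding r_def using D(1) by (intro Min_le) auto
    then show "r < e x" using e(1)[of x] by linarith
  qed
  have "f y = f z" if "dist y z \<le> r" for y z
  proof -
    obtain x where x: "x \<in> D" "dist x y < e x" using D(2) by fastforce
    have "dist x z < e x" using ultrametric[of x z y] x that r(2)[OF x(1)] by linarith
    then show ?thesis using e(2)[of y x] e(2)[of z x] x by (simp add: dist_commute)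
  qed
  then show "\<exists>r>0. const_at_scale r f" using r(1) by (auto simp: const_at_scale_def)
next
  assume "\<exists>r>0. const_at_scale r f"
  then obtain r where r: "0 < r" "\<And>x y. dist x y \<le> r \<Longrightarrow> f x = f y"
    by (auto simp: const_at_scale_def)
  show "f \<in> test_functions"
    unfolding test_functions_def eventually_nhds_metric
    using r by (fastforce intro!: exI[of _ r])
qed

lemma test_functionE:
  assumes "f \<in> test_functions"
  obtains r where "0 < r" "const_at_scale r f"
  using assms test_function_iff by blast

lemma test_functionE2:
  assumes "f \<in> test_functions" "g \<in> test_functions"
  obtains r where "0 < r" "const_at_scale r f" "const_at_scale r g"
proof -
  obtain p q where "0 < p" "const_at_scale p f" "0 < q" "const_at_scale q g"
    using assms test_function_iff by metis
  then show ?thesis using that[of "min p q"] const_at_scale_mono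
    by (metis min.cobounded1 min.cobounded2 min_less_iff_conj)
qed

lemma test_function_comp2:
  assumes "f \<in> test_functions" "g \<in> test_functions"
  shows "(\<lambda>x. k (f x) (g x)) \<in> test_functions"
  using test_functionE2[OF assms] const_at_scale_comp(2) test_function_iff by metis

lemma test_function_comp:
  assumes "f \<in> test_functions"
  shows "(\<lambda>x. k (f x)) \<in> test_functions"
  using test_function_comp2[OF assms assms] .

lemma test_function_const: "(\<lambda>x. c) \<in> test_functions"
  by (auto simp: test_functions_def)

lemma test_function_indicator_disc:
  assumes "v \<in> discs"
  shows "(\<lambda>x. a * indicator v x) \<in> test_functions"
proof -
  obtain c r where "v = cball c r" "0 < r" using assms by (auto simp: discs_def)
  then show ?thesis using const_at_scale_indicator_cball[of r r a c] test_function_iff by blast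
qed

text \<open>
  A function constant at scale r is the finite sum of its values times the indicators of the
  balls of radius r.
\<close>

lemma const_at_scale_induct [consumes 2, case_names indicator add]:
  fixes f :: "'a::ultrametric_cantor_set \<Rightarrow> complex"
  assumes f: "const_at_scale r f" and r: "0 < r"
    and ind: "\<And>x a. P (\<lambda>y. a * indicator (cball x r) y)"
    and add: "\<And>f g. const_at_scale r f \<Longrightarrow> const_at_scale r g \<Longrightarrow> P f \<Longrightarrow> P g \<Longrightarrow> P (\<lambda>y. f y + g y)"
  shows "P f"
proof -
  let ?K = "range (center r :: 'a \<Rightarrow> 'a)"
  let ?g = "\<lambda>c y. f c * indicator (cball c r) y :: complex"
  have cs: "const_at_scale r (?g c)" for c
    by (rule const_at_scale_indicator_cball) simp
  have "const_at_scale r (\<lambda>y. \<Sum>c\<in>L. ?g c y) \<and> P (\<lambda>y. \<Sum>c\<in>L. ?g c y)" if "finite L" for L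
    using that
  proof (induction L)
    case empty
    show ?case using ind[of 0] by (simp add: const_at_scale_def)
  next
    case (insert c L)
    show ?case
      unfolding sum.insert[OF insert.hyps]
      using insert.IH add[OF cs[of c], of "\<lambda>y. \<Sum>c\<in>L. ?g c y"] ind[of "f c" c]
        const_at_scale_comp(2)[OF cs[of c], of "\<lambda>y. \<Sum>c\<in>L. ?g c y" "(+)"]
      by blast
  qed
  then have "P (\<lambda>y. \<Sum>c\<in>?K. ?g c y)" using finite_range_center[OF r] by blast
  also have "(\<lambda>y. \<Sum>c\<in>?K. ?g c y) = f"
  proof
    fix y
    have "(\<Sum>c\<in>?K. ?g c y) = (\<Sum>c\<in>?K. if c = center r y then f c else 0)"
    proof (rule sum.cong)
      fix c assume "c \<in> ?K"
      then obtain z where z: "c = center r z" by auto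
      have "y \<in> cball c r \<longleftrightarrow> c = center r y"
      proof
        assume "y \<in> cball c r"
        then have "dist z y \<le> r"
          using z dist_center[of r z] ultrametric[of z y c] r by auto
        then show "c = center r y" using z center_cong by metis
      next
        assume "c = center r y"
        then show "y \<in> cball c r" using dist_center[of r y] r by (auto simp: dist_commute)
      qed
      then show "?g c y = (if c = center r y then f c else 0)" by (auto simp: indicator_def)
    qed simp
    also have "\<dots> = f (center r y)"
      using sum.delta[OF finite_range_center[OF r], of "center r y" f] by auto
    also have "\<dots> = f y" using const_at_scale_center[OF f] r by simp
    finally show "(\<Sum>c\<in>?K. ?g c y) = f y" .
  qed
  finally show ?thesis .
qed

lemma test_function_induct [consumes 1, case_names indicator add]:
  fixes f :: "'a::ultrametric_cantor_set \<Rightarrow> complex"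
  assumes "f \<in> test_functions"
    and ind: "\<And>v a. v \<in> discs \<Longrightarrow> P (\<lambda>y. a * indicator v y)"
    and add: "\<And>f g. f \<in> test_functions \<Longrightarrow> g \<in> test_functions \<Longrightarrow> P f \<Longrightarrow> P g \<Longrightarrow> P (\<lambda>y. f y + g y)"
  shows "P f"
proof -
  obtain r where r: "0 < r" "const_at_scale r f" using assms(1) test_functionE by blast
  show ?thesis
    using r(2,1)
  proof (induction rule: const_at_scale_induct)
    case (indicator x a)
    show ?case using ind r(1) by (auto simp: discs_def)
  next
    case (add f g)
    then show ?case using assms(3) r(1) test_function_iff by blast
  qed
qed

lemma eventually_discs_at:
  assumes "0 < e"
  shows "eventually (\<lambda>v. v \<in> discs \<and> z \<in> v \<and> diameter v < e) (discs_at z)"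
  unfolding discs_at_def
  by (rule eventually_INF1[of e]) (auto simp: assms eventually_principal)

lemma discs_at_neq_bot: "discs_at (z::'a::ultrametric_cantor_set) \<noteq> bot"
proof
  assume "discs_at z = bot"
  then have "eventually (\<lambda>_. False) (INF e\<in>{0<..}. principal {v \<in> discs. z \<in> v \<and> diameter v < (e::real)})"
    by (simp add: discs_at_def)
  then obtain e :: real where e: "0 < e" "\<forall>v\<in>discs. z \<in> v \<longrightarrow> \<not> diameter v < e"
  proof (subst (asm) eventually_INF_base)
    fix i j :: real assume ij: "i \<in> {0<..}" "j \<in> {0<..}"
    show "\<exists>x\<in>{0<..}. principal {v \<in> discs. z \<in> v \<and> diameter v < x}
       \<le> principal {v \<in> discs. z \<in> v \<and> diameter v < i} \<sqinter> principal {v \<in> discs. z \<in> v \<and> diameter v < j}"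
      using ij by (intro bexI[of _ "min i j"]) auto
  qed (auto simp: eventually_principal intro: exI[of _ "1::real"])
  obtain y where y: "y \<noteq> z" "dist y z < e"
    using e(1) islimpt_UNIV[of z] by (auto simp: islimpt_approachable)
  moreover have "diameter (cball z (dist z y)) = dist z y" "cball z (dist z y) \<in> discs"
    using disc_join[of z y] y(1) by auto
  ultimately show False using e(2) by (auto simp: dist_commute)
qed

section \<open>The space of square integrable functions\<close>

lemma L2_measurable: "f \<in> L2 M \<Longrightarrow> f \<in> borel_measurable M"
  and L2_integrable: "f \<in> L2 M \<Longrightarrow> integrable M (\<lambda>x. (cmod (f x))\<^sup>2)"
  by (auto simp: L2_def)

lemma borel_measurable_cnj:
  assumes "f \<in> borel_measurable M"
  shows "(\<lambda>x. cnj (f x)) \<in> borel_measurable M"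
  by (rule measurable_compose[OF assms borel_measurable_continuous_onI])
    (intro continuous_intros)

lemma norm_add_sq_le: "(cmod (a + b))\<^sup>2 \<le> 2 * (cmod a)\<^sup>2 + 2 * (cmod b)\<^sup>2"
proof -
  have "(cmod (a + b))\<^sup>2 \<le> (cmod a + cmod b)\<^sup>2"
    by (simp add: norm_triangle_ineq power_mono)
  also have "\<dots> \<le> 2 * (cmod a)\<^sup>2 + 2 * (cmod b)\<^sup>2"
    using sum_squares_bound[of "cmod a" "cmod b"] by (simp add: power2_sum)
  finally show ?thesis .
qed

lemma L2_bound:
  assumes "f \<in> borel_measurable M" "integrable M h" "AE x in M. (cmod (f x))\<^sup>2 \<le> h x"
  shows "f \<in> L2 M"
proof -
  have "integrable M (\<lambda>x. (cmod (f x))\<^sup>2)"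
    by (rule Bochner_Integration.integrable_bound[OF assms(2)]) (use assms in auto)
  then show ?thesis using assms(1) by (simp add: L2_def)
qed

lemma L2_add:
  assumes "f \<in> L2 M" "g \<in> L2 M"
  shows "(\<lambda>x. f x + g x) \<in> L2 M"
  by (rule L2_bound[where h = "\<lambda>x. 2 * (cmod (f x))\<^sup>2 + 2 * (cmod (g x))\<^sup>2"])
    (use assms L2_integrable[OF assms(1)] L2_integrable[OF assms(2)] in
      \<open>auto simp: norm_add_sq_le intro!: borel_measurable_add dest: L2_measurable\<close>)

lemma L2_scale:
  assumes "f \<in> L2 M"
  shows "(\<lambda>x. c * f x) \<in> L2 M"
  by (rule L2_bound[where h = "\<lambda>x. (cmod c)\<^sup>2 * (cmod (f x))\<^sup>2"])
    (use L2_measurable[OF assms] L2_integrable[OF assms] in \<open>auto simp: norm_mult power_mult_distrib\<close>)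

lemma L2_uminus: "f \<in> L2 M \<Longrightarrow> (\<lambda>x. - f x) \<in> L2 M"
  using L2_scale[of f M "-1"] by simp

lemma L2_diff: "f \<in> L2 M \<Longrightarrow> g \<in> L2 M \<Longrightarrow> (\<lambda>x. f x - g x) \<in> L2 M"
  using L2_add[OF _ L2_uminus, of f M g] by simp

lemma L2_norm_nonneg [simp]: "0 \<le> L2_norm M f"
  by (simp add: L2_norm_def)

lemma L2_norm_sq: "(L2_norm M f)\<^sup>2 = (LINT x|M. (cmod (f x))\<^sup>2)"
  by (simp add: L2_norm_def)

lemma L2_inner_self: "L2_inner M f f = of_real ((L2_norm M f)\<^sup>2)"
  unfolding L2_norm_sq L2_inner_def
  by (subst integral_complex_of_real[symmetric], rule Bochner_Integration.integral_cong)
    (auto simp: complex_norm_square[symmetric] mult.commute)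

lemma L2_inner_integrable:
  assumes "f \<in> L2 M" "g \<in> L2 M"
  shows "integrable M (\<lambda>x. cnj (f x) * g x)"
proof (rule Bochner_Integration.integrable_bound)
  show "integrable M (\<lambda>x. (cmod (f x))\<^sup>2 + (cmod (g x))\<^sup>2)"
    by (intro Bochner_Integration.integrable_add L2_integrable assms)
  show "AE x in M. norm (cnj (f x) * g x) \<le> norm ((cmod (f x))\<^sup>2 + (cmod (g x))\<^sup>2)"
  proof (rule AE_I2)
    fix x
    have "cmod (f x) * cmod (g x) \<le> (cmod (f x))\<^sup>2 + (cmod (g x))\<^sup>2"
      using sum_squares_bound[of "cmod (f x)" "cmod (g x)"]
        mult_nonneg_nonneg[OF norm_ge_zero norm_ge_zero, of "f x" "g x"] by linarith
    then show "norm (cnj (f x) * g x) \<le> norm ((cmod (f x))\<^sup>2 + (cmod (g x))\<^sup>2)"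
      by (simp add: norm_mult)
  qed
  show "(\<lambda>x. cnj (f x) * g x) \<in> borel_measurable M"
    by (intro borel_measurable_times borel_measurable_cnj L2_measurable assms)
qed

lemma L2_norm_cong_AE:
  assumes "AE x in M. f x = f' x" "f \<in> borel_measurable M" "f' \<in> borel_measurable M"
  shows "L2_norm M f = L2_norm M f'"
  unfolding L2_norm_def using assms by (intro arg_cong[of _ _ sqrt] integral_cong_AE) auto

lemma L2_inner_cnj: "cnj (L2_inner M f g) = L2_inner M g f"
  unfolding L2_inner_def Bochner_Integration.integral_cnj[of M, symmetric] by (simp add: mult.commute)

lemma L2_inner_add_right:
  assumes "f \<in> L2 M" "g \<in> L2 M" "h \<in> L2 M"
  shows "L2_inner M f (\<lambda>x. g x + h x) = L2_inner M f g + L2_inner M f h"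
  unfolding L2_inner_def
  using L2_inner_integrable[OF assms(1,2)] L2_inner_integrable[OF assms(1,3)]
  by (simp add: distrib_left)

lemma L2_inner_scale_right: "L2_inner M f (\<lambda>x. c * g x) = c * L2_inner M f g"
  unfolding L2_inner_def by (simp add: mult.left_commute)

lemma L2_inner_scale_left: "L2_inner M (\<lambda>x. c * f x) g = cnj c * L2_inner M f g"
  unfolding L2_inner_def by (simp add: mult.assoc)

lemma L2_inner_add_left:
  assumes "f \<in> L2 M" "g \<in> L2 M" "h \<in> L2 M"
  shows "L2_inner M (\<lambda>x. f x + g x) h = L2_inner M f h + L2_inner M g h"
  unfolding L2_inner_def
  using L2_inner_integrable[OF assms(1,3)] L2_inner_integrable[OF assms(2,3)]
  by (simp add: distrib_right)

lemma L2_inner_diff_right: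
  assumes "f \<in> L2 M" "g \<in> L2 M" "h \<in> L2 M"
  shows "L2_inner M f (\<lambda>x. g x - h x) = L2_inner M f g - L2_inner M f h"
  unfolding L2_inner_def
  using L2_inner_integrable[OF assms(1,2)] L2_inner_integrable[OF assms(1,3)]
  by (simp add: right_diff_distrib)

lemma L2_inner_diff_left:
  assumes "f \<in> L2 M" "g \<in> L2 M" "h \<in> L2 M"
  shows "L2_inner M (\<lambda>x. f x - g x) h = L2_inner M f h - L2_inner M g h"
  unfolding L2_inner_def
  using L2_inner_integrable[OF assms(1,3)] L2_inner_integrable[OF assms(2,3)]
  by (simp add: left_diff_distrib)

text \<open>
  The optimal weight is \<open>t = b / a\<close>; enlarging a and b by e avoids the division by zero.
\<close>

lemma le_mult_of_weighted_mean:
  fixes a b c :: real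
  assumes "0 \<le> a" "0 \<le> b" "\<And>t. 0 < t \<Longrightarrow> 2 * c \<le> t * a\<^sup>2 + b\<^sup>2 / t"
  shows "c \<le> a * b"
proof -
  have "c \<le> (a + e) * (b + e)" if e: "0 < e" for e
  proof -
    have "2 * c \<le> (b + e) / (a + e) * a\<^sup>2 + b\<^sup>2 / ((b + e) / (a + e))"
      using assms(1,2) e by (intro assms(3)) (simp add: add_nonneg_pos)
    also have "\<dots> \<le> (b + e) / (a + e) * (a + e)\<^sup>2 + (b + e)\<^sup>2 / ((b + e) / (a + e))"
      using assms(1,2) e by (intro add_mono mult_left_mono divide_right_mono power_mono) auto
    also have "\<dots> = 2 * ((a + e) * (b + e))"
    proof -
      have "q / p * p\<^sup>2 + q\<^sup>2 / (q / p) = 2 * (p * q)" if "0 < p" "0 < q" for p q :: real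
        using that by (simp add: power2_eq_square)
      then show ?thesis using assms(1,2) e by (simp add: add_nonneg_pos)
    qed
    finally show ?thesis by simp
  qed
  moreover have "((\<lambda>e. (a + e) * (b + e)) \<longlongrightarrow> (a + 0) * (b + 0)) (at_right 0)"
    by (intro tendsto_intros)
  ultimately show ?thesis
    by (intro tendsto_lowerbound[of "\<lambda>e. (a + e) * (b + e)" "a * b" "at_right (0::real)"])
      (auto simp: eventually_at_right_less intro: eventually_mono[OF eventually_at_right_less])
qed

lemma L2_Cauchy_Schwarz_abs:
  assumes "f \<in> L2 M" "g \<in> L2 M"
  shows "(LINT x|M. cmod (f x) * cmod (g x)) \<le> L2_norm M f * L2_norm M g"
proof (rule le_mult_of_weighted_mean)
  fix t :: real assume t: "0 < t"
  have *: "2 * (cmod (f x) * cmod (g x)) \<le> t * (cmod (f x))\<^sup>2 + (cmod (g x))\<^sup>2 / t" for x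
  proof -
    have "2 * (sqrt t * cmod (f x)) * (cmod (g x) / sqrt t)
        \<le> (sqrt t * cmod (f x))\<^sup>2 + (cmod (g x) / sqrt t)\<^sup>2"
      by (rule sum_squares_bound)
    then show ?thesis using t by (simp add: power_mult_distrib power_divide)
  qed
  have int: "integrable M (\<lambda>x. cmod (f x) * cmod (g x))"
    using integrable_norm[OF L2_inner_integrable[OF assms]] by (simp add: norm_mult)
  have "2 * (LINT x|M. cmod (f x) * cmod (g x)) = (LINT x|M. 2 * (cmod (f x) * cmod (g x)))"
    by simp
  also have "\<dots> \<le> (LINT x|M. t * (cmod (f x))\<^sup>2 + (cmod (g x))\<^sup>2 / t)"
    using int L2_integrable[OF assms(1)] L2_integrable[OF assms(2)] *
    by (intro integral_mono) auto
  also have "\<dots> = t * (L2_norm M f)\<^sup>2 + (L2_norm M g)\<^sup>2 / t"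
    unfolding L2_norm_sq using L2_integrable[OF assms(1)] L2_integrable[OF assms(2)] by simp
  finally show "2 * (LINT x|M. cmod (f x) * cmod (g x)) \<le> t * (L2_norm M f)\<^sup>2 + (L2_norm M g)\<^sup>2 / t" .
qed auto

lemma L2_Cauchy_Schwarz:
  assumes "f \<in> L2 M" "g \<in> L2 M"
  shows "cmod (L2_inner M f g) \<le> L2_norm M f * L2_norm M g"
proof -
  have "cmod (L2_inner M f g) \<le> (LINT x|M. cmod (cnj (f x) * g x))"
    unfolding L2_inner_def by (rule integral_norm_bound)
  then show ?thesis using L2_Cauchy_Schwarz_abs[OF assms] by (simp add: norm_mult)
qed

lemma L2_norm_triangle:
  assumes "f \<in> L2 M" "g \<in> L2 M"
  shows "L2_norm M (\<lambda>x. f x + g x) \<le> L2_norm M f + L2_norm M g"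
proof (rule power2_le_imp_le)
  have int: "integrable M (\<lambda>x. cmod (f x) * cmod (g x))"
    using integrable_norm[OF L2_inner_integrable[OF assms]] by (simp add: norm_mult)
  note ints = L2_integrable[OF assms(1)] L2_integrable[OF assms(2)] int
  have "(L2_norm M (\<lambda>x. f x + g x))\<^sup>2 \<le>
      (LINT x|M. (cmod (f x))\<^sup>2 + (cmod (g x))\<^sup>2 + 2 * (cmod (f x) * cmod (g x)))"
    unfolding L2_norm_sq
  proof (intro integral_mono)
    fix x
    have "(cmod (f x + g x))\<^sup>2 \<le> (cmod (f x) + cmod (g x))\<^sup>2"
      by (simp add: norm_triangle_ineq power_mono)
    then show "(cmod (f x + g x))\<^sup>2 \<le> (cmod (f x))\<^sup>2 + (cmod (g x))\<^sup>2 + 2 * (cmod (f x) * cmod (g x))"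
      by (simp add: power2_sum)
  qed (use ints L2_integrable[OF L2_add[OF assms]] in auto)
  also have "\<dots> = (L2_norm M f)\<^sup>2 + (L2_norm M g)\<^sup>2 + 2 * (LINT x|M. cmod (f x) * cmod (g x))"
    unfolding L2_norm_sq using ints by simp
  also have "\<dots> \<le> (L2_norm M f + L2_norm M g)\<^sup>2"
    using L2_Cauchy_Schwarz_abs[OF assms] by (simp add: power2_sum)
  finally show "(L2_norm M (\<lambda>x. f x + g x))\<^sup>2 \<le> (L2_norm M f + L2_norm M g)\<^sup>2" .
qed simp

lemma L2_norm_scale: "L2_norm M (\<lambda>x. c * f x) = cmod c * L2_norm M f"
  by (simp add: L2_norm_def norm_mult power_mult_distrib real_sqrt_mult)

lemma L2_norm_uminus: "L2_norm M (\<lambda>x. - f x) = L2_norm M f"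
  by (simp add: L2_norm_def)

lemma L2_norm_minus_commute: "L2_norm M (\<lambda>x. f x - g x) = L2_norm M (\<lambda>x. g x - f x)"
  by (simp add: L2_norm_def norm_minus_commute)

lemma L2_norm_triangle_diff:
  assumes "f \<in> L2 M" "g \<in> L2 M" "h \<in> L2 M"
  shows "L2_norm M (\<lambda>x. f x - h x) \<le> L2_norm M (\<lambda>x. f x - g x) + L2_norm M (\<lambda>x. g x - h x)"
  using L2_norm_triangle[OF L2_diff[OF assms(1,2)] L2_diff[OF assms(2,3)]] by simp

lemma L2_norm_le_diff:
  assumes "f \<in> L2 M" "g \<in> L2 M"
  shows "L2_norm M f \<le> L2_norm M (\<lambda>x. f x - g x) + L2_norm M g"
  using L2_norm_triangle[OF L2_diff[OF assms] assms(2)] by simp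

lemma L2_norm_zero_AE:
  assumes "f \<in> L2 M" "L2_norm M f = 0"
  shows "AE x in M. f x = 0"
proof -
  have "(LINT x|M. (cmod (f x))\<^sup>2) = 0" using assms(2) by (simp add: L2_norm_def)
  then have "AE x in M. (cmod (f x))\<^sup>2 = 0"
    using integral_nonneg_eq_0_iff_AE[OF L2_integrable[OF assms(1)]] by simp
  then show ?thesis by simp
qed

lemma L2_norm_diff_zero_AE:
  assumes "f \<in> L2 M" "g \<in> L2 M" "L2_norm M (\<lambda>x. f x - g x) = 0"
  shows "AE x in M. f x = g x"
  using L2_norm_zero_AE[OF L2_diff[OF assms(1,2)] assms(3)] by simp

lemma L2_norm_diff_eq_0I:
  assumes "AE x in M. f x = g x"
  shows "L2_norm M (\<lambda>x. f x - g x) = 0"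
proof -
  have "(LINT x|M. (cmod (f x - g x))\<^sup>2) = 0"
    by (rule integral_eq_zero_AE) (use assms in auto)
  then show ?thesis by (simp add: L2_norm_def)
qed

lemma L2_inner_tendsto:
  assumes "\<And>n. F n \<in> L2 M" "\<And>n. G n \<in> L2 M" "f \<in> L2 M" "g \<in> L2 M"
    and "(\<lambda>n. L2_norm M (\<lambda>x. F n x - f x)) \<longlonglongrightarrow> 0"
    and "(\<lambda>n. L2_norm M (\<lambda>x. G n x - g x)) \<longlonglongrightarrow> 0"
  shows "(\<lambda>n. L2_inner M (F n) (G n)) \<longlonglongrightarrow> L2_inner M f g"
proof -
  have "(\<lambda>n. L2_inner M (F n) (G n) - L2_inner M f g) \<longlonglongrightarrow> 0"
  proof (rule Lim_null_comparison)
    let ?a = "\<lambda>n. L2_norm M (\<lambda>x. F n x - f x)"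
    let ?b = "\<lambda>n. L2_norm M (\<lambda>x. G n x - g x)"
    show "\<forall>\<^sub>F n in sequentially. norm (L2_inner M (F n) (G n) - L2_inner M f g)
        \<le> ?a n * (?b n + L2_norm M g) + L2_norm M f * ?b n"
    proof (rule always_eventually, rule allI)
      fix n
      have "L2_inner M (F n) (G n) - L2_inner M f g =
          L2_inner M (\<lambda>x. F n x - f x) (G n) + L2_inner M f (\<lambda>x. G n x - g x)"
        by (simp add: L2_inner_diff_left L2_inner_diff_right assms)
      then have "cmod (L2_inner M (F n) (G n) - L2_inner M f g) \<le>
          ?a n * L2_norm M (G n) + L2_norm M f * ?b n"
        using order_trans[OF norm_triangle_ineq
            add_mono[OF L2_Cauchy_Schwarz[OF L2_diff[OF assms(1,3)] assms(2)]
              L2_Cauchy_Schwarz[OF assms(3) L2_diff[OF assms(2,4)]]]]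
        by simp
      moreover have "?a n * L2_norm M (G n) \<le> ?a n * (?b n + L2_norm M g)"
        by (intro mult_left_mono L2_norm_le_diff assms) simp
      ultimately show "norm (L2_inner M (F n) (G n) - L2_inner M f g)
        \<le> ?a n * (?b n + L2_norm M g) + L2_norm M f * ?b n" by linarith
    qed
    have "(\<lambda>n. ?a n * (?b n + L2_norm M g) + L2_norm M f * ?b n) \<longlonglongrightarrow>
        0 * (0 + L2_norm M g) + L2_norm M f * 0"
      by (intro tendsto_intros assms)
    then show "(\<lambda>n. ?a n * (?b n + L2_norm M g) + L2_norm M f * ?b n) \<longlonglongrightarrow> 0" by simp
  qed
  then show ?thesis by (simp add: LIM_zero_iff)
qed

lemma integral_complex_indicator:
  assumes "A \<in> sets M"
  shows "(LINT x|M. indicator A x) = complex_of_real (measure M A)"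
proof -
  have "(LINT x|M. indicator A x) = (LINT x|M. complex_of_real (indicator A x))"
    by (rule Bochner_Integration.integral_cong) (auto simp: indicator_def)
  also have "\<dots> = of_real (LINT x|M. indicator A x)" by (rule integral_complex_of_real)
  finally show ?thesis using sets.sets_into_space[OF assms] by (simp add: Int_absorb2)
qed

section \<open>Test functions are dense\<close>

locale cantor_measure = prob_space \<mu> for \<mu> :: "'a::ultrametric_cantor_set measure" +
  assumes sets_eq: "sets \<mu> = sets borel"
    and full_support: "measure_support \<mu> = UNIV"
begin

lemma space_eq: "space \<mu> = UNIV"
  using sets_eq_imp_space_eq[OF sets_eq] by simp

lemma measurable_eq: "measurable \<mu> N = measurable borel N"
  by (rule measurable_cong_sets) (auto simp: sets_eq)

lemma test_measurable: "f \<in> test_functions \<Longrightarrow> f \<in> borel_measurable borel"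
  using borel_measurable_continuous_onI const_at_scale_continuous test_functionE by metis

lemma disc_sets: "v \<in> discs \<Longrightarrow> v \<in> sets \<mu>"
  by (auto simp: discs_def sets_eq)

lemma open_measure_pos:
  assumes "open U" "U \<noteq> {}"
  shows "0 < measure \<mu> U"
proof -
  obtain x where "x \<in> U" using assms(2) by auto
  moreover have "x \<in> measure_support \<mu>" using full_support by auto
  ultimately have "0 < emeasure \<mu> U" using assms(1) by (auto simp: measure_support_def)
  then show ?thesis by (simp add: emeasure_eq_measure)
qed

lemma cball_measure_pos: "0 < r \<Longrightarrow> 0 < measure \<mu> (cball x r)"
proof -
  assume r: "0 < r"
  have "0 < measure \<mu> (ball x r)" using r by (intro open_measure_pos) auto
  also have "\<dots> \<le> measure \<mu> (cball x r)"
    by (rule finite_measure_mono) (auto simp: sets_eq)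
  finally show ?thesis .
qed

lemma disc_measure_pos: "v \<in> discs \<Longrightarrow> 0 < measure \<mu> v"
  using cball_measure_pos by (auto simp: discs_def)

lemma bounded_L2:
  assumes "f \<in> borel_measurable borel" "\<And>x. cmod (f x) \<le> B"
  shows "f \<in> L2 \<mu>"
proof (rule L2_bound[where h = "\<lambda>x. B\<^sup>2"])
  show "AE x in \<mu>. (cmod (f x))\<^sup>2 \<le> B\<^sup>2"
    using assms(2) by (auto intro!: power_mono)
qed (use assms in \<open>auto simp: measurable_eq\<close>)

lemma test_bounded:
  assumes "f \<in> test_functions"
  obtains B where "\<And>x::'a. cmod (f x) \<le> B"
proof -
  have "finite (range f)" using assms const_at_scale_finite_range test_functionE by metis
  then have "bounded (range f)" by (rule finite_imp_bounded)
  then show ?thesis using that by (auto simp: bounded_iff)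
qed

lemma test_L2: "f \<in> test_functions \<Longrightarrow> f \<in> L2 \<mu>"
  using bounded_L2[OF test_measurable] test_bounded by metis

lemma test_integrable:
  assumes "f \<in> (test_functions :: ('a \<Rightarrow> complex) set)"
  shows "integrable \<mu> f"
proof -
  obtain B where "\<And>x. norm (f x) \<le> B" using test_bounded[OF assms] by blast
  then show ?thesis
    by (intro integrable_const_bound[where B = B])
      (use test_measurable[OF assms] in \<open>auto simp: measurable_eq\<close>)
qed

lemma L2_integrable1: "f \<in> L2 \<mu> \<Longrightarrow> integrable \<mu> f"
  using L2_inner_integrable[OF test_L2[OF test_function_const[of 1]], of f] by simp

text \<open>
  Density is proved by showing that the L2-closure of the test functions is a vector space closed
  under limits which contains the indicators of Borel sets.
\<close>

definition approximable :: "('a \<Rightarrow> complex) \<Rightarrow> bool" where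
  "approximable f \<longleftrightarrow> f \<in> L2 \<mu> \<and> (\<forall>e>0. \<exists>u\<in>test_functions. L2_norm \<mu> (\<lambda>x. f x - u x) < e)"

lemma approximable_test: "u \<in> test_functions \<Longrightarrow> approximable u"
  unfolding approximable_def using test_L2 by (auto intro!: bexI[of _ u] simp: L2_norm_def)

lemma approximable_add:
  assumes "approximable f" "approximable g"
  shows "approximable (\<lambda>x. f x + g x)"
  unfolding approximable_def
proof (intro conjI allI impI)
  have L: "f \<in> L2 \<mu>" "g \<in> L2 \<mu>" using assms by (auto simp: approximable_def)
  then show "(\<lambda>x. f x + g x) \<in> L2 \<mu>" by (rule L2_add)
  fix e :: real assume "0 < e"
  then have e2: "0 < e / 2" by simp
  obtain u v where u: "u \<in> test_functions" "L2_norm \<mu> (\<lambda>x. f x - u x) < e/2"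
    and v: "v \<in> test_functions" "L2_norm \<mu> (\<lambda>x. g x - v x) < e/2"
    using assms e2 unfolding approximable_def by blast
  have "L2_norm \<mu> (\<lambda>x. (f x - u x) + (g x - v x)) < e"
    using L2_norm_triangle[OF L2_diff[OF L(1) test_L2[OF u(1)]] L2_diff[OF L(2) test_L2[OF v(1)]]]
      u(2) v(2) by linarith
  then show "\<exists>w\<in>test_functions. L2_norm \<mu> (\<lambda>x. (f x + g x) - w x) < e"
    by (intro bexI[of _ "\<lambda>x. u x + v x"])
      (auto simp: algebra_simps intro: test_function_comp2[OF u(1) v(1)])
qed

lemma approximable_scale:
  assumes "approximable f"
  shows "approximable (\<lambda>x. c * f x)"
  unfolding approximable_def
proof (intro conjI allI impI)
  have L: "f \<in> L2 \<mu>" using assms by (auto simp: approximable_def)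
  then show "(\<lambda>x. c * f x) \<in> L2 \<mu>" by (rule L2_scale)
  fix e :: real assume e: "0 < e"
  have "0 < e / (cmod c + 1)" using e by (simp add: add_nonneg_pos)
  then obtain u where u: "u \<in> test_functions" "L2_norm \<mu> (\<lambda>x. f x - u x) < e / (cmod c + 1)"
    using assms unfolding approximable_def by blast
  have "L2_norm \<mu> (\<lambda>x. c * (f x - u x)) \<le> (cmod c + 1) * L2_norm \<mu> (\<lambda>x. f x - u x)"
    unfolding L2_norm_scale by (intro mult_right_mono) auto
  also have "\<dots> < e" using u(2) by (simp add: pos_less_divide_eq add_nonneg_pos mult.commute)
  finally show "\<exists>w\<in>test_functions. L2_norm \<mu> (\<lambda>x. c * f x - w x) < e"
    by (intro bexI[of _ "\<lambda>x. c * u x"])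
      (auto simp: algebra_simps intro: test_function_comp[OF u(1)])
qed

lemma approximable_limit:
  assumes "f \<in> L2 \<mu>" "\<And>n. approximable (F n)"
    "(\<lambda>n. L2_norm \<mu> (\<lambda>x. f x - F n x)) \<longlonglongrightarrow> 0"
  shows "approximable f"
  unfolding approximable_def
proof (intro conjI allI impI)
  fix e :: real assume "0 < e"
  then have e2: "0 < e / 2" by simp
  then have "\<forall>\<^sub>F n in sequentially. L2_norm \<mu> (\<lambda>x. f x - F n x) < e/2"
    using order_tendstoD(2)[OF assms(3)] by blast
  then obtain n where n: "L2_norm \<mu> (\<lambda>x. f x - F n x) < e/2"
    by (meson eventually_happens trivial_limit_sequentially)
  obtain u where u: "u \<in> test_functions" "L2_norm \<mu> (\<lambda>x. F n x - u x) < e/2"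
    and Fn: "F n \<in> L2 \<mu>"
    using assms(2)[of n] e2 unfolding approximable_def by blast
  have "L2_norm \<mu> (\<lambda>x. f x - u x) < e"
    using L2_norm_triangle_diff[OF assms(1) Fn test_L2[OF u(1)]] n u(2) by linarith
  then show "\<exists>w\<in>test_functions. L2_norm \<mu> (\<lambda>x. f x - w x) < e" using u(1) by blast
qed (rule assms)

lemma L2_norm_dominated:
  assumes "f \<in> L2 \<mu>" "\<And>n. F n \<in> borel_measurable \<mu>" "integrable \<mu> h"
    "\<And>x. (\<lambda>n. F n x) \<longlonglongrightarrow> f x" "\<And>n x. (cmod (f x - F n x))\<^sup>2 \<le> h x"
  shows "(\<lambda>n. L2_norm \<mu> (\<lambda>x. f x - F n x)) \<longlonglongrightarrow> 0"
proof -
  have "(\<lambda>n. LINT x|\<mu>. (cmod (f x - F n x))\<^sup>2) \<longlonglongrightarrow> (LINT x|\<mu>. 0)"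
  proof (rule integral_dominated_convergence[where w = h])
    show "AE x in \<mu>. (\<lambda>n. (cmod (f x - F n x))\<^sup>2) \<longlonglongrightarrow> 0"
    proof (rule AE_I2)
      fix x
      have "(\<lambda>n. (cmod (f x - F n x))\<^sup>2) \<longlonglongrightarrow> (cmod (f x - f x))\<^sup>2"
        by (intro tendsto_intros assms)
      then show "(\<lambda>n. (cmod (f x - F n x))\<^sup>2) \<longlonglongrightarrow> 0" by simp
    qed
  qed (use assms L2_measurable[OF assms(1)] in auto)
  then have "(\<lambda>n. sqrt (LINT x|\<mu>. (cmod (f x - F n x))\<^sup>2)) \<longlonglongrightarrow> sqrt (LINT x|\<mu>. 0)"
    by (rule tendsto_real_sqrt)
  then show ?thesis by (simp add: L2_norm_def)
qed

definition clopen_sets :: "'a set set" where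
  "clopen_sets = {A. (indicator A :: 'a \<Rightarrow> complex) \<in> test_functions}"

lemma clopen_iff: "A \<in> clopen_sets \<longleftrightarrow> (\<exists>r>0. const_at_scale r (\<lambda>x. x \<in> A))"
proof -
  have "const_at_scale r (indicator A :: 'a \<Rightarrow> complex) \<longleftrightarrow> const_at_scale r (\<lambda>x. x \<in> A)" for r
    unfolding const_at_scale_def indicator_def by auto
  then show ?thesis by (simp add: clopen_sets_def test_function_iff)
qed

lemma clopen_combine:
  assumes "A \<in> clopen_sets" "B \<in> clopen_sets"
  shows "{x. k (x \<in> A) (x \<in> B)} \<in> clopen_sets"
proof -
  obtain p q where "0 < p" "const_at_scale p (\<lambda>x. x \<in> A)" "0 < q" "const_at_scale q (\<lambda>x. x \<in> B)"
    using assms unfolding clopen_iff by blast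
  then have "0 < min p q" "const_at_scale (min p q) (\<lambda>x. k (x \<in> A) (x \<in> B))"
    by (auto simp: const_at_scale_def)
  then show ?thesis unfolding clopen_iff mem_Collect_eq by (intro exI[of _ "min p q"]) simp
qed

lemma test_function_indicator: "A \<in> clopen_sets \<Longrightarrow> (indicator A :: 'a \<Rightarrow> complex) \<in> test_functions"
  by (simp add: clopen_sets_def)

lemma clopen_Int: "A \<in> clopen_sets \<Longrightarrow> B \<in> clopen_sets \<Longrightarrow> A \<inter> B \<in> clopen_sets"
  and clopen_Un: "A \<in> clopen_sets \<Longrightarrow> B \<in> clopen_sets \<Longrightarrow> A \<union> B \<in> clopen_sets"
  and clopen_Diff: "A \<in> clopen_sets \<Longrightarrow> B \<in> clopen_sets \<Longrightarrow> A - B \<in> clopen_sets"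
  using clopen_combine[of A B "(\<and>)"] clopen_combine[of A B "(\<or>)"]
    clopen_combine[of A B "\<lambda>a b. a \<and> \<not> b"]
  by (auto simp: Int_def Un_def set_diff_eq)

lemma clopen_UNIV: "UNIV \<in> clopen_sets" and clopen_empty: "{} \<in> clopen_sets"
  unfolding clopen_iff const_at_scale_def using zero_less_one[where ?'a = real] by blast+

lemma disc_clopen: "v \<in> discs \<Longrightarrow> v \<in> clopen_sets"
  using test_function_indicator_disc[of v 1] by (simp add: clopen_sets_def)

lemma clopen_open:
  assumes "A \<in> clopen_sets"
  shows "open A"
proof -
  obtain r where "0 < r" "const_at_scale r (\<lambda>x. x \<in> A)"
    using assms unfolding clopen_iff by blast
  then show ?thesis by (intro open_of_scale[of r]) (auto simp: const_at_scale_def)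
qed

lemma clopen_closed: "A \<in> clopen_sets \<Longrightarrow> closed A"
  using clopen_open[OF clopen_Diff[OF clopen_UNIV]] by (simp add: closed_def Compl_eq_Diff_UNIV)

lemma countable_discs: "countable (discs :: 'a set set)"
proof -
  have "(discs :: 'a set set) \<subseteq> (\<Union>n. {v \<in> discs. 1 / real (Suc n) < diameter v})"
  proof
    fix v :: "'a set" assume v: "v \<in> discs"
    then obtain n where "1 / real (Suc n) < diameter v"
      using reals_Archimedean[OF disc_diameter_pos[OF v]] by (auto simp: inverse_eq_divide)
    then show "v \<in> (\<Union>n. {v \<in> discs. 1 / real (Suc n) < diameter v})" using v by blast
  qed
  moreover have "countable (\<Union>n. {v \<in> (discs :: 'a set set). 1 / real (Suc n) < diameter v})"
    by (rule countable_UN[OF countableI_type], rule countable_finite, rule finite_large_discs) simp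
  ultimately show ?thesis by (rule countable_subset)
qed

lemma disc_in_ball:
  fixes x :: 'a
  assumes "0 < e"
  obtains v where "v \<in> discs" "x \<in> v" "v \<subseteq> ball x e"
proof
  show "cball x (e/2) \<in> discs" "x \<in> cball x (e/2)" "cball x (e/2) \<subseteq> ball x e"
    using assms unfolding discs_def by (auto intro!: exI[of _ "e/2"])
qed

text \<open>
  There are only countably many discs and every open set is a union of discs, so the
  clopen sets generate the Borel sets.
\<close>

lemma sigma_sets_clopen: "sigma_sets UNIV clopen_sets = sets borel"
proof -
  have "sigma_sets UNIV {S :: 'a set. open S} = sigma_sets UNIV clopen_sets"
  proof (rule sigma_sets_eqI)
    fix S :: "'a set" assume "S \<in> {S. open S}"
    then have op: "open S" by simp
    have "S = \<Union>{v \<in> discs. v \<subseteq> S}"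
    proof (intro equalityI subsetI)
      fix x assume "x \<in> S"
      then obtain e where e: "0 < e" "ball x e \<subseteq> S" using op openE by blast
      obtain v where "v \<in> discs" "x \<in> v" "v \<subseteq> ball x e" using disc_in_ball[OF e(1)] by metis
      then show "x \<in> \<Union>{v \<in> discs. v \<subseteq> S}" using e(2) by auto
    qed auto
    moreover have "\<Union>{v \<in> discs. v \<subseteq> S} \<in> sigma_sets UNIV clopen_sets"
    proof (rule sigma_sets_UNION)
      show "countable {v \<in> discs. v \<subseteq> S}" using countable_discs by (auto intro: countable_subset)
      show "b \<in> sigma_sets UNIV clopen_sets" if "b \<in> {v \<in> discs. v \<subseteq> S}" for b
        using that disc_clopen by auto
    qed
    ultimately show "S \<in> sigma_sets UNIV clopen_sets" by simp
  qed (use clopen_open in auto)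
  then show ?thesis by (simp add: borel_def)
qed

lemma Int_stable_clopen: "Int_stable clopen_sets"
  by (auto simp: Int_stable_def clopen_Int)

text \<open>
  A Dynkin system argument starting from the clopen sets, whose indicators are test functions.
\<close>

lemma approximable_indicator:
  assumes "A \<in> sets borel"
  shows "approximable (indicator A)"
proof -
  have L: "indicator A \<in> L2 \<mu>" if "A \<in> sets borel" for A
    using that by (intro bounded_L2[of _ 1]) (auto simp: indicator_def)
  have "clopen_sets \<subseteq> Pow UNIV" by simp
  from Int_stable_clopen this assms[folded sigma_sets_clopen] show ?thesis
  proof (induction rule: sigma_sets_induct_disjoint)
    case (basic A)
    then show ?case using approximable_test test_function_indicator by blast
  next
    case empty
    then show ?case using approximable_test[OF test_function_const[of 0]] by simp
  next
    case (compl A)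
    have "approximable (\<lambda>x. 1 + - 1 * indicator A x)"
      by (intro approximable_add approximable_scale approximable_test test_function_const compl)
    also have "(\<lambda>x. 1 + - 1 * indicator A x) = (indicator (UNIV - A) :: 'a \<Rightarrow> complex)"
      by (auto simp: indicator_def)
    finally show ?case .
  next
    case (union A)
    let ?F = "\<lambda>n x. \<Sum>i<n. indicator (A i) x :: complex"
    have A: "A i \<in> sets borel" for i using union(2) by (auto simp: sigma_sets_clopen)
    have F: "(\<Sum>i<n. indicator (A i) x :: complex) = indicator (\<Union>i<n. A i) x" for n x
      using union(1)
      by (subst indicator_UN_disjoint) (auto simp: disjoint_family_on_def)
    show ?case
    proof (rule approximable_limit)
      show "indicator (\<Union>i. A i) \<in> L2 \<mu>" using A by (intro L) auto
      show "approximable (?F n)" for n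
      proof (induction n)
        case 0
        then show ?case using approximable_test[OF test_function_const[of 0]] by simp
      next
        case (Suc n)
        then show ?case using approximable_add[OF Suc union(3)[of n]] by simp
      qed
      show "(\<lambda>n. L2_norm \<mu> (\<lambda>x. indicator (\<Union>i. A i) x - ?F n x)) \<longlonglongrightarrow> 0"
      proof (rule L2_norm_dominated[where h = "\<lambda>_. 1"])
        show "indicator (\<Union>i. A i) \<in> L2 \<mu>" using A by (intro L) auto
        show "?F n \<in> borel_measurable \<mu>" for n
          using A by (auto simp: measurable_eq intro!: borel_measurable_sum)
        show "(\<lambda>n. ?F n x) \<longlonglongrightarrow> indicator (\<Union>i. A i) x" for x
          unfolding F by (rule LIMSEQ_indicator_UN)
        show "(cmod (indicator (\<Union>i. A i) x - ?F n x))\<^sup>2 \<le> 1" for n x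
          unfolding F by (auto simp: indicator_def)
      qed simp
    qed
  qed
qed

proposition test_functions_dense:
  assumes f: "f \<in> L2 \<mu>" and "0 < e"
  obtains u where "u \<in> test_functions" "L2_norm \<mu> (\<lambda>x. f x - u x) < e"
proof -
  obtain F where F: "\<And>i. simple_function \<mu> (F i)" "\<And>x. (\<lambda>i. F i x) \<longlonglongrightarrow> f x"
    "\<And>i x. cmod (F i x) \<le> 2 * cmod (f x)"
    using borel_measurable_implies_sequence_metric[OF L2_measurable[OF f], of 0]
    by (auto simp: space_eq)
  have "approximable f"
  proof (rule approximable_limit[OF f])
    fix n
    have fin: "finite (range (F n))" using simple_functionD(1)[OF F(1)[of n]] by (simp add: space_eq)
    have meas: "F n -` {c} \<in> sets borel" for c
      using simple_functionD(2)[OF F(1)[of n], of "{c}"] by (simp add: space_eq sets_eq)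
    have "approximable (\<lambda>x. \<Sum>c\<in>S. c * indicator (F n -` {c}) x)" if "finite S" for S
      using that
    proof (induction S)
      case empty
      then show ?case using approximable_test[OF test_function_const[of 0]] by simp
    next
      case (insert c S)
      show ?case
        unfolding sum.insert[OF insert.hyps]
        by (intro approximable_add approximable_scale approximable_indicator meas insert.IH)
    qed
    from this[OF fin] have "approximable (\<lambda>x. \<Sum>c\<in>range (F n). c * indicator (F n -` {c}) x)" .
    also have "(\<lambda>x. \<Sum>c\<in>range (F n). c * indicator (F n -` {c}) x) = F n"
    proof
      fix x
      have "(\<Sum>c\<in>range (F n). c * indicator (F n -` {c}) x) = (\<Sum>c\<in>range (F n). if c = F n x then c else 0)"
        by (intro sum.cong) (auto simp: indicator_def)
      also have "\<dots> = F n x" using sum.delta[OF fin, of "F n x" "\<lambda>c. c"] by simp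
      finally show "(\<Sum>c\<in>range (F n). c * indicator (F n -` {c}) x) = F n x" .
    qed
    finally show "approximable (F n)" .
  next
    show "(\<lambda>n. L2_norm \<mu> (\<lambda>x. f x - F n x)) \<longlonglongrightarrow> 0"
    (* |F n| is at most 2 |f|, so |f - F n| is at most 3 |f| *)
    proof (rule L2_norm_dominated[where h = "\<lambda>x. 9 * (cmod (f x))\<^sup>2"])
      show "(cmod (f x - F n x))\<^sup>2 \<le> 9 * (cmod (f x))\<^sup>2" for n x
      proof -
        have "cmod (f x - F n x) \<le> 3 * cmod (f x)"
          using norm_triangle_ineq4[of "f x" "F n x"] F(3)[of n x] by linarith
        then have "(cmod (f x - F n x))\<^sup>2 \<le> (3 * cmod (f x))\<^sup>2" by (intro power_mono) auto
        then show ?thesis by (simp add: power_mult_distrib)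
      qed
      show "F n \<in> borel_measurable \<mu>" for n using F(1) by (rule borel_measurable_simple_function)
    qed (use f F(2) L2_integrable[OF f] in auto)
  qed
  then show ?thesis using that \<open>0 < e\<close> unfolding approximable_def by blast
qed

lemma test_functions_dense_seq:
  assumes f: "f \<in> L2 \<mu>"
  obtains F where "\<And>n. F n \<in> test_functions" "(\<lambda>n. L2_norm \<mu> (\<lambda>x. F n x - f x)) \<longlonglongrightarrow> 0"
proof -
  have "\<exists>u. u \<in> test_functions \<and> L2_norm \<mu> (\<lambda>x. f x - u x) < 1 / real (Suc n)" for n
    using test_functions_dense[OF f, of "1 / real (Suc n)"] by auto
  then obtain F where F: "\<And>n. F n \<in> test_functions"
    "\<And>n. L2_norm \<mu> (\<lambda>x. f x - F n x) < 1 / real (Suc n)" by metis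
  have "(\<lambda>n. L2_norm \<mu> (\<lambda>x. F n x - f x)) \<longlonglongrightarrow> 0"
  proof (rule Lim_null_comparison)
    show "\<forall>\<^sub>F n in sequentially. norm (L2_norm \<mu> (\<lambda>x. F n x - f x)) \<le> 1 / real (Suc n)"
      using less_imp_le[OF F(2)]
      by (auto intro!: always_eventually simp: L2_norm_minus_commute[of \<mu> _ f])
    show "(\<lambda>n. 1 / real (Suc n)) \<longlonglongrightarrow> 0" by (rule LIMSEQ_Suc[OF lim_1_over_n])
  qed
  then show ?thesis using that F(1) by blast
qed

text \<open>
  Operators act on representatives of classes, so differences are respected only up to null sets.
  Together with the norm bound, this determines an operator on L2 by its values on test functions.
\<close>

definition L2_bounded_op :: "(('a \<Rightarrow> complex) \<Rightarrow> 'a \<Rightarrow> complex) \<Rightarrow> bool" where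
  "L2_bounded_op U \<longleftrightarrow> (\<forall>f\<in>L2 \<mu>. U f \<in> L2 \<mu>) \<and>
     (\<forall>f\<in>L2 \<mu>. \<forall>g\<in>L2 \<mu>. AE x in \<mu>. U (\<lambda>y. f y - g y) x = U f x - U g x) \<and>
     (\<exists>K. \<forall>f\<in>L2 \<mu>. L2_norm \<mu> (U f) \<le> K * L2_norm \<mu> f)"

lemma L2_bounded_op_diff:
  assumes "L2_bounded_op U"
  obtains K where "0 \<le> K" "\<And>f g. f \<in> L2 \<mu> \<Longrightarrow> g \<in> L2 \<mu> \<Longrightarrow>
    L2_norm \<mu> (\<lambda>x. U f x - U g x) \<le> K * L2_norm \<mu> (\<lambda>x. f x - g x)"
proof -
  obtain K where K: "\<And>f. f \<in> L2 \<mu> \<Longrightarrow> L2_norm \<mu> (U f) \<le> K * L2_norm \<mu> f"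
    using assms unfolding L2_bounded_op_def by blast
  have "L2_norm \<mu> (\<lambda>x. U f x - U g x) \<le> max K 0 * L2_norm \<mu> (\<lambda>x. f x - g x)"
    if fg: "f \<in> L2 \<mu>" "g \<in> L2 \<mu>" for f g
  proof -
    have "U f \<in> L2 \<mu>" "U g \<in> L2 \<mu>" "U (\<lambda>y. f y - g y) \<in> L2 \<mu>"
      using assms fg L2_diff unfolding L2_bounded_op_def by auto
    moreover have "AE x in \<mu>. U f x - U g x = U (\<lambda>y. f y - g y) x"
      using assms fg unfolding L2_bounded_op_def by fastforce
    ultimately have "L2_norm \<mu> (\<lambda>x. U f x - U g x) = L2_norm \<mu> (U (\<lambda>y. f y - g y))"
      by (intro L2_norm_cong_AE borel_measurable_diff L2_measurable)
    also have "\<dots> \<le> K * L2_norm \<mu> (\<lambda>x. f x - g x)" by (rule K[OF L2_diff[OF fg]])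
    also have "\<dots> \<le> max K 0 * L2_norm \<mu> (\<lambda>x. f x - g x)" by (intro mult_right_mono) auto
    finally show ?thesis .
  qed
  then show ?thesis using that[of "max K 0"] by auto
qed

lemma L2_bounded_op_eq:
  assumes U: "L2_bounded_op U" and V: "L2_bounded_op V"
    and eq: "\<And>u. u \<in> test_functions \<Longrightarrow> AE x in \<mu>. U u x = V u x"
    and f: "f \<in> L2 \<mu>"
  shows "AE x in \<mu>. U f x = V f x"
proof -
  obtain K where K: "0 \<le> K" "\<And>f g. f \<in> L2 \<mu> \<Longrightarrow> g \<in> L2 \<mu> \<Longrightarrow>
    L2_norm \<mu> (\<lambda>x. U f x - U g x) \<le> K * L2_norm \<mu> (\<lambda>x. f x - g x)"
    using L2_bounded_op_diff[OF U] by blast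
  obtain K' where K': "0 \<le> K'" "\<And>f g. f \<in> L2 \<mu> \<Longrightarrow> g \<in> L2 \<mu> \<Longrightarrow>
    L2_norm \<mu> (\<lambda>x. V f x - V g x) \<le> K' * L2_norm \<mu> (\<lambda>x. f x - g x)"
    using L2_bounded_op_diff[OF V] by blast
  have UL: "U g \<in> L2 \<mu>" and VL: "V g \<in> L2 \<mu>" if "g \<in> L2 \<mu>" for g
    using U V that by (auto simp: L2_bounded_op_def)
  have "L2_norm \<mu> (\<lambda>x. U f x - V f x) \<le> 0"
  proof (rule field_le_epsilon)
    fix e :: real assume "0 < e"
    then have "0 < e / (K + K' + 1)" using K(1) K'(1) by simp
    then obtain u where u: "u \<in> test_functions" "L2_norm \<mu> (\<lambda>x. f x - u x) < e / (K + K' + 1)"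
      using test_functions_dense[OF f] by blast
    note uL = test_L2[OF u(1)]
    have "L2_norm \<mu> (\<lambda>x. U f x - V f x) \<le>
        L2_norm \<mu> (\<lambda>x. U f x - U u x) + L2_norm \<mu> (\<lambda>x. U u x - V f x)"
      by (intro L2_norm_triangle_diff UL VL f uL)
    also have "L2_norm \<mu> (\<lambda>x. U u x - V f x) \<le>
        L2_norm \<mu> (\<lambda>x. U u x - V u x) + L2_norm \<mu> (\<lambda>x. V u x - V f x)"
      by (intro L2_norm_triangle_diff UL VL f uL)
    also have "L2_norm \<mu> (\<lambda>x. U u x - V u x) = 0"
      by (intro L2_norm_diff_eq_0I eq u)
    also have "L2_norm \<mu> (\<lambda>x. V u x - V f x) = L2_norm \<mu> (\<lambda>x. V f x - V u x)"
      by (rule L2_norm_minus_commute)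
    finally have "L2_norm \<mu> (\<lambda>x. U f x - V f x) \<le> (K + K') * L2_norm \<mu> (\<lambda>x. f x - u x)"
      using K(2)[OF f uL] K'(2)[OF f uL] by (simp add: distrib_right)
    also have "\<dots> \<le> (K + K') * (e / (K + K' + 1))"
      using u(2) K(1) K'(1) by (intro mult_left_mono) auto
    also have "\<dots> \<le> 0 + e"
      using K(1) K'(1) \<open>0 < e\<close> by (simp add: field_simps)
    finally show "L2_norm \<mu> (\<lambda>x. U f x - V f x) \<le> 0 + e" .
  qed
  then show ?thesis
    by (intro L2_norm_diff_zero_AE UL VL f) (simp add: order_antisym)
qed

lemma L2_bounded_op_cong:
  assumes U: "L2_bounded_op U" and f: "f \<in> L2 \<mu>" "g \<in> L2 \<mu>" "AE x in \<mu>. f x = g x"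
  shows "AE x in \<mu>. U f x = U g x"
proof -
  obtain K where K: "0 \<le> K" "\<And>f g. f \<in> L2 \<mu> \<Longrightarrow> g \<in> L2 \<mu> \<Longrightarrow>
    L2_norm \<mu> (\<lambda>x. U f x - U g x) \<le> K * L2_norm \<mu> (\<lambda>x. f x - g x)"
    using L2_bounded_op_diff[OF U] by blast
  have "L2_norm \<mu> (\<lambda>x. U f x - U g x) \<le> 0"
    using K(2)[OF f(1,2)] L2_norm_diff_eq_0I[OF f(3)] by simp
  then have "L2_norm \<mu> (\<lambda>x. U f x - U g x) = 0" by (simp add: order_antisym)
  then show ?thesis using U f(1,2) by (intro L2_norm_diff_zero_AE) (auto simp: L2_bounded_op_def)
qed

lemma L2_bounded_op_comp:
  assumes U: "L2_bounded_op U" and V: "L2_bounded_op V"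
  shows "L2_bounded_op (\<lambda>f. U (V f))"
  unfolding L2_bounded_op_def
proof (intro conjI ballI)
  have VL: "V f \<in> L2 \<mu>" and UL: "U f \<in> L2 \<mu>" if "f \<in> L2 \<mu>" for f
    using U V that by (auto simp: L2_bounded_op_def)
  fix f assume f: "f \<in> L2 \<mu>"
  show "U (V f) \<in> L2 \<mu>" using UL VL f by blast
  fix g assume g: "g \<in> L2 \<mu>"
  have "AE x in \<mu>. V (\<lambda>y. f y - g y) x = V f x - V g x"
    using V f g by (auto simp: L2_bounded_op_def)
  then have "AE x in \<mu>. U (V (\<lambda>y. f y - g y)) x = U (\<lambda>y. V f y - V g y) x"
    by (intro L2_bounded_op_cong[OF U] VL L2_diff f g)
  moreover have "AE x in \<mu>. U (\<lambda>y. V f y - V g y) x = U (V f) x - U (V g) x"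
    using U VL[OF f] VL[OF g] by (auto simp: L2_bounded_op_def)
  ultimately show "AE x in \<mu>. U (V (\<lambda>y. f y - g y)) x = U (V f) x - U (V g) x"
    by eventually_elim simp
next
  obtain K where K: "\<And>f. f \<in> L2 \<mu> \<Longrightarrow> L2_norm \<mu> (U f) \<le> K * L2_norm \<mu> f"
    using U unfolding L2_bounded_op_def by blast
  obtain K' where K': "\<And>f. f \<in> L2 \<mu> \<Longrightarrow> L2_norm \<mu> (V f) \<le> K' * L2_norm \<mu> f"
    using V unfolding L2_bounded_op_def by blast
  show "\<exists>K. \<forall>f\<in>L2 \<mu>. L2_norm \<mu> (U (V f)) \<le> K * L2_norm \<mu> f"
  proof (intro exI[of _ "max K 0 * K'"] ballI)
    fix f assume f: "f \<in> L2 \<mu>"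
    then have Vf: "V f \<in> L2 \<mu>" using V by (auto simp: L2_bounded_op_def)
    have "L2_norm \<mu> (U (V f)) \<le> K * L2_norm \<mu> (V f)" by (rule K[OF Vf])
    also have "\<dots> \<le> max K 0 * L2_norm \<mu> (V f)" by (intro mult_right_mono) auto
    also have "\<dots> \<le> max K 0 * (K' * L2_norm \<mu> f)" by (intro mult_left_mono K' f) auto
    finally show "L2_norm \<mu> (U (V f)) \<le> max K 0 * K' * L2_norm \<mu> f" by (simp add: mult.assoc)
  qed
qed

lemma L2_bounded_op_id: "L2_bounded_op (\<lambda>f. f)"
  unfolding L2_bounded_op_def by (auto intro: exI[of _ 1])

lemma nn_integral_L2: "f \<in> L2 \<mu> \<Longrightarrow> (\<integral>\<^sup>+x. ennreal ((cmod (f x))\<^sup>2) \<partial>\<mu>) = ennreal ((L2_norm \<mu> f)\<^sup>2)"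
  unfolding L2_norm_sq by (rule nn_integral_eq_integral) (auto dest: L2_integrable)

lemma ring_of_clopen_sets: "ring_of_sets UNIV clopen_sets"
  by (simp add: ring_of_sets_iff clopen_empty clopen_Un clopen_Diff)

text \<open>
  Compactness in the form needed for Caratheodory's theorem: on the algebra of clopen sets,
  continuity at the empty set holds because a decreasing sequence with empty intersection is
  eventually empty.
\<close>

lemma clopen_decseq_empty:
  assumes A: "range A \<subseteq> clopen_sets" and dec: "decseq A" and empty: "(\<Inter>i. A i) = {}"
  obtains N :: nat where "\<And>n. N \<le> n \<Longrightarrow> A n = {}"
proof -
  obtain I where I: "finite I" "UNIV \<subseteq> (\<Union>i\<in>I. - A i)"
  proof (rule compactE_image[OF compact_space, of UNIV "\<lambda>i. - A i"])
    show "open (- A i)" for i using A clopen_closed by (auto intro: open_Compl)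
    show "UNIV \<subseteq> (\<Union>i. - A i)" using empty by blast
  qed auto
  have "A n = {}" if "Max (insert 0 I) \<le> n" for n
  proof -
    have "A n \<subseteq> A i" if "i \<in> I" for i
    proof -
      have "i \<le> n" using I(1) \<open>i \<in> I\<close> \<open>Max (insert 0 I) \<le> n\<close>
          by (meson Max_ge finite_insert insertI2 order_trans)
      then show ?thesis using dec by (auto simp: decseq_def)
    qed
    then show ?thesis using I(2) by blast
  qed
  then show ?thesis using that by blast
qed

end

section \<open>The Dirichlet form as a jump form\<close>

lemma dirac_matrix:
  "dirac v = vector [vector [0, of_real (1 / diameter v)], vector [of_real (1 / diameter v), 0]]"
proof -
  have "k *\<^sub>R vector [vector [0, 1], vector [1, 0]] =
      (vector [vector [0, of_real k], vector [of_real k, 0]] :: complex^2^2)" for k :: real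
    by (simp add: vec_eq_iff forall_2 vector_2 of_real_def)
  then show ?thesis unfolding dirac_def .
qed

text \<open>
  At each vertex the commutator with the Dirac operator is off-diagonal, and its entries are plus
  and minus the difference quotient of the function, so the block of the form is a multiple of the
  identity.
\<close>

lemma trace_dirichlet_block:
  fixes v :: "'a::ultrametric_cantor_set set"
  shows "trace ((abs_dirac_powr z \<odot> block_adjoint (block_commutator dirac (rep \<tau> f))
      \<odot> block_commutator dirac (rep \<tau> g)) v)
    = 2 * (complex_of_real (1 / diameter v) powr z) * of_real ((1 / diameter v)\<^sup>2) *
      (cnj (f (fst (\<tau> v)) - f (snd (\<tau> v))) * (g (fst (\<tau> v)) - g (snd (\<tau> v))))"
  by (simp add: trace_def sum_2 matrix_matrix_mult_def block_mult_def block_adjoint_def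
      block_commutator_def dirac_matrix rep_def abs_dirac_powr_def mat_def vector_2
      power2_eq_square algebra_simps)

locale pearson_form = cantor_measure \<mu> for \<mu> :: "'a::ultrametric_cantor_set measure" +
  fixes s :: real
begin

sublocale P: pair_prob_space \<mu> \<mu> ..

lemma sets_pair: "sets (\<mu> \<Otimes>\<^sub>M \<mu>) = sets (borel \<Otimes>\<^sub>M borel)"
  by (intro sets_pair_measure_cong sets_eq)

lemma measurable_pair_eq: "measurable (\<mu> \<Otimes>\<^sub>M \<mu>) N = measurable (borel \<Otimes>\<^sub>M borel) N"
  by (rule measurable_cong_sets) (auto simp: sets_pair)

lemma choices_perturb:
  assumes v: "v \<in> discs" and d: "dist x x' \<le> diameter v / 2" "dist y y' \<le> diameter v / 2"
    and xy: "(x, y) \<in> choices v"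
  shows "(x', y') \<in> choices v"
proof -
  have xy': "x \<in> v" "y \<in> v" "dist x y = diameter v" using xy by (auto simp: choices_def)
  have pos: "0 < diameter v" using disc_diameter_pos[OF v] .
  have "dist x' y' = diameter v"
    using dist_eq_of_perturbation[OF d] xy'(3) pos by simp
  moreover have "x' \<in> v"
  proof -
    have "dist x x' \<le> diameter v" using d(1) pos by linarith
    then show ?thesis using disc_eq_cball[OF v xy'(1)] mem_cball by blast
  qed
  moreover have "y' \<in> v"
  proof -
    have "dist y y' \<le> diameter v" using d(2) pos by linarith
    then show ?thesis using disc_eq_cball[OF v xy'(2)] mem_cball by blast
  qed
  ultimately show ?thesis by (simp add: choices_def)
qed

text \<open>
  The set is a union of products of balls with half the diameter of v as radius, so its indicator
  is constant at that scale in both variables.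
\<close>

lemma choices_sets:
  assumes "v \<in> discs"
  shows "choices v \<in> sets (\<mu> \<Otimes>\<^sub>M \<mu>)"
proof -
  have "case_prod (\<lambda>x y. indicator (choices v) (x, y) :: real) \<in> borel_measurable (borel \<Otimes>\<^sub>M borel)"
  proof (rule const_at_scale_measurable_pair[of "diameter v / 2"])
    fix x x' y y' :: 'a assume d: "dist x x' \<le> diameter v / 2" "dist y y' \<le> diameter v / 2"
    then have "dist x' x \<le> diameter v / 2" "dist y' y \<le> diameter v / 2"
      by (auto simp: dist_commute)
    then have "(x, y) \<in> choices v \<longleftrightarrow> (x', y') \<in> choices v"
      using choices_perturb[OF assms] d by blast
    then show "indicator (choices v) (x, y) = (indicator (choices v) (x', y') :: real)"
      by (simp add: indicator_def)
  qed (use disc_diameter_pos[OF assms] in auto)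
  then have "(indicator (choices v) :: _ \<Rightarrow> real) \<in> borel_measurable (\<mu> \<Otimes>\<^sub>M \<mu>)"
    by (simp add: measurable_pair_eq case_prod_beta')
  then show ?thesis
    by (simp add: borel_measurable_indicator_iff space_pair_measure space_eq)
qed

text \<open>
  Two points at maximal distance may be moved inside small discs, which have positive measure because
  the measure has full support.
\<close>

lemma choices_measure_pos:
  assumes "v \<in> discs"
  shows "0 < measure (\<mu> \<Otimes>\<^sub>M \<mu>) (choices v)"
proof -
  let ?r = "diameter v / 2"
  obtain p q where pq: "p \<in> v" "q \<in> v" "dist p q = diameter v"
    using disc_diameter_attained[OF assms] by blast
  have "cball p ?r \<times> cball q ?r \<subseteq> choices v"
    using choices_perturb[OF assms, of p _ q] pq by (auto simp: choices_def)
  then have "measure (\<mu> \<Otimes>\<^sub>M \<mu>) (cball p ?r \<times> cball q ?r) \<le> measure (\<mu> \<Otimes>\<^sub>M \<mu>) (choices v)"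
    by (intro P.P.finite_measure_mono choices_sets assms)
  moreover have "measure (\<mu> \<Otimes>\<^sub>M \<mu>) (cball p ?r \<times> cball q ?r) = measure \<mu> (cball p ?r) * measure \<mu> (cball q ?r)"
    unfolding measure_def
    by (subst emeasure_pair_measure_Times) (auto simp: sets_eq enn2real_mult)
  moreover have "0 < measure \<mu> (cball p ?r) * measure \<mu> (cball q ?r)"
    using disc_diameter_pos[OF assms] by (intro mult_pos_pos cball_measure_pos) auto
  ultimately show ?thesis by linarith
qed

text \<open>
  The factor of \<open>|D| powr (-s)\<close> combined with the two factors from the commutators.
\<close>

definition weight :: "'a set \<Rightarrow> real" where
  "weight v = (1 / diameter v) powr (- s) * (1 / diameter v)\<^sup>2"

definition jump :: "'a set \<Rightarrow> real" where
  "jump v = weight v / measure (\<mu> \<Otimes>\<^sub>M \<mu>) (choices v)"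

text \<open>
  The sets \<open>choices v\<close> partition the pairs of distinct points, so the normalised weights of
  the vertices form a single kernel on pairs of points, constant on each of these sets.
\<close>

definition jump_kernel :: "'a \<Rightarrow> 'a \<Rightarrow> real" where
  "jump_kernel x y = (if x = y then 0 else jump (cball x (dist x y)))"

lemma jump_nonneg: "0 \<le> jump v"
  by (simp add: jump_def weight_def)

lemma jump_kernel_nonneg: "0 \<le> jump_kernel x y"
  by (simp add: jump_kernel_def jump_nonneg)

lemma jump_kernel_commute: "jump_kernel x y = jump_kernel y x"
  using cball_eq_of_dist_le[of x y "dist x y"] by (auto simp: jump_kernel_def dist_commute)

lemma jump_kernel_local:
  assumes "dist x x' \<le> r" "dist y y' \<le> r" "r < dist x y"
  shows "jump_kernel x' y' = jump_kernel x y"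
proof -
  have d: "dist x' y' = dist x y" by (rule dist_eq_of_perturbation[OF assms])
  have "0 < dist x y" using assms zero_le_dist[of x x'] by linarith
  then have "x \<noteq> y" "x' \<noteq> y'" using d by auto
  moreover have "cball x (dist x y) = cball x' (dist x y)"
    using assms by (intro cball_eq_of_dist_le) auto
  ultimately show ?thesis by (simp add: jump_kernel_def d)
qed

text \<open>
  On functions constant at scale r, jumps of length at most r have no effect. Removing them makes the
  kernel bounded and locally constant.
\<close>

definition cut_kernel :: "real \<Rightarrow> 'a \<Rightarrow> 'a \<Rightarrow> real" where
  "cut_kernel r x y = (if dist x y \<le> r then 0 else jump_kernel x y)"

lemma cut_kernel_nonneg: "0 \<le> cut_kernel r x y"
  by (simp add: cut_kernel_def jump_kernel_nonneg)

lemma cut_kernel_commute: "cut_kernel r x y = cut_kernel r y x"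
  by (simp add: cut_kernel_def jump_kernel_commute dist_commute)

lemma cut_kernel_local:
  assumes "dist x x' \<le> r" "dist y y' \<le> r"
  shows "cut_kernel r x y = cut_kernel r x' y'"
proof (cases "r < dist x y")
  case True
  then show ?thesis using jump_kernel_local[OF assms True] dist_eq_of_perturbation[OF assms True]
    by (simp add: cut_kernel_def)
next
  case False
  moreover have "\<not> r < dist x' y'"
    using dist_eq_of_perturbation[of x' x r y' y] assms False by (auto simp: dist_commute)
  ultimately show ?thesis by (simp add: cut_kernel_def)
qed

lemma cut_kernel_bounded:
  assumes "0 < r"
  obtains B where "0 \<le> B" "\<And>x y. cut_kernel r x y \<le> B"
proof
  let ?F = "{v \<in> (discs :: 'a set set). r < diameter v}"
  show "0 \<le> (\<Sum>v\<in>?F. jump v)" by (intro sum_nonneg jump_nonneg)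
  fix x y :: 'a
  show "cut_kernel r x y \<le> (\<Sum>v\<in>?F. jump v)"
  proof (cases "dist x y \<le> r")
    case False
    then have ne: "x \<noteq> y" using assms by auto
    then have "cball x (dist x y) \<in> ?F" using False disc_join[OF ne] by auto
    then have "jump (cball x (dist x y)) \<le> (\<Sum>v\<in>?F. jump v)"
      by (intro member_le_sum finite_large_discs assms jump_nonneg) auto
    then show ?thesis using False ne by (simp add: cut_kernel_def jump_kernel_def)
  qed (simp add: cut_kernel_def sum_nonneg jump_nonneg)
qed

lemma sum_jump_choices:
  assumes "0 < r"
  shows "(\<Sum>v\<in>{v \<in> discs. r < diameter v}. jump v * indicator (choices v) (x, y)) = cut_kernel r x y"
proof -
  let ?F = "{v \<in> (discs :: 'a set set). r < diameter v}"
  let ?w = "cball x (dist x y)"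
  have "(\<Sum>v\<in>?F. jump v * indicator (choices v) (x, y)) = (\<Sum>v\<in>?F. if v = ?w then cut_kernel r x y else 0)"
  proof (rule sum.cong)
    fix v assume v: "v \<in> ?F"
    show "jump v * indicator (choices v) (x, y) = (if v = ?w then cut_kernel r x y else 0)"
    proof (cases "(x, y) \<in> choices v")
      case True
      then have "v = ?w" "x \<noteq> y" using disc_unique_join[of v x y] v by auto
      moreover have "r < dist x y" using True v by (auto simp: choices_def)
      ultimately show ?thesis using True by (simp add: cut_kernel_def jump_kernel_def)
    next
      case False
      have "cut_kernel r x y = 0" if "v = ?w"
      proof (rule ccontr)
        assume "cut_kernel r x y \<noteq> 0"
        then have "x \<noteq> y" by (auto simp: cut_kernel_def jump_kernel_def split: if_splits)
        then show False using in_choices_join False that by blast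
      qed
      then show ?thesis using False by simp
    qed
  qed simp
  also have "\<dots> = (if ?w \<in> ?F then cut_kernel r x y else 0)"
    using sum.delta[OF finite_large_discs[OF assms], of ?w "\<lambda>_. cut_kernel r x y"] by simp
  also have "\<dots> = cut_kernel r x y"
  proof (cases "dist x y \<le> r")
    case False
    then have ne: "x \<noteq> y" using assms by auto
    then have "?w \<in> ?F" using False disc_join[OF ne] by auto
    then show ?thesis by simp
  qed (simp add: cut_kernel_def)
  finally show ?thesis .
qed

lemma bounded_L2_pair:
  assumes "F \<in> borel_measurable (\<mu> \<Otimes>\<^sub>M \<mu>)" "\<And>z. cmod (F z) \<le> B"
  shows "F \<in> L2 (\<mu> \<Otimes>\<^sub>M \<mu>)"
proof (rule L2_bound[where h = "\<lambda>z. B\<^sup>2"])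
  show "AE z in \<mu> \<Otimes>\<^sub>M \<mu>. (cmod (F z))\<^sup>2 \<le> B\<^sup>2"
    using assms(2) by (auto intro!: power_mono)
qed (use assms in auto)

lemma pair_integrable:
  fixes F :: "'a \<Rightarrow> 'a \<Rightarrow> complex"
  assumes "0 < r" "\<And>x x' y y'. dist x x' \<le> r \<Longrightarrow> dist y y' \<le> r \<Longrightarrow> F x y = F x' y'"
  shows "integrable (\<mu> \<Otimes>\<^sub>M \<mu>) (case_prod F)"
proof -
  let ?K = "range (center r :: 'a \<Rightarrow> 'a)"
  have "range (case_prod F) \<subseteq> case_prod F ` (?K \<times> ?K)"
  proof clarify
    fix x y
    have "F x y = F (center r x) (center r y)"
      using assms(2)[OF dist_center dist_center] assms(1) by simp
    then show "F x y \<in> case_prod F ` (?K \<times> ?K)"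
      by (intro image_eqI[of _ _ "(center r x, center r y)"]) auto
  qed
  moreover have "finite (?K \<times> ?K)" using finite_range_center[OF assms(1)] by blast
  ultimately have "finite (range (case_prod F))" using finite_surj by blast
  then have "bounded (range (case_prod F))" by (rule finite_imp_bounded)
  then obtain B where B: "\<And>z. cmod (case_prod F z) \<le> B" by (auto simp: bounded_iff)
  show ?thesis
  proof (rule P.P.integrable_const_bound[where B = B])
    show "case_prod F \<in> borel_measurable (\<mu> \<Otimes>\<^sub>M \<mu>)"
      unfolding measurable_pair_eq by (rule const_at_scale_measurable_pair[OF assms])
  qed (use B in auto)
qed

definition grad :: "real \<Rightarrow> ('a \<Rightarrow> complex) \<Rightarrow> 'a \<times> 'a \<Rightarrow> complex" where
  "grad r f = (\<lambda>(x, y). of_real (sqrt (cut_kernel r x y)) * (f x - f y))"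

lemma grad_L2:
  assumes r: "0 < r" and f: "const_at_scale r f"
  shows "grad r f \<in> L2 (\<mu> \<Otimes>\<^sub>M \<mu>)"
proof -
  obtain B where B: "0 \<le> B" "\<And>x y. cut_kernel r x y \<le> B" using cut_kernel_bounded[OF r] by metis
  have "f \<in> test_functions" using assms test_function_iff by blast
  then obtain C where C: "\<And>x. cmod (f x) \<le> C" using test_bounded by blast
  show ?thesis
  proof (rule bounded_L2_pair)
    show "grad r f \<in> borel_measurable (\<mu> \<Otimes>\<^sub>M \<mu>)"
      unfolding grad_def measurable_pair_eq
      by (rule const_at_scale_measurable_pair[OF r]) (use cut_kernel_local const_at_scaleD[OF f] in metis)
    show "cmod (grad r f z) \<le> sqrt B * (C + C)" for z
    proof -
      obtain x y where z: "z = (x, y)" by force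
      have "cmod (f x - f y) \<le> C + C"
        using C[of x] C[of y] norm_triangle_ineq4[of "f x" "f y"] by linarith
      moreover have "cmod (of_real (sqrt (cut_kernel r x y))) \<le> sqrt B"
        using B(2)[of x y] cut_kernel_nonneg[of r x y] by simp
      ultimately show ?thesis unfolding z grad_def prod.case norm_mult
        by (intro mult_mono) (use B(1) in auto)
    qed
  qed
qed

lemma grad_diff: "grad r (\<lambda>x. f x - g x) = (\<lambda>z. grad r f z - grad r g z)"
  by (auto simp: grad_def fun_eq_iff algebra_simps)

text \<open>
  Only the finitely many vertices of diameter above the scale contribute to the trace.
  Each contribution depends on a single coordinate of the choice function, so the integral over all
  choice functions reduces to integrals over the sets \<open>choices v\<close>, which add up to an integral
  over pairs of points.
\<close>

proposition pb_form_eq_grad: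
  assumes r: "0 < r" and f: "const_at_scale r f" and g: "const_at_scale r g"
  shows "pb_form \<mu> s f g = L2_inner (\<mu> \<Otimes>\<^sub>M \<mu>) (grad r f) (grad r g)"
proof -
  let ?F = "{v \<in> (discs :: 'a set set). r < diameter v}"
  let ?N = "\<lambda>v. restrict_space (uniform_measure (\<mu> \<Otimes>\<^sub>M \<mu>) (choices v)) (choices v)"
  let ?m = "\<lambda>v. measure (\<mu> \<Otimes>\<^sub>M \<mu>) (choices v)"
  define h where "h = (\<lambda>z. cnj (f (fst z) - f (snd z)) * (g (fst z) - g (snd z)))"
  have test: "f \<in> test_functions" "g \<in> test_functions" using r f g test_function_iff by blast+
  obtain C where C: "\<And>x. cmod (f x) \<le> C" using test_bounded[OF test(1)] by blast
  obtain E where E: "\<And>x. cmod (g x) \<le> E" using test_bounded[OF test(2)] by blast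
  have hb: "cmod (h z) \<le> (C + C) * (E + E)" for z
  proof -
    have "cmod (f (fst z) - f (snd z)) \<le> C + C"
      using C[of "fst z"] C[of "snd z"] norm_triangle_ineq4[of "f (fst z)" "f (snd z)"] by linarith
    moreover have "cmod (g (fst z) - g (snd z)) \<le> E + E"
      using E[of "fst z"] E[of "snd z"] norm_triangle_ineq4[of "g (fst z)" "g (snd z)"] by linarith
    ultimately show ?thesis unfolding h_def norm_mult complex_mod_cnj
      using order_trans[OF norm_ge_zero C[of undefined]] order_trans[OF norm_ge_zero E[of undefined]]
      by (intro mult_mono) auto
  qed
  have "h (x, y) = h (x', y')" if "dist x x' \<le> r" "dist y y' \<le> r" for x x' y y'
    unfolding h_def
    using const_at_scaleD[OF f that(1)] const_at_scaleD[OF f that(2)]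
      const_at_scaleD[OF g that(1)] const_at_scaleD[OF g that(2)] by simp
  then have "case_prod (\<lambda>x y. h (x, y)) \<in> borel_measurable (borel \<Otimes>\<^sub>M borel)"
    by (rule const_at_scale_measurable_pair[OF r])
  then have hm: "h \<in> borel_measurable (\<mu> \<Otimes>\<^sub>M \<mu>)" by (simp add: measurable_pair_eq case_prod_beta')
  have prob: "prob_space (?N v)" if v: "v \<in> discs" for v
  proof -
    have "prob_space (uniform_measure (\<mu> \<Otimes>\<^sub>M \<mu>) (choices v))"
      using choices_measure_pos[OF v] P.P.emeasure_eq_measure
      by (intro prob_space_uniform_measure) auto
    moreover have "emeasure (uniform_measure (\<mu> \<Otimes>\<^sub>M \<mu>) (choices v)) (choices v) = 1"
      using choices_measure_pos[OF v] choices_sets[OF v]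
      by (subst emeasure_uniform_measure) (auto simp: P.P.emeasure_eq_measure divide_ennreal)
    ultimately show ?thesis
      using choices_sets[OF v] by (intro prob_spaceI) (simp add: space_restrict_space emeasure_restrict_space)
  qed
  have hN: "h \<in> borel_measurable (?N v)" for v
    using hm by (intro measurable_restrict_space1) simp
  have choice: "choice_measure \<mu> = PiM discs ?N" by (simp add: choice_measure_def)
  interpret C: prob_space "PiM discs ?N" using prob by (rule prob_space_PiM)
  have Tr: "Tr (abs_dirac_powr (- of_real s) \<odot> block_adjoint (block_commutator dirac (rep \<tau> f))
           \<odot> block_commutator dirac (rep \<tau> g)) = (\<Sum>v\<in>?F. of_real (2 * weight v) * h (\<tau> v))"
    if \<tau>: "\<tau> \<in> space (PiM discs ?N)" for \<tau>
  proof -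
    have ch: "\<tau> v \<in> choices v" if "v \<in> discs" for v
      using \<tau> that by (auto simp: space_PiM space_restrict_space PiE_iff)
    have tr: "trace ((abs_dirac_powr (- of_real s) \<odot> block_adjoint (block_commutator dirac (rep \<tau> f))
           \<odot> block_commutator dirac (rep \<tau> g)) v) = of_real (2 * weight v) * h (\<tau> v)"
      if "v \<in> discs" for v
    proof -
      have "complex_of_real (1 / diameter v) powr (- of_real s) = of_real ((1 / diameter v) powr (- s))"
        using disc_diameter_pos[OF that] powr_of_real[of "1 / diameter v" "- s"] by simp
      then show ?thesis unfolding trace_dirichlet_block by (simp add: weight_def h_def)
    qed
    have "h (\<tau> v) = 0" if "v \<in> discs - ?F" for v
    proof -
      have "dist (fst (\<tau> v)) (snd (\<tau> v)) \<le> r"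
        using ch[of v] that by (auto simp: choices_def)
      then show ?thesis using const_at_scaleD[OF f] by (simp add: h_def)
    qed
    then have "Tr (abs_dirac_powr (- of_real s) \<odot> block_adjoint (block_commutator dirac (rep \<tau> f))
           \<odot> block_commutator dirac (rep \<tau> g)) = infsum (\<lambda>v. of_real (2 * weight v) * h (\<tau> v)) ?F"
      unfolding Tr_def by (intro infsum_cong_neutral) (auto simp: tr)
    then show ?thesis by (simp add: infsum_finite finite_large_discs[OF r])
  qed
  have meas_comp: "(\<lambda>\<tau>. h (\<tau> v)) \<in> borel_measurable (PiM discs ?N)" if "v \<in> discs" for v
    by (rule measurable_compose[OF measurable_component_singleton[OF that] hN])
  have int_comp: "integrable (PiM discs ?N) (\<lambda>\<tau>. h (\<tau> v))" if "v \<in> discs" for v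
    by (rule C.integrable_const_bound[where B = "(C + C) * (E + E)"]) (use hb meas_comp that in auto)
  have comp: "(LINT \<tau>|PiM discs ?N. h (\<tau> v)) = (LINT z|(\<mu> \<Otimes>\<^sub>M \<mu>). of_real (indicator (choices v) z / ?m v) *
      h z)"
    if v: "v \<in> discs" for v
  proof -
    have "(LINT \<tau>|PiM discs ?N. h (\<tau> v)) = (LINT z|distr (PiM discs ?N) (?N v) (\<lambda>\<tau>. \<tau> v). h z)"
      by (rule integral_distr[symmetric]) (use measurable_component_singleton[OF v] hN in auto)
    also have "\<dots> = (LINT z|?N v. h z)"
      by (subst distr_PiM_component[OF prob v]) auto
    also have "\<dots> = (LINT z|uniform_measure (\<mu> \<Otimes>\<^sub>M \<mu>) (choices v). indicator (choices v) z *\<^sub>R h z)"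
      by (rule integral_restrict_space) (use choices_sets[OF v] sets.sets_into_space in auto)
    also have "uniform_measure (\<mu> \<Otimes>\<^sub>M \<mu>) (choices v) =
        density (\<mu> \<Otimes>\<^sub>M \<mu>) (\<lambda>z. ennreal (indicator (choices v) z / ?m v))"
      unfolding uniform_measure_def
      using choices_measure_pos[OF v]
      by (intro arg_cong2[where f = density] refl ext)
        (auto simp: P.P.emeasure_eq_measure indicator_def divide_ennreal[symmetric])
    also have "(LINT z|density (\<mu> \<Otimes>\<^sub>M \<mu>) (\<lambda>z. ennreal (indicator (choices v) z / ?m v)). indicator (choices
        v) z *\<^sub>R h z)
        = (LINT z|(\<mu> \<Otimes>\<^sub>M \<mu>). (indicator (choices v) z / ?m v) *\<^sub>R (indicator (choices v) z *\<^sub>R h z))"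
      using hm choices_sets[OF v] by (intro integral_density) auto
    also have "\<dots> = (LINT z|(\<mu> \<Otimes>\<^sub>M \<mu>). of_real (indicator (choices v) z / ?m v) * h z)"
      by (intro Bochner_Integration.integral_cong) (auto simp: indicator_def scaleR_conv_of_real)
    finally show ?thesis .
  qed
  have int: "integrable (\<mu> \<Otimes>\<^sub>M \<mu>) (\<lambda>z. of_real (indicator (choices v) z / ?m v) * h z)" if v: "v \<in> discs" for v
  proof (rule P.P.integrable_const_bound[where B = "1 / ?m v * ((C + C) * (E + E))"])
    show "AE z in \<mu> \<Otimes>\<^sub>M \<mu>. norm (of_real (indicator (choices v) z / ?m v) * h z) \<le> 1 / ?m v * ((C + C) * (E
        + E))"
    proof (rule AE_I2)
      fix z
      show "norm (of_real (indicator (choices v) z / ?m v) * h z) \<le> 1 / ?m v * ((C + C) * (E + E))"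
        unfolding norm_mult by (intro mult_mono hb) (auto simp: indicator_def norm_divide)
    qed
    show "(\<lambda>z. of_real (indicator (choices v) z / ?m v) * h z) \<in> borel_measurable (\<mu> \<Otimes>\<^sub>M \<mu>)"
      using hm choices_sets[OF v] by measurable
  qed
  have "pb_form \<mu> s f g = 1/2 * (LINT \<tau>|PiM discs ?N. (\<Sum>v\<in>?F. of_real (2 * weight v) * h (\<tau> v)))"
    unfolding pb_form_def choice by (simp add: Tr cong: Bochner_Integration.integral_cong)
  also have "\<dots> = 1/2 * (\<Sum>v\<in>?F. of_real (2 * weight v) * (LINT \<tau>|PiM discs ?N. h (\<tau> v)))"
    using int_comp by (subst Bochner_Integration.integral_sum) auto
  also have "\<dots> = (\<Sum>v\<in>?F. of_real (weight v) * (LINT z|(\<mu> \<Otimes>\<^sub>M \<mu>). of_real (indicator (choices v) z / ?m v) *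
      h z))"
    by (simp add: comp sum_distrib_left)
  also have "\<dots> = (\<Sum>v\<in>?F. (LINT z|(\<mu> \<Otimes>\<^sub>M \<mu>). of_real (weight v) * (of_real (indicator (choices v) z / ?m v) *
      h z)))"
    by simp
  also have "\<dots> = (LINT z|(\<mu> \<Otimes>\<^sub>M \<mu>). (\<Sum>v\<in>?F. of_real (weight v) * (of_real (indicator (choices v) z / ?m v) *
      h z)))"
    by (rule Bochner_Integration.integral_sum[symmetric], rule integrable_mult_right, rule int) simp
  also have "\<dots> = (LINT z|(\<mu> \<Otimes>\<^sub>M \<mu>). of_real (cut_kernel r (fst z) (snd z)) * h z)"
  proof (rule Bochner_Integration.integral_cong[OF refl])
    fix z
    have "(\<Sum>v\<in>?F. of_real (weight v) * (of_real (indicator (choices v) z / ?m v) * h z)) =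
       of_real (\<Sum>v\<in>?F. jump v * indicator (choices v) (fst z, snd z)) * h z"
      by (simp add: sum_distrib_right jump_def mult.assoc)
    then show "(\<Sum>v\<in>?F. of_real (weight v) * (of_real (indicator (choices v) z / ?m v) * h z)) =
       of_real (cut_kernel r (fst z) (snd z)) * h z"
      unfolding sum_jump_choices[OF r] .
  qed
  also have "\<dots> = L2_inner (\<mu> \<Otimes>\<^sub>M \<mu>) (grad r f) (grad r g)"
    unfolding L2_inner_def
  proof (rule Bochner_Integration.integral_cong[OF refl])
    fix z :: "'a \<times> 'a"
    have "complex_of_real (cut_kernel r (fst z) (snd z)) = (of_real (sqrt (cut_kernel r (fst z) (snd z))))\<^sup>2"
      by (metis cut_kernel_nonneg of_real_power real_sqrt_pow2)
    then show "of_real (cut_kernel r (fst z) (snd z)) * h z = cnj (grad r f z) * grad r g z"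
      by (simp add: grad_def h_def case_prod_beta power2_eq_square)
  qed
  finally show ?thesis .
qed

section \<open>The jump operator on test functions\<close>

text \<open>
  This is half of the operator associated with the form, hence the Vladimirov-Pearson operator
  on test functions.
\<close>

definition jump_op :: "('a \<Rightarrow> complex) \<Rightarrow> 'a \<Rightarrow> complex" where
  "jump_op f x = (LINT y|\<mu>. of_real (jump_kernel x y) * (f x - f y))"

lemma jump_op_cutoff:
  assumes "const_at_scale r f"
  shows "jump_op f x = (LINT y|\<mu>. of_real (cut_kernel r x y) * (f x - f y))"
  unfolding jump_op_def
  by (rule Bochner_Integration.integral_cong) (auto simp: cut_kernel_def const_at_scaleD[OF assms])

lemma cutoff_test:
  assumes r: "0 < r" and f: "const_at_scale r f"
  shows "(\<lambda>y. of_real (cut_kernel r x y) * (f x - f y)) \<in> test_functions"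
proof -
  have "const_at_scale r (\<lambda>y. of_real (cut_kernel r x y) * (f x - f y))"
    unfolding const_at_scale_def
  proof (intro allI impI)
    fix y z :: 'a assume d: "dist y z \<le> r"
    have "cut_kernel r x y = cut_kernel r x z" by (rule cut_kernel_local) (use r d in auto)
    then show "of_real (cut_kernel r x y) * (f x - f y) = of_real (cut_kernel r x z) * (f x - f z)"
      using const_at_scaleD[OF f d] by simp
  qed
  then show ?thesis using r test_function_iff by blast
qed

lemma jump_op_const_at_scale:
  assumes r: "0 < r" and f: "const_at_scale r f"
  shows "const_at_scale r (jump_op f)"
  unfolding const_at_scale_def
proof (intro allI impI)
  fix x z :: 'a assume d: "dist x z \<le> r"
  have "cut_kernel r x y = cut_kernel r z y" for y by (rule cut_kernel_local) (use r d in auto)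
  then show "jump_op f x = jump_op f z"
    unfolding jump_op_cutoff[OF f] using const_at_scaleD[OF f d] by simp
qed

lemma jump_op_test: "f \<in> test_functions \<Longrightarrow> jump_op f \<in> test_functions"
  using jump_op_const_at_scale test_function_iff by blast

lemma jump_op_integrable:
  assumes "f \<in> test_functions"
  shows "integrable \<mu> (\<lambda>y. of_real (jump_kernel x y) * (f x - f y))"
proof -
  obtain r where r: "0 < r" "const_at_scale r f" using test_functionE[OF assms] .
  have "(\<lambda>y. of_real (jump_kernel x y) * (f x - f y)) = (\<lambda>y. of_real (cut_kernel r x y) * (f x - f y))"
    by (auto simp: cut_kernel_def const_at_scaleD[OF r(2)])
  then show ?thesis using test_integrable[OF cutoff_test[OF r]] by simp
qed

lemma jump_op_add:
  assumes "f \<in> test_functions" "g \<in> test_functions"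
  shows "jump_op (\<lambda>x. f x + g x) = (\<lambda>x. jump_op f x + jump_op g x)"
proof
  fix x
  have "(\<lambda>y. of_real (jump_kernel x y) * (f x + g x - (f y + g y))) =
      (\<lambda>y. of_real (jump_kernel x y) * (f x - f y) + of_real (jump_kernel x y) * (g x - g y))"
    by (auto simp: algebra_simps)
  then show "jump_op (\<lambda>x. f x + g x) x = jump_op f x + jump_op g x"
    unfolding jump_op_def using jump_op_integrable[OF assms(1)] jump_op_integrable[OF assms(2)] by simp
qed

lemma jump_op_scale: "jump_op (\<lambda>x. c * f x) = (\<lambda>x. c * jump_op f x)"
proof
  fix x
  have "(\<lambda>y. of_real (jump_kernel x y) * (c * f x - c * f y))
      = (\<lambda>y. c * (of_real (jump_kernel x y) * (f x - f y)))"
    by (auto simp: algebra_simps)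
  then show "jump_op (\<lambda>x. c * f x) x = c * jump_op f x" unfolding jump_op_def by simp
qed

lemma jump_op_diff:
  assumes "f \<in> test_functions" "g \<in> test_functions"
  shows "jump_op (\<lambda>x. f x - g x) = (\<lambda>x. jump_op f x - jump_op g x)"
  using jump_op_add[OF assms(1) test_function_comp[OF assms(2), of "\<lambda>z. -1 * z"]] jump_op_scale[of "-1" g]
  by simp

text \<open>
  Expanding the second difference gives two terms, which are exchanged by swapping the two points.
\<close>

proposition pb_form_jump_op:
  assumes "f \<in> test_functions" "g \<in> test_functions"
  shows "pb_form \<mu> s f g = 2 * L2_inner \<mu> (jump_op f) g"
proof -
  obtain r where r: "0 < r" and f: "const_at_scale r f" and g: "const_at_scale r g"
    using test_functionE2[OF assms] .
  define K where "K = (\<lambda>x y. of_real (cut_kernel r x y) * cnj (f x - f y))"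
  have Kloc: "K x y = K x' y'" if "dist x x' \<le> r" "dist y y' \<le> r" for x x' y y'
    unfolding K_def using cut_kernel_local[OF that] const_at_scaleD[OF f that(1)] const_at_scaleD[OF f that(2)]
    by simp
  have i1: "integrable (\<mu> \<Otimes>\<^sub>M \<mu>) (\<lambda>(x, y). K x y * g x)"
    by (rule pair_integrable[OF r(1)]) (use Kloc const_at_scaleD[OF g] in metis)
  have i2: "integrable (\<mu> \<Otimes>\<^sub>M \<mu>) (\<lambda>(x, y). K x y * g y)"
    by (rule pair_integrable[OF r(1)]) (use Kloc const_at_scaleD[OF g] in metis)
  have "(LINT z|(\<mu> \<Otimes>\<^sub>M \<mu>). (\<lambda>(x, y). K x y * g y) z) = (LINT (x, y)|(\<mu> \<Otimes>\<^sub>M \<mu>). (\<lambda>(x, y). K x y * g y) (y, x))"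
    by (rule P.integral_product_swap[symmetric]) (rule borel_measurable_integrable[OF i2])
  also have "\<dots> = (LINT z|(\<mu> \<Otimes>\<^sub>M \<mu>). - ((\<lambda>(x, y). K x y * g x) z))"
    by (intro Bochner_Integration.integral_cong refl)
      (auto simp: K_def cut_kernel_commute algebra_simps)
  finally have swap: "(LINT z|(\<mu> \<Otimes>\<^sub>M \<mu>). (\<lambda>(x, y). K x y * g y) z)
      = - (LINT z|(\<mu> \<Otimes>\<^sub>M \<mu>). (\<lambda>(x, y). K x y * g x) z)"
    by simp
  have "pb_form \<mu> s f g = L2_inner (\<mu> \<Otimes>\<^sub>M \<mu>) (grad r f) (grad r g)"
    by (rule pb_form_eq_grad[OF r f g])
  also have "\<dots> = (LINT z|(\<mu> \<Otimes>\<^sub>M \<mu>). (\<lambda>(x, y). K x y * g x) z - (\<lambda>(x, y). K x y * g y) z)"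
    unfolding L2_inner_def
  proof (rule Bochner_Integration.integral_cong[OF refl])
    fix z :: "'a \<times> 'a"
    obtain x y where z: "z = (x, y)" by force
    have "of_real (sqrt (cut_kernel r x y)) * of_real (sqrt (cut_kernel r x y))
        = complex_of_real (cut_kernel r x y)"
      by (simp add: cut_kernel_nonneg flip: of_real_mult)
    then have "cnj (grad r f z) * grad r g z = of_real (cut_kernel r x y) * (cnj (f x - f y) * (g x - g y))"
      by (simp add: z grad_def ac_simps)
    then show "cnj (grad r f z) * grad r g z = (\<lambda>(x, y). K x y * g x) z - (\<lambda>(x, y). K x y * g y) z"
      by (simp add: z K_def algebra_simps)
  qed
  also have "\<dots> = 2 * (LINT z|(\<mu> \<Otimes>\<^sub>M \<mu>). (\<lambda>(x, y). K x y * g x) z)"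
    using Bochner_Integration.integral_diff[OF i1 i2] swap by simp
  also have "(LINT z|(\<mu> \<Otimes>\<^sub>M \<mu>). (\<lambda>(x, y). K x y * g x) z) = (LINT x|\<mu>. LINT y|\<mu>. K x y * g x)"
    using P.integral_fst'[OF i1] by simp
  also have "\<dots> = L2_inner \<mu> (jump_op f) g"
    unfolding L2_inner_def
  proof (rule Bochner_Integration.integral_cong[OF refl])
    fix x
    have "cnj (jump_op f x) = (LINT y|\<mu>. K x y)"
      unfolding jump_op_cutoff[OF f] Bochner_Integration.integral_cnj[of \<mu>, symmetric] by (simp add: K_def)
    then show "(LINT y|\<mu>. K x y * g x) = cnj (jump_op f x) * g x" by simp
  qed
  finally show ?thesis .
qed

lemma pb_form_cnj:
  assumes "f \<in> test_functions" "g \<in> test_functions"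
  shows "cnj (pb_form \<mu> s f g) = pb_form \<mu> s g f"
proof -
  obtain r where r: "0 < r" and f: "const_at_scale r f" and g: "const_at_scale r g"
    using test_functionE2[OF assms] .
  show ?thesis using pb_form_eq_grad[OF r f g] pb_form_eq_grad[OF r g f] L2_inner_cnj by simp
qed

proposition jump_op_symmetric:
  assumes "f \<in> test_functions" "g \<in> test_functions"
  shows "L2_inner \<mu> (jump_op f) g = L2_inner \<mu> f (jump_op g)"
proof -
  have "2 * L2_inner \<mu> (jump_op f) g = cnj (2 * L2_inner \<mu> (jump_op g) f)"
    using pb_form_cnj[OF assms(2,1)] pb_form_jump_op assms by simp
  then show ?thesis by (simp add: L2_inner_cnj)
qed

section \<open>Closability and the operator of the form\<close>

definition energy :: "('a \<Rightarrow> complex) \<Rightarrow> real" where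
  "energy f = sqrt (cmod (pb_form \<mu> s f f))"

lemma energy_eq_grad:
  assumes "0 < r" "const_at_scale r f"
  shows "energy f = L2_norm (\<mu> \<Otimes>\<^sub>M \<mu>) (grad r f)"
  unfolding energy_def pb_form_eq_grad[OF assms(1) assms(2) assms(2)] L2_inner_self
  by (simp add: norm_power)

lemma energy_nonneg [simp]: "0 \<le> energy f" by (simp add: energy_def)

lemma energy_triangle:
  assumes "f \<in> test_functions" "g \<in> test_functions"
  shows "energy f \<le> energy (\<lambda>x. f x - g x) + energy g"
proof -
  obtain r where r: "0 < r" and f: "const_at_scale r f" and g: "const_at_scale r g"
    using test_functionE2[OF assms] .
  show ?thesis
    unfolding energy_eq_grad[OF r f] energy_eq_grad[OF r g]
      energy_eq_grad[OF r const_at_scale_comp(2)[OF f g, of "(-)"]] grad_diff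
    by (intro L2_norm_le_diff grad_L2 r f g)
qed

lemma pb_form_Cauchy_Schwarz:
  assumes "f \<in> test_functions" "g \<in> test_functions"
  shows "cmod (pb_form \<mu> s f g) \<le> energy f * energy g"
proof -
  obtain r where r: "0 < r" and f: "const_at_scale r f" and g: "const_at_scale r g"
    using test_functionE2[OF assms] .
  show ?thesis
    unfolding energy_eq_grad[OF r f] energy_eq_grad[OF r g] pb_form_eq_grad[OF r f g]
    by (intro L2_Cauchy_Schwarz grad_L2 r f g)
qed

lemma pb_form_diff_left:
  assumes "f \<in> test_functions" "h \<in> test_functions" "g \<in> test_functions"
  shows "pb_form \<mu> s (\<lambda>x. f x - h x) g = pb_form \<mu> s f g - pb_form \<mu> s h g"
  unfolding pb_form_jump_op[OF assms(1,3)] pb_form_jump_op[OF assms(2,3)]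
    pb_form_jump_op[OF test_function_comp2[OF assms(1,2), of "(-)"] assms(3)] jump_op_diff[OF assms(1,2)]
  by (simp add: L2_inner_diff_left test_L2 jump_op_test assms right_diff_distrib)

lemma test_diff: "f \<in> test_functions \<Longrightarrow> g \<in> test_functions
    \<Longrightarrow> (\<lambda>x. f x - g x) \<in> (test_functions :: ('a \<Rightarrow> complex) set)"
  by (rule test_function_comp2)

text \<open>
  For fixed m, the form of \<open>E m\<close> and \<open>E n\<close> is an inner product of \<open>E n\<close> with
  a fixed test function and tends to zero; the remaining part is small by the Cauchy property.
\<close>

lemma pb_form_closable:
  assumes E: "\<And>n. E n \<in> test_functions"
    and lim: "(\<lambda>n. L2_norm \<mu> (E n)) \<longlonglongrightarrow> 0"
    and Cauchy: "\<And>e. 0 < e \<Longrightarrow> \<exists>N. \<forall>m\<ge>N. \<forall>n\<ge>N. energy (\<lambda>x. E m x - E n x) < e"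
  shows "(\<lambda>n. energy (E n)) \<longlonglongrightarrow> 0"
proof -
  obtain N1 where N1: "\<And>m n. N1 \<le> m \<Longrightarrow> N1 \<le> n \<Longrightarrow> energy (\<lambda>x. E m x - E n x) < 1"
    using Cauchy[of 1] by auto
  define B where "B = 1 + energy (E N1)"
  have B: "0 < B" "\<And>n. N1 \<le> n \<Longrightarrow> energy (E n) \<le> B"
  proof -
    show "0 < B" unfolding B_def by (simp add: add_pos_nonneg)
    fix n assume "N1 \<le> n"
    then show "energy (E n) \<le> B"
      using energy_triangle[OF E[of n] E[of N1]] N1[of n N1] unfolding B_def by simp
  qed
  have "(\<lambda>n. (energy (E n))\<^sup>2) \<longlonglongrightarrow> 0"
  proof (rule order_tendstoI)
    fix e :: real assume e: "0 < e"
    then have "0 < e / (2 * B)" using B(1) by simp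
    then obtain N2 where N2: "\<And>m n. N2 \<le> m \<Longrightarrow> N2 \<le> n \<Longrightarrow> energy (\<lambda>x. E m x - E n x) < e / (2 * B)"
      using Cauchy by metis
    define m where "m = max N1 N2"
    have "(\<lambda>n. 2 * (L2_norm \<mu> (jump_op (E m)) * L2_norm \<mu> (E n))) \<longlonglongrightarrow> 2 * (L2_norm \<mu> (jump_op (E m)) * 0)"
      by (intro tendsto_intros lim)
    then have "\<forall>\<^sub>F n in sequentially. 2 * (L2_norm \<mu> (jump_op (E m)) * L2_norm \<mu> (E n)) < e / 2"
      by (rule order_tendstoD(2)) (use e in simp)
    then show "\<forall>\<^sub>F n in sequentially. (energy (E n))\<^sup>2 < e"
      using eventually_ge_at_top[of m]
    proof eventually_elim
      case (elim n)
      have "energy (E n) * energy (\<lambda>x. E m x - E n x) \<le> B * (e / (2 * B))"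
        using B N2[of m n] elim(2) by (intro mult_mono) (auto simp: m_def intro: less_imp_le)
      also have "\<dots> = e / 2" using B(1) by simp
      finally have 1: "cmod (pb_form \<mu> s (\<lambda>x. E m x - E n x) (E n)) \<le> e / 2"
        using pb_form_Cauchy_Schwarz[OF test_diff[OF E E] E, of m n n] by (simp add: mult.commute)
      have 2: "cmod (pb_form \<mu> s (E m) (E n)) < e / 2"
        unfolding pb_form_jump_op[OF E E]
        using L2_Cauchy_Schwarz[OF test_L2[OF jump_op_test[OF E]] test_L2[OF E], of m n] elim(1)
        by (simp add: norm_mult)
      have "pb_form \<mu> s (E n) (E n) = pb_form \<mu> s (E m) (E n) - pb_form \<mu> s (\<lambda>x. E m x - E n x) (E n)"
        by (simp add: pb_form_diff_left E)
      then have "cmod (pb_form \<mu> s (E n) (E n)) < e"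
        using 1 2 norm_triangle_ineq4[of "pb_form \<mu> s (E m) (E n)" "pb_form \<mu> s (\<lambda>x. E m x - E n x) (E n)"]
        by simp
      then show ?case by (simp add: energy_def)
    qed
  next
    fix a :: real assume "a < 0"
    then show "\<forall>\<^sub>F n in sequentially. a < (energy (E n))\<^sup>2"
      by (intro always_eventually allI) (auto intro: less_le_trans)
  qed
  then have "(\<lambda>n. sqrt ((energy (E n))\<^sup>2)) \<longlonglongrightarrow> sqrt 0" by (rule tendsto_real_sqrt)
  then show ?thesis by simp
qed

lemma form_approximatesD:
  assumes "form_approximates \<mu> s F f"
  shows "f \<in> L2 \<mu>" "\<And>n. F n \<in> test_functions" "(\<lambda>n. L2_norm \<mu> (\<lambda>x. F n x - f x)) \<longlonglongrightarrow> 0"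
    "\<And>e. 0 < e \<Longrightarrow> \<exists>N. \<forall>m\<ge>N. \<forall>n\<ge>N. energy (\<lambda>x. F m x - F n x) < e"
proof -
  show "f \<in> L2 \<mu>" "\<And>n. F n \<in> test_functions" "(\<lambda>n. L2_norm \<mu> (\<lambda>x. F n x - f x)) \<longlonglongrightarrow> 0"
    using assms by (auto simp: form_approximates_def)
  fix e :: real assume e: "0 < e"
  then obtain N where "\<forall>m\<ge>N. \<forall>n\<ge>N. cmod (pb_form \<mu> s (\<lambda>x. F m x - F n x) (\<lambda>x. F m x - F n x)) < e\<^sup>2"
    using assms unfolding form_approximates_def by (meson zero_less_power)
  then show "\<exists>N. \<forall>m\<ge>N. \<forall>n\<ge>N. energy (\<lambda>x. F m x - F n x) < e"
    unfolding energy_def using e by (intro exI[of _ N]) (auto intro!: real_less_lsqrt)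
qed

lemma form_approximates_const:
  assumes "f \<in> test_functions"
  shows "form_approximates \<mu> s (\<lambda>_. f) f"
proof -
  have "pb_form \<mu> s (\<lambda>x. f x - f x) (\<lambda>x. f x - f x) = 0"
    using pb_form_jump_op[OF test_function_const[of 0] test_function_const[of 0]]
    by (simp add: L2_inner_def)
  then show ?thesis
    unfolding form_approximates_def using assms test_L2
    by (auto simp: L2_norm_def)
qed

text \<open>
  The approximating sequence of f may be replaced by f itself, by closability. The form with fixed
  first argument f is then an inner product, which passes to the limit.
\<close>

lemma neg_laplacian_test:
  assumes f: "f \<in> test_functions"
  shows "(f, \<lambda>x. 2 * jump_op f x) \<in> neg_laplacian \<mu> s"
proof -
  have "(\<lambda>n. pb_form \<mu> s (F n) (G n)) \<longlonglongrightarrow> L2_inner \<mu> (\<lambda>x. 2 * jump_op f x) g"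
    if F: "form_approximates \<mu> s F f" and G: "form_approximates \<mu> s G g" for F g G
  proof -
    note FD = form_approximatesD[OF F] and GD = form_approximatesD[OF G]
    have "(\<lambda>n. energy (\<lambda>x. F n x - f x)) \<longlonglongrightarrow> 0"
      by (rule pb_form_closable) (use FD f in \<open>simp_all add: test_diff\<close>)
    moreover obtain N where N: "\<And>n. N \<le> n \<Longrightarrow> energy (\<lambda>x. G n x - G N x) < 1"
      using GD(4)[of 1] by auto
    have bound: "energy (G n) \<le> 1 + energy (G N)" if "N \<le> n" for n
      using energy_triangle[OF GD(2)[of n] GD(2)[of N]] N[OF that] by simp
    ultimately have lim0: "(\<lambda>n. energy (\<lambda>x. F n x - f x) * (1 + energy (G N))) \<longlonglongrightarrow> 0 * (1 + energy (G N))"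
      by (intro tendsto_intros)
    have "(\<lambda>n. pb_form \<mu> s (\<lambda>x. F n x - f x) (G n)) \<longlonglongrightarrow> 0"
    proof (rule Lim_null_comparison)
      show "\<forall>\<^sub>F n in sequentially. norm (pb_form \<mu> s (\<lambda>x. F n x - f x) (G n)) \<le>
          energy (\<lambda>x. F n x - f x) * (1 + energy (G N))"
        using eventually_ge_at_top[of N]
      proof eventually_elim
        case (elim n)
        have "norm (pb_form \<mu> s (\<lambda>x. F n x - f x) (G n)) \<le> energy (\<lambda>x. F n x - f x) * energy (G n)"
          by (rule pb_form_Cauchy_Schwarz[OF test_diff[OF FD(2) f] GD(2)])
        also have "\<dots> \<le> energy (\<lambda>x. F n x - f x) * (1 + energy (G N))"
          by (intro mult_left_mono bound elim) simp
        finally show ?case .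
      qed
      show "(\<lambda>n. energy (\<lambda>x. F n x - f x) * (1 + energy (G N))) \<longlonglongrightarrow> 0"
        using lim0 by simp
    qed
    moreover have "(\<lambda>n. 2 * L2_inner \<mu> (jump_op f) (G n)) \<longlonglongrightarrow> 2 * L2_inner \<mu> (jump_op f) g"
      by (intro tendsto_intros L2_inner_tendsto)
        (use GD f in \<open>auto intro: test_L2 jump_op_test simp: L2_norm_def\<close>)
    ultimately have "(\<lambda>n. pb_form \<mu> s (\<lambda>x. F n x - f x) (G n) + 2 * L2_inner \<mu> (jump_op f) (G n))
        \<longlonglongrightarrow> 0 + 2 * L2_inner \<mu> (jump_op f) g"
      by (intro tendsto_add)
    then show ?thesis
      by (simp add: pb_form_diff_left FD GD f pb_form_jump_op[OF f GD(2)] L2_inner_scale_left)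
  qed
  moreover have "(\<lambda>x. 2 * jump_op f x) \<in> L2 \<mu>" by (intro L2_scale test_L2 jump_op_test f)
  ultimately show ?thesis
    unfolding neg_laplacian_def using form_approximates_const[OF f] by blast
qed

lemma disc_average_test:
  assumes f: "f \<in> test_functions"
  shows "\<forall>\<^sub>F v in discs_at z. L2_inner \<mu> (indicator v) f / of_real (measure \<mu> v) = f z"
proof -
  obtain r where r: "0 < r" "const_at_scale r f" using test_functionE[OF f] .
  show ?thesis using eventually_discs_at[OF r(1), of z]
  proof eventually_elim
    case (elim v)
    have "L2_inner \<mu> (indicator v) f = (LINT x|\<mu>. of_real (indicator v x) * f z)"
      unfolding L2_inner_def
    proof (rule Bochner_Integration.integral_cong[OF refl])
      fix x
      have "f x = f z" if "x \<in> v"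
        using diameter_bounded_bound[OF bounded_space that, of z] elim
        by (intro const_at_scaleD[OF r(2)]) auto
      then show "cnj (indicator v x) * f x = of_real (indicator v x) * f z"
        by (auto simp: indicator_def)
    qed
    also have "\<dots> = of_real (measure \<mu> v) * f z"
      using disc_sets[of v] elim by (simp add: integral_complex_of_real del: of_real_indicator)
    finally show ?case using disc_measure_pos[of v] elim by simp
  qed
qed

text \<open>
  Averages over shrinking discs recover the pointwise values because \<open>jump_op f\<close> is locally
  constant. They do not depend on the representative h of the image under the operator of the form,
  as they are inner products with indicators of discs, which the form determines.
\<close>

proposition vp_initial_eq: "vp_initial \<mu> s = {(f, g). f \<in> test_functions \<and> g = jump_op f}"
proof (intro set_eqI iffI; clarsimp)
  fix f g assume "(f, g) \<in> vp_initial \<mu> s"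
  then obtain h where f: "f \<in> test_functions" and h: "(f, h) \<in> neg_laplacian \<mu> s"
    and lim: "\<And>z. ((\<lambda>v. 1/2 * (L2_inner \<mu> (indicator v) h / of_real (measure \<mu> v))) \<longlongrightarrow> g z) (discs_at z)"
    by (auto simp: vp_initial_def)
  have inner: "L2_inner \<mu> (indicator v) h = 2 * L2_inner \<mu> (indicator v) (jump_op f)" if v: "v \<in> discs" for v
  proof -
    have t: "indicator v \<in> test_functions" using test_function_indicator_disc[OF v, of 1] by simp
    have "(\<lambda>n. pb_form \<mu> s f (indicator v)) \<longlonglongrightarrow> L2_inner \<mu> h (indicator v)"
      using h form_approximates_const[OF f] form_approximates_const[OF t]
      unfolding neg_laplacian_def by blast
    then have "L2_inner \<mu> h (indicator v) = 2 * L2_inner \<mu> (jump_op f) (indicator v)"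
      using pb_form_jump_op[OF f t] by (simp add: LIMSEQ_const_iff)
    then have "cnj (L2_inner \<mu> h (indicator v)) = cnj (2 * L2_inner \<mu> (jump_op f) (indicator v))" by simp
    then show ?thesis by (simp add: L2_inner_cnj)
  qed
  have "g z = jump_op f z" for z
  proof (rule tendsto_unique[OF discs_at_neq_bot lim])
    have "\<forall>\<^sub>F v in discs_at z. 1/2 * (L2_inner \<mu> (indicator v) h / of_real (measure \<mu> v)) = jump_op f z"
      using disc_average_test[OF jump_op_test[OF f], of z] eventually_discs_at[OF zero_less_one, of z]
      by eventually_elim (simp add: inner)
    then show "((\<lambda>v. 1/2 * (L2_inner \<mu> (indicator v) h / of_real (measure \<mu> v))) \<longlongrightarrow> jump_op f z) (discs_at z)"
      by (rule tendsto_eventually)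
  qed
  then show "f \<in> test_functions \<and> g = jump_op f" using f by auto
next
  fix f :: "'a \<Rightarrow> complex" assume f: "f \<in> test_functions"
  have "\<forall>\<^sub>F v in discs_at z. 1/2 * (L2_inner \<mu> (indicator v) (\<lambda>x. 2 * jump_op f x) / of_real (measure \<mu> v))
      = jump_op f z" for z
    using disc_average_test[OF jump_op_test[OF f], of z]
    by eventually_elim (simp add: L2_inner_scale_right)
  then show "(f, jump_op f) \<in> vp_initial \<mu> s"
    unfolding vp_initial_def using f neg_laplacian_test[OF f] by (auto intro!: tendsto_eventually)
qed

section \<open>Eigenfunctions\<close>

definition eigenfunction :: "real \<Rightarrow> ('a \<Rightarrow> complex) \<Rightarrow> bool" where
  "eigenfunction l \<phi> \<longleftrightarrow> \<phi> \<in> test_functions \<and> jump_op \<phi> = (\<lambda>x. of_real l * \<phi> x)"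

lemma eigenfunction_test: "eigenfunction l \<phi> \<Longrightarrow> \<phi> \<in> test_functions"
  by (simp add: eigenfunction_def)

lemma eigenfunction_scale: "eigenfunction l \<phi> \<Longrightarrow> eigenfunction l (\<lambda>x. a * \<phi> x)"
  by (auto simp: eigenfunction_def jump_op_scale intro: test_function_comp)

lemma eigenfunction_const: "eigenfunction 0 (\<lambda>x. a)"
  by (simp add: eigenfunction_def test_function_const jump_op_def fun_eq_iff)

lemma indicator_const_at_scale:
  assumes "v \<in> discs"
  shows "const_at_scale (diameter v) (indicator v :: 'a \<Rightarrow> complex)"
proof -
  obtain x where "x \<in> v" using disc_nonempty[OF assms] by auto
  then have v: "v = cball x (diameter v)" using disc_eq_cball[OF assms] by simp
  show ?thesis
    using const_at_scale_indicator_cball[OF order_refl, of "diameter v" 1 x] v by simp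
qed

lemma disc_test: "v \<in> discs \<Longrightarrow> (indicator v :: 'a \<Rightarrow> complex) \<in> test_functions"
  using test_function_indicator_disc[of v 1] by simp

lemma jump_kernel_outside_disc:
  assumes "w \<in> discs" "y \<in> w" "z \<in> w" "x \<notin> w"
  shows "jump_kernel x y = jump_kernel x z"
proof -
  have "diameter w < dist z x"
    using disc_eq_cball[OF assms(1,3)] assms(4) by (metis mem_cball not_le)
  moreover have "dist z y \<le> diameter w"
    using diameter_bounded_bound[OF bounded_space assms(3,2)] .
  ultimately show ?thesis
    using jump_kernel_local[of x x "diameter w" z y] disc_diameter_pos[OF assms(1)] by (simp add: dist_commute)
qed

lemma jump_op_indicator_outside:
  assumes w: "w \<in> discs" "z \<in> w" "x \<notin> w"
  shows "jump_op (indicator w) x = - of_real (jump_kernel x z * measure \<mu> w)"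
proof -
  have "jump_op (indicator w) x = (LINT y|\<mu>. of_real (- jump_kernel x z * indicator w y))"
    unfolding jump_op_def
  proof (rule Bochner_Integration.integral_cong[OF refl])
    fix y
    show "of_real (jump_kernel x y) * (indicator w x - indicator w y)
        = complex_of_real (- jump_kernel x z * indicator w y)"
    proof (cases "y \<in> w")
      case True
      then have "jump_kernel x y = jump_kernel x z" by (rule jump_kernel_outside_disc[OF w(1) _ w(2,3)])
      then show ?thesis using True w(3) by simp
    qed (use w(3) in simp)
  qed
  also have "\<dots> = of_real (LINT y|\<mu>. - jump_kernel x z * indicator w y)"
    by (rule integral_complex_of_real)
  also have "(LINT y|\<mu>. - jump_kernel x z * indicator w y) = - jump_kernel x z * measure \<mu> w"
    using disc_sets[OF w(1)] by simp
  finally show ?thesis by simp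
qed

lemma jump_op_indicator_inside:
  assumes uv: "u \<in> discs" "v \<in> discs" "u \<subset> v" and x: "x \<in> u"
    and sep: "\<And>x y. x \<in> u \<Longrightarrow> y \<in> v - u \<Longrightarrow> dist x y = diameter v"
  shows "jump_op (indicator u) x = jump_op (indicator v) x + of_real (jump v * (measure \<mu> v - measure \<mu> u))"
proof -
  have Jv: "jump_kernel x y = jump v" if "y \<in> v - u" for y
  proof -
    have "v = cball x (dist x y)" using disc_eq_cball[OF uv(2), of x] sep[OF x that] x uv(3) by auto
    then show ?thesis using x that by (auto simp: jump_kernel_def)
  qed
  have "jump_op (indicator u) x - jump_op (indicator v) x
      = (LINT y|\<mu>. of_real (jump_kernel x y) * (indicator u x - indicator u y)
      - of_real (jump_kernel x y) * (indicator v x - indicator v y))"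
    unfolding jump_op_def
    by (rule Bochner_Integration.integral_diff[symmetric]) (intro jump_op_integrable disc_test uv)+
  also have "\<dots> = (LINT y|\<mu>. of_real (jump v * indicator (v - u) y))"
    by (rule Bochner_Integration.integral_cong[OF refl])
      (use Jv x uv(3) in \<open>auto simp: indicator_def\<close>)
  also have "\<dots> = of_real (LINT y|\<mu>. jump v * indicator (v - u) y)"
    by (rule integral_complex_of_real)
  also have "(LINT y|\<mu>. jump v * indicator (v - u) y) = jump v * measure \<mu> (v - u)"
    using disc_sets[OF uv(1)] disc_sets[OF uv(2)] by simp
  also have "measure \<mu> (v - u) = measure \<mu> v - measure \<mu> u"
    using finite_measure_Diff[OF disc_sets[OF uv(2)] disc_sets[OF uv(1)]] uv(3) by auto
  finally show ?thesis by (simp add: algebra_simps)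
qed

text \<open>
  If v is the parent of u, the kernel does not distinguish points of u as seen from outside u, and
  it is constant between u and the rest of v. The combination of the two indicators is orthogonal to
  constants, so nothing remains outside v, and inside v both values are multiplied by the same
  number.
\<close>

proposition disc_eigenfunction:
  assumes uv: "u \<in> discs" "v \<in> discs" "u \<subset> v"
    and sep: "\<And>x y. x \<in> u \<Longrightarrow> y \<in> v - u \<Longrightarrow> dist x y = diameter v"
  obtains l where "eigenfunction l (\<lambda>x. indicator u x - of_real (measure \<mu> u / measure \<mu> v) * indicator v x)"
proof -
  define m where "m = measure \<mu> u / measure \<mu> v"
  have m: "measure \<mu> u = m * measure \<mu> v"
    using disc_measure_pos[OF uv(2)] by (simp add: m_def)
  obtain z where z: "z \<in> u" using disc_nonempty[OF uv(1)] by auto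
  then have zv: "z \<in> v" using uv(3) by auto
  (* the total jump rate from a point of v to the complement of v *)
  define c where "c = (LINT y|\<mu>. jump_kernel z y * (indicator v z - indicator v y))"
  have c: "jump_op (indicator v) x = of_real c" if "x \<in> v" for x
  proof -
    have "dist x z \<le> diameter v" using diameter_bounded_bound[OF bounded_space that zv] .
    then have "jump_op (indicator v) x = jump_op (indicator v) z"
      by (rule const_at_scaleD[OF jump_op_const_at_scale[OF disc_diameter_pos[OF uv(2)]
          indicator_const_at_scale[OF uv(2)]]])
    also have "\<dots> = (LINT y|\<mu>. of_real (jump_kernel z y * (indicator v z - indicator v y)))"
      unfolding jump_op_def by (rule Bochner_Integration.integral_cong[OF refl]) (simp add: indicator_def)
    also have "\<dots> = of_real c" unfolding c_def by (rule integral_complex_of_real)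
    finally show ?thesis .
  qed
  let ?phi = "\<lambda>x. indicator u x - of_real m * indicator v x :: complex"
  have t: "(\<lambda>x. of_real m * indicator v x :: complex) \<in> test_functions"
    by (rule test_function_indicator_disc[OF uv(2)])
  have jump_op: "jump_op ?phi = (\<lambda>x. jump_op (indicator u) x - of_real m * jump_op (indicator v) x)"
    using jump_op_diff[OF disc_test[OF uv(1)] t] by (simp add: jump_op_scale)
  have "jump_op ?phi x = of_real (c + jump v * measure \<mu> v) * ?phi x" for x
  proof -
    consider (u) "x \<in> u" | (v) "x \<in> v - u" | (out) "x \<notin> v" by blast
    then show ?thesis
    proof cases
      case u
      then have xv: "x \<in> v" using uv(3) by auto
      have "jump_op (indicator u) x = of_real (c + jump v * (measure \<mu> v - m * measure \<mu> v))"
        using jump_op_indicator_inside[OF uv u sep] c[OF xv] m by simp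
      then show ?thesis using u xv c[OF xv] unfolding jump_op by (simp add: algebra_simps)
    next
      case v
      then have xv: "x \<in> v" by auto
      have "dist x z = diameter v" using sep[OF z v] by (simp add: dist_commute)
      moreover have "v = cball x (diameter v)" using disc_eq_cball[OF uv(2) xv] .
      moreover have "x \<noteq> z" using v z by auto
      ultimately have "jump_kernel x z = jump v" by (simp add: jump_kernel_def)
      then have "jump_op (indicator u) x = - of_real (jump v * (m * measure \<mu> v))"
        using jump_op_indicator_outside[OF uv(1) z, of x] v m by simp
      then show ?thesis using v c[OF xv] unfolding jump_op by (simp add: algebra_simps)
    next
      case out
      then have "x \<notin> u" using uv(3) by auto
      then show ?thesis
        using out jump_op_indicator_outside[OF uv(1) z, of x] jump_op_indicator_outside[OF uv(2) zv out] m
        unfolding jump_op by simp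
    qed
  qed
  then have "eigenfunction (c + jump v * measure \<mu> v) ?phi"
    unfolding eigenfunction_def using test_diff[OF disc_test[OF uv(1)] t] by auto
  then show ?thesis using that unfolding m_def by blast
qed

text \<open>
  Test functions are finite sums of eigenfunctions. This reduces the identities for the exponential
  series below to scalar ones.
\<close>

proposition eigenfunction_induct [consumes 1, case_names eigenfunction add]:
  assumes f: "f \<in> test_functions"
    and eigenfunction: "\<And>l \<phi>. eigenfunction l \<phi> \<Longrightarrow> P \<phi>"
    and add: "\<And>f g. f \<in> test_functions \<Longrightarrow> g \<in> test_functions \<Longrightarrow> P f \<Longrightarrow> P g \<Longrightarrow> P (\<lambda>y. f y + g y)"
  shows "P f"
  using f
proof (induction rule: test_function_induct)
  case (indicator v a)
  then have "\<forall>a. P (\<lambda>y. a * indicator v y)"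
  proof (induction rule: disc_induct)
    case root
    show ?case using eigenfunction[OF eigenfunction_const] by simp
  next
    case (step u v)
    show ?case
    proof
      fix a
      let ?m = "of_real (measure \<mu> u / measure \<mu> v) :: complex"
      let ?phi = "\<lambda>x. indicator u x - ?m * indicator v x"
      obtain l where l: "eigenfunction l ?phi" using disc_eigenfunction[OF step(1-4)] by blast
      have "P (\<lambda>y. a * ?phi y + (a * ?m) * indicator v y)"
      proof (rule add)
        show "P (\<lambda>y. a * ?phi y)" by (rule eigenfunction[OF eigenfunction_scale[OF l]])
        show "(\<lambda>y. a * ?phi y) \<in> test_functions" using eigenfunction_scale[OF l] by (rule eigenfunction_test)
        show "(\<lambda>y. (a * ?m) * indicator v y) \<in> test_functions"
          by (rule test_function_indicator_disc[OF step(2)])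
        show "P (\<lambda>y. (a * ?m) * indicator v y)" using step(5) by blast
      qed
      also have "(\<lambda>y. a * ?phi y + (a * ?m) * indicator v y) = (\<lambda>y. a * indicator u y)"
        by (auto simp: algebra_simps)
      finally show "P (\<lambda>y. a * indicator u y)" .
    qed
  qed
  then show ?case by blast
qed (rule add)

section \<open>The semigroup on test functions\<close>

text \<open>
  The operator \<open>exp (- t jump_op)\<close>. Pointwise convergence of the series is enough, because on a
  finite sum of eigenfunctions it is a finite sum of scalar exponential series.
\<close>

definition exp_op :: "real \<Rightarrow> ('a \<Rightarrow> complex) \<Rightarrow> 'a \<Rightarrow> complex" where
  "exp_op t f x = (\<Sum>k. ((of_real (- t)) ^ k /\<^sub>R fact k) * (jump_op ^^ k) f x)"

lemma funpow_test: "f \<in> test_functions \<Longrightarrow> (jump_op ^^ k) f \<in> test_functions"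
  by (induction k) (auto intro: jump_op_test)

lemma funpow_jump_op_add:
  assumes "f \<in> test_functions" "g \<in> test_functions"
  shows "(jump_op ^^ k) (\<lambda>x. f x + g x) = (\<lambda>x. (jump_op ^^ k) f x + (jump_op ^^ k) g x)"
  by (induction k) (simp_all add: jump_op_add funpow_test assms)

lemma funpow_jump_op_eigenfunction: "eigenfunction l \<phi> \<Longrightarrow> (jump_op ^^ k) \<phi> = (\<lambda>x. of_real l ^ k * \<phi> x)"
  by (induction k) (auto simp: jump_op_scale eigenfunction_def)

lemma exp_op_eigenfunction_sums:
  assumes "eigenfunction l \<phi>"
  shows "(\<lambda>k. ((of_real (- t)) ^ k /\<^sub>R fact k) * (jump_op ^^ k) \<phi> x) sums (of_real (exp (- t * l)) * \<phi> x)"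
proof -
  have "(\<lambda>k. (complex_of_real (- t * l)) ^ k /\<^sub>R fact k * \<phi> x) sums (exp (of_real (- t * l)) * \<phi> x)"
    by (intro sums_mult2 exp_converges)
  moreover have "complex_of_real (- t * l) ^ k = of_real (- t) ^ k * of_real l ^ k" for k
    by (simp only: of_real_mult power_mult_distrib)
  ultimately show ?thesis
    unfolding funpow_jump_op_eigenfunction[OF assms] by (simp only: exp_of_real mult_scaleR_left mult.assoc)
qed

lemma exp_op_eigenfunction: "eigenfunction l \<phi> \<Longrightarrow> exp_op t \<phi> = (\<lambda>x. of_real (exp (- t * l)) * \<phi> x)"
  unfolding exp_op_def by (rule ext, rule sums_unique[symmetric], rule exp_op_eigenfunction_sums)

lemma exp_op_summable:
  assumes "f \<in> test_functions"
  shows "summable (\<lambda>k. ((of_real (- t)) ^ k /\<^sub>R fact k) * (jump_op ^^ k) f x)"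
  using assms
proof (induction rule: eigenfunction_induct)
  case (eigenfunction l \<phi>)
  then show ?case using exp_op_eigenfunction_sums by (meson sums_summable)
next
  case (add f g)
  show ?case unfolding funpow_jump_op_add[OF add(1,2)] distrib_left by (intro summable_add add)
qed

lemma exp_op_add:
  assumes "f \<in> test_functions" "g \<in> test_functions"
  shows "exp_op t (\<lambda>x. f x + g x) = (\<lambda>x. exp_op t f x + exp_op t g x)"
  unfolding exp_op_def funpow_jump_op_add[OF assms] distrib_left
  by (intro ext suminf_add[symmetric] exp_op_summable assms)

lemma exp_op_test: "f \<in> test_functions \<Longrightarrow> exp_op t f \<in> test_functions"
proof (induction rule: eigenfunction_induct)
  case (eigenfunction l \<phi>)
  then show ?case unfolding exp_op_eigenfunction[OF eigenfunction]
      by (rule test_function_comp[OF eigenfunction_test])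
next
  case (add f g)
  show ?case unfolding exp_op_add[OF add(1,2)] by (rule test_function_comp2[OF add(3,4)])
qed

lemma exp_op_scale: "f \<in> test_functions \<Longrightarrow> exp_op t (\<lambda>x. c * f x) = (\<lambda>x. c * exp_op t f x)"
proof (induction rule: eigenfunction_induct)
  case (eigenfunction l \<phi>)
  then show ?case unfolding exp_op_eigenfunction[OF eigenfunction] exp_op_eigenfunction[OF
      eigenfunction_scale[OF eigenfunction]] by (simp add: mult.left_commute)
next
  case (add f g)
  have t: "(\<lambda>x. c * f x) \<in> test_functions" "(\<lambda>x. c * g x) \<in> test_functions"
    using add(1,2) by (auto intro: test_function_comp)
  have "(\<lambda>x. c * (f x + g x)) = (\<lambda>x. c * f x + c * g x)" by (simp add: distrib_left)
  then show ?case using exp_op_add[OF t, of t] exp_op_add[OF add(1,2), of t] add(3,4)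
      by (simp add: distrib_left)
qed

lemma exp_op_diff:
  assumes "f \<in> test_functions" "g \<in> test_functions"
  shows "exp_op t (\<lambda>x. f x - g x) = (\<lambda>x. exp_op t f x - exp_op t g x)"
  using exp_op_add[OF assms(1) test_function_comp[OF assms(2), of "\<lambda>z. -1 * z"]] exp_op_scale[OF assms(2),
      of t "-1"]
  by simp

lemma exp_op_const: "exp_op t (\<lambda>x. a) = (\<lambda>x. a)"
  using exp_op_eigenfunction[OF eigenfunction_const] by simp

lemma exp_op_0: "f \<in> test_functions \<Longrightarrow> exp_op 0 f = f"
proof (induction rule: eigenfunction_induct)
  case (eigenfunction l \<phi>)
  then show ?case using exp_op_eigenfunction[OF eigenfunction] by simp
qed (simp add: exp_op_add)

lemma exp_op_semigroup: "f \<in> test_functions \<Longrightarrow> exp_op (t + t') f = exp_op t (exp_op t' f)"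
proof (induction rule: eigenfunction_induct)
  case (eigenfunction l \<phi>)
  have "exp (- (t + t') * l) = exp (- t * l) * exp (- t' * l)"
    by (simp add: exp_add[symmetric] algebra_simps)
  then show ?case
    unfolding exp_op_eigenfunction[OF eigenfunction] exp_op_eigenfunction[OF eigenfunction_scale[OF
        eigenfunction]] by (simp only: of_real_mult mult.assoc)
qed (simp add: exp_op_add exp_op_test)

text \<open>
  Eigenfunctions with different eigenvalues are orthogonal because the operator is symmetric.
\<close>

proposition exp_op_symmetric:
  assumes "f \<in> test_functions" "g \<in> test_functions"
  shows "L2_inner \<mu> (exp_op t f) g = L2_inner \<mu> f (exp_op t g)"
  using assms(1)
proof (induction rule: eigenfunction_induct)
  case (eigenfunction l \<phi>)
  note phi = eigenfunction
  show ?case using assms(2)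
  proof (induction rule: eigenfunction_induct)
    case (eigenfunction k \<psi>)
    have "of_real l * L2_inner \<mu> \<phi> \<psi> = of_real k * L2_inner \<mu> \<phi> \<psi>"
      using jump_op_symmetric[OF eigenfunction_test[OF phi] eigenfunction_test[OF eigenfunction]] phi
          eigenfunction
      by (simp add: eigenfunction_def L2_inner_scale_left L2_inner_scale_right)
    then have "L2_inner \<mu> \<phi> \<psi> = 0 \<or> l = k" by simp
    then show ?case
      unfolding exp_op_eigenfunction[OF phi] exp_op_eigenfunction[OF eigenfunction] L2_inner_scale_left
          L2_inner_scale_right by auto
  next
    case (add f g)
    then show ?case
      using eigenfunction_test[OF phi] by (simp add: exp_op_add L2_inner_add_right test_L2 exp_op_test)
  qed
next
  case (add f h)
  then show ?case
    using assms(2) by (simp add: exp_op_add L2_inner_add_left test_L2 exp_op_test)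
qed

text \<open>
  The exponential of \<open>- t jump_op\<close> is \<open>exp (- t c)\<close> times that of
  \<open>t (c - jump_op)\<close>. For large c the terms of the second series preserve positivity.
\<close>

lemma exp_op_uniformised:
  fixes c :: real
  defines "A \<equiv> \<lambda>h x. of_real c * h x - jump_op h x"
  assumes "f \<in> test_functions"
  shows "(\<lambda>k. ((of_real t) ^ k /\<^sub>R fact k) * (A ^^ k) f x) sums (of_real (exp (t * c)) * exp_op t f x)"
  using assms(2)
proof (induction rule: eigenfunction_induct)
  case (eigenfunction l \<phi>)
  have A: "(A ^^ k) \<phi> = (\<lambda>x. of_real (c - l) ^ k * \<phi> x)" for k
  proof (induction k)
    case (Suc k)
    have "A (\<lambda>x. z * \<phi> x) = (\<lambda>x. of_real (c - l) * (z * \<phi> x))" for z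
      unfolding A_def jump_op_scale using eigenfunction
          by (simp add: eigenfunction_def fun_eq_iff algebra_simps)
    then show ?case using Suc by (simp add: mult.assoc)
  qed simp
  have "(\<lambda>k. (complex_of_real (t * (c - l))) ^ k /\<^sub>R fact k * \<phi> x) sums (exp (of_real (t * (c - l))) * \<phi> x)"
    by (intro sums_mult2 exp_converges)
  moreover have "exp (complex_of_real (t * (c - l))) = of_real (exp (t * c)) * of_real (exp (- t * l))"
    by (simp add: exp_of_real[symmetric] exp_add[symmetric] algebra_simps)
  ultimately show ?case
    unfolding A exp_op_eigenfunction[OF eigenfunction] by (simp add: power_mult_distrib mult.assoc)
next
  case (add f g)
  have At: "(A ^^ k) h \<in> test_functions" if "h \<in> test_functions" for k h
  proof (induction k)
    case (Suc k)
    then show ?case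
      using test_function_comp2[OF _ jump_op_test, of "(A ^^ k) h" "(A ^^ k) h" "\<lambda>a b. of_real c * a - b"]
      by (simp add: A_def)
  qed (use that in simp)
  have "(A ^^ k) (\<lambda>x. f x + g x) = (\<lambda>x. (A ^^ k) f x + (A ^^ k) g x)" for k
  proof (induction k)
    case (Suc k)
    have "A (\<lambda>x. p x + q x) = (\<lambda>x. A p x + A q x)" if "p \<in> test_functions" "q \<in> test_functions" for p q
      by (simp add: A_def jump_op_add[OF that] fun_eq_iff algebra_simps)
    from this[OF At[OF add(1)] At[OF add(2)]] show ?case using Suc by simp
  qed simp
  then show ?case
    unfolding exp_op_add[OF add(1,2)] by (simp only: distrib_left) (intro sums_add add)
qed

definition nonneg_fun :: "('a \<Rightarrow> complex) \<Rightarrow> bool" where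
  "nonneg_fun f \<longleftrightarrow> (\<forall>x. Im (f x) = 0 \<and> 0 \<le> Re (f x))"

text \<open>
  The only negative contribution to \<open>- jump_op h x\<close> is \<open>h x\<close> times the total jump rate at scale
  r, which is at most B.
\<close>

lemma nonneg_shifted_jump_op:
  assumes r: "0 < r" and h: "const_at_scale r h" and nn: "nonneg_fun h"
    and B: "0 \<le> B" "\<And>x y. cut_kernel r x y \<le> B"
  shows "nonneg_fun (\<lambda>x. of_real B * h x - jump_op h x)"
proof -
  have re: "h x = of_real (Re (h x))" for x
    using nn by (simp add: nonneg_fun_def complex_eq_iff)
  have "jump_op h x = of_real (LINT y|\<mu>. cut_kernel r x y * (Re (h x) - Re (h y)))" for x
  proof -
    have "jump_op h x = (LINT y|\<mu>. of_real (cut_kernel r x y * (Re (h x) - Re (h y))))"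
      unfolding jump_op_cutoff[OF h] using re
      by (intro Bochner_Integration.integral_cong refl) (metis of_real_diff of_real_mult)
    then show ?thesis by (simp only: integral_complex_of_real)
  qed
  moreover have "(LINT y|\<mu>. cut_kernel r x y * (Re (h x) - Re (h y))) \<le> B * Re (h x)" for x
  proof -
    have "(LINT y|\<mu>. cut_kernel r x y * (Re (h x) - Re (h y))) \<le> (LINT y|\<mu>. B * Re (h x))"
    proof (rule integral_mono)
      have "integrable \<mu> (\<lambda>y. Re (of_real (cut_kernel r x y) * (h x - h y)))"
        by (intro integrable_Re test_integrable cutoff_test r h)
      then show "integrable \<mu> (\<lambda>y. cut_kernel r x y * (Re (h x) - Re (h y)))" by simp
      fix y
      have "0 \<le> Re (h x)" "0 \<le> Re (h y)" using nn by (auto simp: nonneg_fun_def)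
      then have "cut_kernel r x y * (Re (h x) - Re (h y)) \<le> cut_kernel r x y * Re (h x)"
        by (intro mult_left_mono cut_kernel_nonneg) simp
      also have "\<dots> \<le> B * Re (h x)" using B(2) \<open>0 \<le> Re (h x)\<close> by (intro mult_right_mono)
      finally show "cut_kernel r x y * (Re (h x) - Re (h y)) \<le> B * Re (h x)" .
    qed simp
    then show ?thesis by (simp add: prob_space)
  qed
  ultimately show ?thesis using nn by (simp add: nonneg_fun_def)
qed

text \<open>
  At a fixed scale the operator is bounded, so after a shift by a large constant its negative
  preserves non-negative functions, and so do all terms of the shifted exponential series.
\<close>

proposition exp_op_nonneg:
  assumes f: "f \<in> test_functions" and nn: "nonneg_fun f" and t: "0 \<le> t"
  shows "nonneg_fun (exp_op t f)"
proof -
  obtain r where r: "0 < r" "const_at_scale r f" using test_functionE[OF f] .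
  obtain B where B: "0 \<le> B" "\<And>x y. cut_kernel r x y \<le> B" using cut_kernel_bounded[OF r(1)] by metis
  define A where "A = (\<lambda>h x. of_real B * h x - jump_op h x)"
  have A: "const_at_scale r ((A ^^ k) f) \<and> nonneg_fun ((A ^^ k) f)" for k
  proof (induction k)
    case 0
    then show ?case using r nn by simp
  next
    case (Suc k)
    then have "nonneg_fun (A ((A ^^ k) f))"
      unfolding A_def using nonneg_shifted_jump_op[OF r(1) _ _ B] by blast
    moreover have "const_at_scale r (A ((A ^^ k) f))"
    proof -
      have c: "const_at_scale r ((A ^^ k) f)" using Suc by blast
      show ?thesis
        using const_at_scale_comp(2)[OF c jump_op_const_at_scale[OF r(1) c],
            where k = "\<lambda>a b. of_real B * a - b"]
        by (simp add: A_def)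
    qed
    ultimately show ?case by simp
  qed
  have "Im (exp_op t f x) = 0 \<and> 0 \<le> Re (exp_op t f x)" for x
  proof -
    have s: "(\<lambda>k. ((of_real t) ^ k /\<^sub>R fact k) * (A ^^ k) f x) sums (of_real (exp (t * B)) * exp_op t f x)"
      unfolding A_def by (rule exp_op_uniformised[OF f])
    have coef: "complex_of_real t ^ k /\<^sub>R fact k = of_real (t ^ k / fact k)" for k
      by (simp add: scaleR_conv_of_real field_simps)
    have terms: "Im ((of_real t ^ k /\<^sub>R fact k) * (A ^^ k) f x) = 0"
      "0 \<le> Re ((of_real t ^ k /\<^sub>R fact k) * (A ^^ k) f x)" for k
    proof -
      have "Im (of_real a * z) = a * Im z" "Re (of_real a * z) = a * Re z" for a z by auto
      then show "Im ((of_real t ^ k /\<^sub>R fact k) * (A ^^ k) f x) = 0"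
        "0 \<le> Re ((of_real t ^ k /\<^sub>R fact k) * (A ^^ k) f x)"
        unfolding coef using A[of k] t by (simp_all only:) (auto simp: nonneg_fun_def)
    qed
    have "Im (of_real (exp (t * B)) * exp_op t f x) = 0"
      using sums_unique2[OF sums_Im[OF s]] unfolding terms(1) using sums_zero by blast
    moreover have "0 \<le> Re (of_real (exp (t * B)) * exp_op t f x)"
      using sums_le[OF _ sums_zero sums_Re[OF s]] terms(2) by simp
    ultimately show ?thesis by (simp add: zero_le_mult_iff)
  qed
  then show ?thesis by (simp add: nonneg_fun_def)
qed

lemma exp_op_real_indicator:
  assumes "A \<in> clopen_sets" "0 \<le> t"
  shows "exp_op t (indicator A) x = of_real (Re (exp_op t (indicator A) x))" "0 \<le> Re (exp_op t (indicator A) x)"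
proof -
  have "nonneg_fun (indicator A)" by (auto simp: nonneg_fun_def indicator_def)
  then have "nonneg_fun (exp_op t (indicator A))"
    using exp_op_nonneg[OF test_function_indicator[OF assms(1)] _ assms(2)] by blast
  then show "exp_op t (indicator A) x = of_real (Re (exp_op t (indicator A) x))" "0
      \<le> Re (exp_op t (indicator A) x)"
    by (auto simp: nonneg_fun_def complex_eq_iff)
qed

section \<open>The heat kernel\<close>

definition kernel_spec :: "real \<Rightarrow> 'a \<Rightarrow> 'a measure \<Rightarrow> bool" where
  "kernel_spec t x M \<longleftrightarrow> sets M = sets borel \<and> prob_space M \<and>
     (\<forall>A\<in>clopen_sets. emeasure M A = ennreal (Re (exp_op t (indicator A) x)))"

text \<open>
  By positivity, the values of the semigroup on indicators of clopen sets form a finitely additive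
  set function, which compactness makes countably additive.
\<close>

proposition kernel_exists:
  assumes t: "0 \<le> t"
  shows "\<exists>M. kernel_spec t x M"
proof -
  define m where "m = (\<lambda>A. ennreal (Re (exp_op t (indicator A) x)))"
  interpret ring_of_sets UNIV clopen_sets by (rule ring_of_clopen_sets)
  have m_empty: "m {} = 0"
    using exp_op_const[of t 0] by (simp add: m_def indicator_def[abs_def])
  have m_add: "m (A \<union> B) = m A + m B" if AB: "A \<in> clopen_sets" "B \<in> clopen_sets" "A \<inter> B = {}" for A B
  proof -
    have "indicator (A \<union> B) = (\<lambda>y. indicator A y + indicator B y :: complex)"
      using AB(3) by (auto simp: indicator_def fun_eq_iff)
    then have "exp_op t (indicator (A \<union> B)) x = exp_op t (indicator A) x + exp_op t (indicator B) x"
      using exp_op_add[OF AB(1,2)[THEN test_function_indicator]] by simp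
    then show ?thesis
      unfolding m_def using exp_op_real_indicator(2)[OF AB(1) t] exp_op_real_indicator(2)[OF AB(2) t]
      by (simp add: ennreal_plus)
  qed
  have "\<exists>m'. (\<forall>A\<in>clopen_sets. m' A = m A) \<and> measure_space UNIV (sigma_sets UNIV clopen_sets) m'"
  proof (rule caratheodory_empty_continuous)
    show "positive clopen_sets m" using m_empty by (simp add: positive_def)
    show "additive clopen_sets m" using m_add by (simp add: additive_def)
    show "m A \<noteq> \<infinity>" for A by (simp add: m_def)
    show "(\<lambda>i. m (A i)) \<longlonglongrightarrow> 0" if A: "range A \<subseteq> clopen_sets" "decseq A" "(\<Inter>i. A i) = {}" for A
    proof -
      obtain N where N: "\<And>n. N \<le> n \<Longrightarrow> A n = {}" using clopen_decseq_empty[OF A] by blast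
      have "\<forall>\<^sub>F n in sequentially. m (A n) = 0"
        using eventually_ge_at_top[of N] by eventually_elim (simp add: N m_empty)
      then show ?thesis by (rule tendsto_eventually)
    qed
  qed
  then obtain m' where m': "\<And>A. A \<in> clopen_sets \<Longrightarrow> m' A = m A"
    and ms: "measure_space UNIV (sigma_sets UNIV clopen_sets) m'" by blast
  define M where "M = measure_of UNIV clopen_sets m'"
  have sets: "sets M = sets borel" unfolding M_def by (simp add: sigma_sets_clopen)
  have em: "emeasure M A = m A" if A: "A \<in> clopen_sets" for A
  proof -
    have "emeasure M A = m' A"
      using ms A sets_measure_of[of clopen_sets UNIV m']
      by (intro emeasure_measure_of[OF M_def]) (auto simp: measure_space_def M_def)
    then show ?thesis using m'[OF A] by simp
  qed
  have "space M = UNIV" using sets_eq_imp_space_eq[OF sets] by simp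
  moreover have "m UNIV = 1"
    using exp_op_const[of t 1] by (simp add: m_def indicator_def[abs_def])
  ultimately have "prob_space M" using em[OF clopen_UNIV] by (intro prob_spaceI) simp
  then show ?thesis unfolding kernel_spec_def using sets em by (auto simp: m_def)
qed

definition heat_kernel :: "real \<Rightarrow> 'a \<Rightarrow> 'a measure" where
  "heat_kernel t x = (SOME M. kernel_spec t x M)"

lemma heat_kernel_spec: "0 \<le> t \<Longrightarrow> kernel_spec t x (heat_kernel t x)"
  unfolding heat_kernel_def using kernel_exists by (rule someI_ex)

lemma heat_kernel_sets: "0 \<le> t \<Longrightarrow> sets (heat_kernel t x) = sets borel"
  and heat_kernel_prob: "0 \<le> t \<Longrightarrow> prob_space (heat_kernel t x)"
  and heat_kernel_emeasure: "0 \<le> t \<Longrightarrow> A \<in> clopen_sets \<Longrightarrow> emeasure (heat_kernel t x) A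
      = ennreal (Re (exp_op t (indicator A) x))"
  using heat_kernel_spec by (auto simp: kernel_spec_def)

lemma heat_kernel_measurable_eq: "0 \<le> t \<Longrightarrow> measurable (heat_kernel t x) N = measurable borel N"
  by (rule measurable_cong_sets) (auto simp: heat_kernel_sets)

lemma heat_kernel_measurable:
  assumes "0 \<le> t"
  shows "heat_kernel t \<in> measurable borel (subprob_algebra borel)"
proof (rule measurable_prob_algebraD, rule measurable_prob_algebra_generated)
  show "sets borel = sigma_sets UNIV clopen_sets" by (simp add: sigma_sets_clopen)
  show "(\<lambda>x. emeasure (heat_kernel t x) A) \<in> borel_measurable borel" if "A \<in> clopen_sets" for A
  proof -
    have "exp_op t (indicator A) \<in> borel_measurable borel"
      by (intro test_measurable exp_op_test test_function_indicator that)
    then have "(\<lambda>x. ennreal (Re (exp_op t (indicator A) x))) \<in> borel_measurable borel" by measurable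
    then show ?thesis by (simp add: heat_kernel_emeasure[OF assms that])
  qed
qed (auto simp: Int_stable_clopen heat_kernel_prob heat_kernel_sets assms)

text \<open>
  On clopen sets this is symmetry of the semigroup tested against the constant 1, which it fixes.
\<close>

proposition heat_kernel_invariant:
  assumes t: "0 \<le> t"
  shows "\<mu> \<bind> heat_kernel t = \<mu>"
proof (rule measure_eqI_generator_eq[OF Int_stable_clopen, where A = "\<lambda>_. UNIV" and \<Omega> = UNIV])
  have k: "heat_kernel t \<in> measurable \<mu> (subprob_algebra borel)"
    using heat_kernel_measurable[OF t] by (simp add: measurable_eq)
  have ne: "space \<mu> \<noteq> {}" by (simp add: space_eq)
  show em: "emeasure (\<mu> \<bind> heat_kernel t) A = emeasure \<mu> A" if A: "A \<in> clopen_sets" for A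
  proof -
    have ti: "indicator A \<in> test_functions" by (rule test_function_indicator[OF A])
    have "emeasure (\<mu> \<bind> heat_kernel t) A = (\<integral>\<^sup>+x. emeasure (heat_kernel t x) A \<partial>\<mu>)"
      using clopen_open[OF A] by (intro emeasure_bind[OF ne k]) auto
    also have "\<dots> = (\<integral>\<^sup>+x. ennreal (Re (exp_op t (indicator A) x)) \<partial>\<mu>)"
      by (simp add: heat_kernel_emeasure[OF t A])
    also have "\<dots> = ennreal (LINT x|\<mu>. Re (exp_op t (indicator A) x))"
      using exp_op_real_indicator(2)[OF A t]
      by (intro nn_integral_eq_integral integrable_Re test_integrable exp_op_test ti) auto
    also have "(LINT x|\<mu>. Re (exp_op t (indicator A) x)) = Re (LINT x|\<mu>. exp_op t (indicator A) x)"
      by (intro integral_Re test_integrable exp_op_test ti)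
    also have "(LINT x|\<mu>. exp_op t (indicator A) x) = L2_inner \<mu> (\<lambda>_. 1) (exp_op t (indicator A))"
      by (simp add: L2_inner_def)
    also have "\<dots> = L2_inner \<mu> (\<lambda>_. 1) (indicator A)"
      using exp_op_symmetric[OF test_function_const ti, of t 1] by (simp add: exp_op_const)
    also have "\<dots> = of_real (measure \<mu> A)"
      using clopen_open[OF A] by (simp add: L2_inner_def integral_complex_indicator sets_eq)
    finally show ?thesis by (simp add: emeasure_eq_measure)
  qed
  show "sets (\<mu> \<bind> heat_kernel t) = sigma_sets UNIV clopen_sets"
    using sets_bind[OF _ ne, of "heat_kernel t" borel] heat_kernel_sets[OF t] by (simp add: sigma_sets_clopen)
  show "emeasure (\<mu> \<bind> heat_kernel t) UNIV \<noteq> \<infinity>" for i :: nat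
    using em[OF clopen_UNIV] by (simp add: emeasure_eq_measure)
qed (auto simp: sets_eq sigma_sets_clopen clopen_UNIV)

lemma nn_integral_heat_kernel:
  assumes "0 \<le> t" "f \<in> borel_measurable borel"
  shows "(\<integral>\<^sup>+x. \<integral>\<^sup>+y. f y \<partial>heat_kernel t x \<partial>\<mu>) = (\<integral>\<^sup>+x. f x \<partial>\<mu>)"
  using nn_integral_bind[OF assms(2), of "heat_kernel t" \<mu>] heat_kernel_measurable[OF assms(1)]
      heat_kernel_invariant[OF assms(1)]
  by (simp add: measurable_eq)

section \<open>The heat semigroup on square integrable functions\<close>

definition heat :: "real \<Rightarrow> ('a \<Rightarrow> complex) \<Rightarrow> 'a \<Rightarrow> complex" where
  "heat t f x = (LINT y|heat_kernel t x. f y)"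

lemma heat_kernel_bounded_integrable:
  assumes "0 \<le> t" "f \<in> borel_measurable borel" "\<And>x. cmod (f x) \<le> B"
  shows "integrable (heat_kernel t x) f"
proof -
  interpret K: prob_space "heat_kernel t x" by (rule heat_kernel_prob[OF assms(1)])
  show ?thesis
    by (rule K.integrable_const_bound[where B = B])
      (use assms in \<open>auto simp: heat_kernel_measurable_eq\<close>)
qed

lemma heat_kernel_test_integrable: "0 \<le> t \<Longrightarrow> f \<in> test_functions \<Longrightarrow> integrable (heat_kernel t x) f"
  using heat_kernel_bounded_integrable test_measurable test_bounded by metis

lemma heat_test:
  assumes t: "0 \<le> t" and f: "f \<in> test_functions"
  shows "heat t f = exp_op t f"
  using f
proof (induction rule: test_function_induct)
  case (indicator v a)
  show ?case
  proof
    fix x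
    have A: "v \<in> clopen_sets" using disc_clopen[OF indicator] .
    have "heat t (\<lambda>y. a * indicator v y) x = a * of_real (measure (heat_kernel t x) v)"
      using disc_sets[OF indicator] heat_kernel_sets[OF t]
      by (simp add: heat_def integral_complex_indicator sets_eq)
    also have "measure (heat_kernel t x) v = Re (exp_op t (indicator v) x)"
      using heat_kernel_emeasure[OF t A] exp_op_real_indicator(2)[OF A t] by (simp add: measure_def)
    also have "a * of_real (Re (exp_op t (indicator v) x)) = exp_op t (\<lambda>y. a * indicator v y) x"
      using exp_op_real_indicator(1)[OF A t] exp_op_scale[OF test_function_indicator[OF A]] by metis
    finally show "heat t (\<lambda>y. a * indicator v y) x = exp_op t (\<lambda>y. a * indicator v y) x" .
  qed
next
  case (add f g)
  have "heat t (\<lambda>y. f y + g y) = (\<lambda>x. heat t f x + heat t g x)"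
    unfolding heat_def using heat_kernel_test_integrable[OF t add(1)] heat_kernel_test_integrable[OF t
        add(2)] by simp
  then show ?case using add exp_op_add by simp
qed

lemma heat_measurable:
  assumes "0 \<le> t" "f \<in> borel_measurable borel"
  shows "heat t f \<in> borel_measurable borel"
  unfolding heat_def
  by (rule measurable_compose[OF heat_kernel_measurable[OF assms(1)] integral_measurable_subprob_algebra[OF
      assms(2)]])

text \<open>
  Invariance of the measure bounds the integral over x of the kernel integrals of \<open>|f|\<close>.
\<close>

lemma heat_kernel_integrable_AE:
  assumes t: "0 \<le> t" and f: "f \<in> L2 \<mu>"
  shows "AE x in \<mu>. integrable (heat_kernel t x) f"
proof -
  have fm: "f \<in> borel_measurable borel" using L2_measurable[OF f] by (simp add: measurable_eq)
  have "(\<integral>\<^sup>+x. \<integral>\<^sup>+y. ennreal (cmod (f y)) \<partial>heat_kernel t x \<partial>\<mu>) = (\<integral>\<^sup>+x. ennreal (cmod (f x)) \<partial>\<mu>)"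
    using fm by (intro nn_integral_heat_kernel t) auto
  also have "\<dots> \<noteq> \<infinity>"
    using L2_integrable1[OF f] by (auto simp: integrable_iff_bounded)
  finally have fin: "(\<integral>\<^sup>+x. \<integral>\<^sup>+y. ennreal (cmod (f y)) \<partial>heat_kernel t x \<partial>\<mu>) \<noteq> \<infinity>" .
  have "(\<lambda>x. \<integral>\<^sup>+y. ennreal (cmod (f y)) \<partial>heat_kernel t x) \<in> borel_measurable \<mu>"
    unfolding measurable_eq
    by (rule measurable_compose[OF heat_kernel_measurable[OF t] nn_integral_measurable_subprob_algebra])
      (use fm in auto)
  then have "AE x in \<mu>. (\<integral>\<^sup>+y. ennreal (cmod (f y)) \<partial>heat_kernel t x) \<noteq> \<infinity>"
    using fin by (rule nn_integral_PInf_AE)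
  then show ?thesis
    by eventually_elim (use fm in \<open>auto simp: integrable_iff_bounded heat_kernel_measurable_eq[OF t] less_top\<close>)
qed

lemma heat_sq_le:
  assumes t: "0 \<le> t" and f: "f \<in> borel_measurable borel"
  shows "ennreal ((cmod (heat t f x))\<^sup>2) \<le> (\<integral>\<^sup>+y. ennreal ((cmod (f y))\<^sup>2) \<partial>heat_kernel t x)"
proof (cases "(\<integral>\<^sup>+y. ennreal ((cmod (f y))\<^sup>2) \<partial>heat_kernel t x) = \<infinity>")
  case False
  interpret K: prob_space "heat_kernel t x" by (rule heat_kernel_prob[OF t])
  have int: "integrable (heat_kernel t x) (\<lambda>y. (cmod (f y))\<^sup>2)"
    using False f by (intro integrableI_bounded) (auto simp: heat_kernel_measurable_eq[OF t] less_top)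
  then have fL: "f \<in> L2 (heat_kernel t x)" using f by (simp add: L2_def heat_kernel_measurable_eq[OF t])
  have one: "(\<lambda>_. 1) \<in> L2 (heat_kernel t x)" by (simp add: L2_def)
  have "cmod (heat t f x) \<le> L2_norm (heat_kernel t x) (\<lambda>_. 1) * L2_norm (heat_kernel t x) f"
    using L2_Cauchy_Schwarz[OF one fL] by (simp add: L2_inner_def heat_def)
  also have "L2_norm (heat_kernel t x) (\<lambda>_. 1) = 1" by (simp add: L2_norm_def K.prob_space)
  finally have "(cmod (heat t f x))\<^sup>2 \<le> (L2_norm (heat_kernel t x) f)\<^sup>2" by (intro power_mono) auto
  also have "\<dots> = (LINT y|heat_kernel t x. (cmod (f y))\<^sup>2)" by (rule L2_norm_sq)
  finally have "ennreal ((cmod (heat t f x))\<^sup>2) \<le> ennreal (LINT y|heat_kernel t x. (cmod (f y))\<^sup>2)"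
    by (rule ennreal_leI)
  also have "\<dots> = (\<integral>\<^sup>+y. ennreal ((cmod (f y))\<^sup>2) \<partial>heat_kernel t x)"
    by (rule nn_integral_eq_integral[symmetric]) (use int in auto)
  finally show ?thesis .
qed simp

text \<open>
  Cauchy-Schwarz for the probability measures \<open>heat_kernel t x\<close>, followed by invariance.
\<close>

proposition heat_contraction:
  assumes t: "0 \<le> t" and f: "f \<in> L2 \<mu>"
  shows "heat t f \<in> L2 \<mu>" "L2_norm \<mu> (heat t f) \<le> L2_norm \<mu> f"
proof -
  have fm: "f \<in> borel_measurable borel" using L2_measurable[OF f] by (simp add: measurable_eq)
  have "(\<integral>\<^sup>+x. ennreal ((cmod (heat t f x))\<^sup>2) \<partial>\<mu>) \<le> (\<integral>\<^sup>+x. \<integral>\<^sup>+y. ennreal ((cmod (f y))\<^sup>2) \<partial>heat_kernel t x \<partial>\<mu>)"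
    by (intro nn_integral_mono heat_sq_le t fm)
  also have "\<dots> = (\<integral>\<^sup>+x. ennreal ((cmod (f x))\<^sup>2) \<partial>\<mu>)"
    using fm by (intro nn_integral_heat_kernel t) auto
  also have "\<dots> = ennreal ((L2_norm \<mu> f)\<^sup>2)" by (rule nn_integral_L2[OF f])
  finally have le: "(\<integral>\<^sup>+x. ennreal ((cmod (heat t f x))\<^sup>2) \<partial>\<mu>) \<le> ennreal ((L2_norm \<mu> f)\<^sup>2)" .
  have "integrable \<mu> (\<lambda>x. (cmod (heat t f x))\<^sup>2)"
    using heat_measurable[OF t fm] le
    by (intro integrableI_bounded) (auto simp: measurable_eq intro: le_less_trans)
  then show L: "heat t f \<in> L2 \<mu>" using heat_measurable[OF t fm] by (simp add: L2_def measurable_eq)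
  show "L2_norm \<mu> (heat t f) \<le> L2_norm \<mu> f"
  proof (rule power2_le_imp_le)
    show "(L2_norm \<mu> (heat t f))\<^sup>2 \<le> (L2_norm \<mu> f)\<^sup>2"
      using le unfolding nn_integral_L2[OF L] by (simp only: ennreal_le_iff zero_le_power2)
  qed simp
qed

lemma heat_lincomb:
  assumes t: "0 \<le> t" and "f \<in> L2 \<mu>" "g \<in> L2 \<mu>"
  shows "AE x in \<mu>. heat t (\<lambda>y. a * f y + b * g y) x = a * heat t f x + b * heat t g x"
  using heat_kernel_integrable_AE[OF t assms(2)] heat_kernel_integrable_AE[OF t assms(3)]
  by eventually_elim (simp add: heat_def)

lemma heat_bounded_op:
  assumes "0 \<le> t"
  shows "L2_bounded_op (heat t)"
  unfolding L2_bounded_op_def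
proof (intro conjI ballI)
  show "heat t f \<in> L2 \<mu>" if "f \<in> L2 \<mu>" for f by (rule heat_contraction[OF assms that])
  show "AE x in \<mu>. heat t (\<lambda>y. f y - g y) x = heat t f x - heat t g x"
    if "f \<in> L2 \<mu>" "g \<in> L2 \<mu>" for f g
    using heat_lincomb[OF assms that, of 1 "-1"] by simp
  show "\<exists>K. \<forall>f\<in>L2 \<mu>. L2_norm \<mu> (heat t f) \<le> K * L2_norm \<mu> f"
    using heat_contraction(2)[OF assms] by (intro exI[of _ 1]) simp
qed

lemma heat_diff_contraction:
  assumes t: "0 \<le> t" and "f \<in> L2 \<mu>" "g \<in> L2 \<mu>"
  shows "L2_norm \<mu> (\<lambda>x. heat t f x - heat t g x) \<le> L2_norm \<mu> (\<lambda>x. f x - g x)"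
proof -
  have "AE x in \<mu>. heat t f x - heat t g x = heat t (\<lambda>y. f y - g y) x"
    using heat_lincomb[OF assms, of 1 "-1"] by eventually_elim simp
  then have "L2_norm \<mu> (\<lambda>x. heat t f x - heat t g x) = L2_norm \<mu> (heat t (\<lambda>y. f y - g y))"
    by (rule L2_norm_cong_AE)
      (intro borel_measurable_diff L2_measurable heat_contraction(1) L2_diff assms)+
  also have "\<dots> \<le> L2_norm \<mu> (\<lambda>x. f x - g x)"
    by (intro heat_contraction(2) L2_diff assms)
  finally show ?thesis .
qed

lemma heat_0: "f \<in> L2 \<mu> \<Longrightarrow> AE x in \<mu>. heat 0 f x = f x"
  by (rule L2_bounded_op_eq[OF heat_bounded_op L2_bounded_op_id]) (simp_all add: heat_test exp_op_0)

lemma heat_semigroup: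
  assumes "0 \<le> t" "0 \<le> t'" "f \<in> L2 \<mu>"
  shows "AE x in \<mu>. heat (t + t') f x = heat t (heat t' f) x"
  by (rule L2_bounded_op_eq[OF heat_bounded_op L2_bounded_op_comp[OF heat_bounded_op heat_bounded_op]])
    (use assms in \<open>simp_all add: heat_test exp_op_test exp_op_semigroup\<close>)

lemma heat_symmetric:
  assumes t: "0 \<le> t" and f: "f \<in> L2 \<mu>" and u: "u \<in> test_functions"
  shows "L2_inner \<mu> (heat t f) u = L2_inner \<mu> f (exp_op t u)"
proof -
  obtain F where F: "\<And>n. F n \<in> test_functions" "(\<lambda>n. L2_norm \<mu> (\<lambda>x. F n x - f x)) \<longlonglongrightarrow> 0"
    using test_functions_dense_seq[OF f] by blast
  have const: "(\<lambda>n::nat. L2_norm \<mu> (\<lambda>x. h x - h x)) \<longlonglongrightarrow> 0" for h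
    by (simp add: L2_norm_def)
  have "(\<lambda>n. L2_norm \<mu> (\<lambda>x. heat t (F n) x - heat t f x)) \<longlonglongrightarrow> 0"
  proof (rule Lim_null_comparison[OF _ F(2)], rule always_eventually, rule allI)
    fix n
    show "norm (L2_norm \<mu> (\<lambda>x. heat t (F n) x - heat t f x)) \<le> L2_norm \<mu> (\<lambda>x. F n x - f x)"
      using heat_diff_contraction[OF t test_L2[OF F(1)] f] by simp
  qed
  then have "(\<lambda>n. L2_inner \<mu> (heat t (F n)) u) \<longlonglongrightarrow> L2_inner \<mu> (heat t f) u"
    by (intro L2_inner_tendsto[OF _ _ _ _ _ const] heat_contraction(1) t test_L2 F f u)
  moreover have "(\<lambda>n. L2_inner \<mu> (F n) (exp_op t u)) \<longlonglongrightarrow> L2_inner \<mu> f (exp_op t u)"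
    by (intro L2_inner_tendsto[OF _ _ _ _ _ const] test_L2 F f u exp_op_test)
  moreover have "L2_inner \<mu> (heat t (F n)) u = L2_inner \<mu> (F n) (exp_op t u)" for n
    using heat_test[OF t F(1)] exp_op_symmetric[OF F(1) u] by simp
  ultimately show ?thesis using LIMSEQ_unique by simp
qed

text \<open>
  A continuous function is a uniform limit of test functions, and the kernels are probability
  measures.
\<close>

proposition heat_continuous:
  assumes t: "0 \<le> t" and f: "continuous_on UNIV f"
  shows "continuous_on UNIV (heat t f)" "\<And>x. integrable (heat_kernel t x) f"
proof -
  have fm: "f \<in> borel_measurable borel" by (rule borel_measurable_continuous_onI[OF f])
  have "bounded (range f)"
    using compact_continuous_image[OF f compact_space] by (rule compact_imp_bounded)
  then obtain B where "\<And>x. cmod (f x) \<le> B" by (auto simp: bounded_iff)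
  then show int: "integrable (heat_kernel t x) f" for x by (rule heat_kernel_bounded_integrable[OF t fm])
  have uc: "uniformly_continuous_on UNIV f"
    by (rule compact_uniformly_continuous[OF f compact_space])
  have approx: "\<exists>u\<in>test_functions. \<forall>x. cmod (f x - u x) \<le> e" if e: "0 < e" for e
  proof -
    obtain d where d: "0 < d" "\<forall>x\<in>UNIV. \<forall>y\<in>UNIV. dist y x < d \<longrightarrow> dist (f y) (f x) < e"
      using uc[unfolded uniformly_continuous_on_def] e by blast
    have d2: "0 < d / 2" using d(1) by simp
    have "const_at_scale (d/2) (\<lambda>x. f (center (d/2) x))"
      unfolding const_at_scale_def using center_cong by metis
    then have "(\<lambda>x. f (center (d/2) x)) \<in> test_functions" using d2 test_function_iff by blast
    moreover have "cmod (f x - f (center (d/2) x)) \<le> e" for x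
    proof -
      have "dist x (center (d/2) x) < d" using dist_center[of "d/2" x] d(1) by linarith
      then have "dist (f x) (f (center (d/2) x)) < e" using d(2) by blast
      then show ?thesis by (simp add: dist_norm)
    qed
    ultimately show ?thesis by (intro bexI[of _ "\<lambda>x. f (center (d/2) x)"]) auto
  qed
  have "\<exists>F. \<forall>n. F n \<in> test_functions \<and> (\<forall>x. cmod (f x - F n x) \<le> 1 / real (Suc n))"
    using approx by (intro choice allI) (metis of_nat_0_less_iff zero_less_Suc zero_less_divide_1_iff)
  then obtain F where F: "\<And>n. F n \<in> test_functions" "\<And>n x. cmod (f x - F n x) \<le> 1 / real (Suc n)"
    by blast
  have close: "cmod (heat t f x - exp_op t (F n) x) \<le> 1 / real (Suc n)" for n x
  proof -
    interpret K: prob_space "heat_kernel t x" by (rule heat_kernel_prob[OF t])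
    note i = int[of x] heat_kernel_test_integrable[OF t F(1), of x n]
    have "heat t f x - exp_op t (F n) x = (LINT y|heat_kernel t x. f y - F n y)"
      unfolding heat_test[OF t F(1), symmetric] heat_def using i by simp
    also have "cmod \<dots> \<le> (LINT y|heat_kernel t x. cmod (f y - F n y))" by (rule integral_norm_bound)
    also have "\<dots> \<le> (LINT y|heat_kernel t x. 1 / real (Suc n))"
      using i F(2) by (intro integral_mono integrable_norm Bochner_Integration.integrable_diff) auto
    finally show ?thesis using K.prob_space by simp
  qed
  show "continuous_on UNIV (heat t f)"
  proof (rule uniform_limit_theorem)
    show "\<forall>\<^sub>F n in sequentially. continuous_on UNIV (exp_op t (F n))"
      using exp_op_test[OF F(1)] const_at_scale_continuous test_functionE by (metis always_eventually)
    show "uniform_limit UNIV (\<lambda>n. exp_op t (F n)) (heat t f) sequentially"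
    proof (rule uniform_limitI)
      fix e :: real assume "0 < e"
      then have "\<forall>\<^sub>F n in sequentially. 1 / real (Suc n) < e"
        by (intro order_tendstoD(2)[OF LIMSEQ_Suc[OF lim_1_over_n]])
      then show "\<forall>\<^sub>F n in sequentially. \<forall>x\<in>UNIV. dist (exp_op t (F n) x) (heat t f x) < e"
        by eventually_elim (use close in \<open>auto simp: dist_norm norm_minus_commute intro: le_less_trans\<close>)
    qed
  qed simp
qed

lemma continuous_AE_eq:
  fixes f g :: "'a \<Rightarrow> complex"
  assumes "continuous_on UNIV f" "continuous_on UNIV g" "AE x in \<mu>. f x = g x"
  shows "f = g"
proof -
  have "open {x. f x \<noteq> g x}" by (rule open_Collect_neq[OF assms(1,2)])
  moreover have "measure \<mu> {x. f x \<noteq> g x} = 0"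
  proof -
    have "emeasure \<mu> {x. f x \<noteq> g x} = 0"
      using assms(3) calculation AE_iff_measurable[of "{x. f x \<noteq> g x}" \<mu> "\<lambda>x. f x = g x"]
      by (simp add: space_eq sets_eq)
    then show ?thesis by (simp add: measure_def)
  qed
  ultimately have "{x. f x \<noteq> g x} = {}" using open_measure_pos by force
  then show ?thesis by auto
qed

section \<open>The generator\<close>

lemma L2_norm_smult_limit:
  fixes c :: "real \<Rightarrow> complex"
  assumes "(c \<longlongrightarrow> 0) F"
  shows "((\<lambda>t. L2_norm \<mu> (\<lambda>x. c t * f x)) \<longlongrightarrow> 0) F"
  unfolding L2_norm_scale using tendsto_mult_left_zero[OF tendsto_norm_zero[OF assms]] .

lemma exp_difference_quotient:
  "((\<lambda>t::real. (complex_of_real (exp (- t * l)) - 1) / of_real t + of_real l) \<longlongrightarrow> 0) (at_right 0)"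
proof -
  have "((\<lambda>t::real. exp (- t * l)) has_field_derivative - l) (at 0)"
    by (auto intro!: derivative_eq_intros)
  then have "((\<lambda>t. (exp (- t * l) - 1) / t) \<longlongrightarrow> - l) (at 0)"
    by (simp add: has_field_derivative_def field_has_derivative_at DERIV_def)
  then have "((\<lambda>t. (exp (- t * l) - 1) / t) \<longlongrightarrow> - l) (at_right 0)"
    by (rule tendsto_mono[rotated]) (simp add: at_le)
  then have "((\<lambda>t. complex_of_real ((exp (- t * l) - 1) / t + l)) \<longlongrightarrow> of_real (- l + l)) (at_right 0)"
    by (intro tendsto_intros)
  then show ?thesis by simp
qed

lemma L2_norm_add_limit:
  assumes "\<And>t. P t \<in> L2 \<mu>" "\<And>t. Q t \<in> L2 \<mu>"
    and "((\<lambda>t. L2_norm \<mu> (P t)) \<longlongrightarrow> 0) F" "((\<lambda>t. L2_norm \<mu> (Q t)) \<longlongrightarrow> 0) F"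
  shows "((\<lambda>t. L2_norm \<mu> (\<lambda>x. P t x + Q t x)) \<longlongrightarrow> 0) F"
proof (rule Lim_null_comparison)
  show "\<forall>\<^sub>F t in F. norm (L2_norm \<mu> (\<lambda>x. P t x + Q t x)) \<le> L2_norm \<mu> (P t) + L2_norm \<mu> (Q t)"
    using L2_norm_triangle[OF assms(1,2)] by (auto intro!: always_eventually)
  show "((\<lambda>t. L2_norm \<mu> (P t) + L2_norm \<mu> (Q t)) \<longlongrightarrow> 0) F"
    using tendsto_add[OF assms(3,4)] by simp
qed

lemma quotient_L2:
  assumes "u \<in> L2 \<mu>" "v \<in> L2 \<mu>" "w \<in> L2 \<mu>"
  shows "(\<lambda>x. (u x - v x) / of_real t + w x) \<in> L2 \<mu>" "(\<lambda>x. (u x - v x) / of_real t) \<in> L2 \<mu>"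
proof -
  have "(\<lambda>x. (1 / of_real t) * (u x - v x)) \<in> L2 \<mu>" by (intro L2_scale L2_diff assms)
  then show "(\<lambda>x. (u x - v x) / of_real t) \<in> L2 \<mu>" by simp
  then show "(\<lambda>x. (u x - v x) / of_real t + w x) \<in> L2 \<mu>" by (rule L2_add[OF _ assms(3)])
qed

proposition exp_op_derivative:
  assumes "u \<in> test_functions"
  shows "((\<lambda>t. L2_norm \<mu> (\<lambda>x. (exp_op t u x - u x) / of_real t + jump_op u x)) \<longlongrightarrow> 0) (at_right 0)"
  using assms
proof (induction rule: eigenfunction_induct)
  case (eigenfunction l \<phi>)
  have "(\<lambda>x. (exp_op t \<phi> x - \<phi> x) / of_real t + jump_op \<phi> x) =
      (\<lambda>x. ((complex_of_real (exp (- t * l)) - 1) / of_real t + of_real l) * \<phi> x)" for t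
    unfolding exp_op_eigenfunction[OF eigenfunction] using eigenfunction
        by (auto simp: eigenfunction_def fun_eq_iff divide_simps algebra_simps)
  then show ?case using L2_norm_smult_limit[OF exp_difference_quotient] by simp
next
  case (add f g)
  have "((\<lambda>t. L2_norm \<mu> (\<lambda>x. ((exp_op t f x - f x) / of_real t + jump_op f x)
      + ((exp_op t g x - g x) / of_real t + jump_op g x)))
      \<longlongrightarrow> 0) (at_right 0)"
    by (intro L2_norm_add_limit quotient_L2(1) test_L2 exp_op_test jump_op_test add)
  moreover have "(\<lambda>x. (exp_op t (\<lambda>y. f y + g y) x - (f x + g x)) / of_real t + jump_op (\<lambda>y. f y + g y) x) =
      (\<lambda>x. ((exp_op t f x - f x) / of_real t + jump_op f x) + ((exp_op t g x - g x) / of_real t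
          + jump_op g x))" for t
    unfolding exp_op_add[OF add(1,2)] jump_op_add[OF add(1,2)]
    by (auto simp: fun_eq_iff diff_divide_distrib add_divide_distrib)
  ultimately show ?case by simp
qed

lemma exp_op_continuous_0:
  assumes "u \<in> test_functions"
  shows "((\<lambda>t. L2_norm \<mu> (\<lambda>x. exp_op t u x - u x)) \<longlongrightarrow> 0) (at_right 0)"
  using assms
proof (induction rule: eigenfunction_induct)
  case (eigenfunction l \<phi>)
  have "((\<lambda>t::real. complex_of_real (exp (- t * l) - 1)) \<longlongrightarrow> of_real (exp (- 0 * l) - 1)) (at_right 0)"
    by (intro tendsto_intros)
  then have "((\<lambda>t. L2_norm \<mu> (\<lambda>x. complex_of_real (exp (- t * l) - 1) * \<phi> x)) \<longlongrightarrow> 0) (at_right 0)"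
    by (intro L2_norm_smult_limit) simp
  then show ?case unfolding exp_op_eigenfunction[OF eigenfunction] by (simp add: left_diff_distrib)
next
  case (add f g)
  have "((\<lambda>t. L2_norm \<mu> (\<lambda>x. (exp_op t f x - f x) + (exp_op t g x - g x))) \<longlongrightarrow> 0) (at_right 0)"
    by (intro L2_norm_add_limit L2_diff test_L2 exp_op_test add)
  then show ?case unfolding exp_op_add[OF add(1,2)] by (simp add: add_diff_add)
qed

lemma exp_op_contraction:
  assumes "0 \<le> t" "u \<in> test_functions"
  shows "L2_norm \<mu> (exp_op t u) \<le> L2_norm \<mu> u"
  using heat_contraction(2)[OF assms(1) test_L2[OF assms(2)]] heat_test[OF assms] by simp

lemma exp_op_telescope:
  assumes h: "0 \<le> h" and u: "u \<in> test_functions"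
  shows "L2_norm \<mu> (\<lambda>x. exp_op (real n * h) u x - u x) \<le> real n * L2_norm \<mu> (\<lambda>x. exp_op h u x - u x)"
proof (induction n)
  case 0
  then show ?case using exp_op_0[OF u] by (simp add: L2_norm_def)
next
  case (Suc n)
  let ?v = "exp_op (real n * h) u"
  have v: "?v \<in> test_functions" by (rule exp_op_test[OF u])
  have "exp_op (real (Suc n) * h) u = exp_op h ?v"
    using exp_op_semigroup[OF u, of h "real n * h"] by (simp add: distrib_right)
  then have "L2_norm \<mu> (\<lambda>x. exp_op (real (Suc n) * h) u x - u x) \<le>
      L2_norm \<mu> (\<lambda>x. exp_op h ?v x - exp_op h u x) + L2_norm \<mu> (\<lambda>x. exp_op h u x - u x)"
    using L2_norm_triangle_diff[OF test_L2[OF exp_op_test[OF v]] test_L2[OF exp_op_test[OF u]] test_L2[OF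
        u]] by simp
  also have "L2_norm \<mu> (\<lambda>x. exp_op h ?v x - exp_op h u x) \<le> L2_norm \<mu> (\<lambda>x. ?v x - u x)"
    using exp_op_contraction[OF h test_diff[OF v u]] unfolding exp_op_diff[OF v u] .
  finally show ?case using Suc by (simp add: distrib_right)
qed

text \<open>
  By contractivity the distance travelled in time t is at most n times the distance travelled in
  time \<open>t / n\<close>, which is asymptotically governed by the derivative at zero.
\<close>

proposition exp_op_drift_bound:
  assumes t: "0 < t" and u: "u \<in> test_functions"
  shows "L2_norm \<mu> (\<lambda>x. exp_op t u x - u x) \<le> t * L2_norm \<mu> (jump_op u)"
proof -
  let ?q = "\<lambda>h. L2_norm \<mu> (\<lambda>x. (exp_op h u x - u x) / of_real h + jump_op u x)"
  let ?h = "\<lambda>n. t / real (Suc n)"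
  have "filterlim ?h (at_right 0) sequentially"
    unfolding filterlim_at
  proof
    show "\<forall>\<^sub>F n in sequentially. ?h n \<in> {0<..} \<and> ?h n \<noteq> 0"
      using t by (intro always_eventually allI) simp
    show "?h \<longlonglongrightarrow> 0"
      using tendsto_mult_right_zero[OF LIMSEQ_Suc[OF lim_1_over_n], of t] by simp
  qed
  then have "(\<lambda>n. ?q (?h n)) \<longlonglongrightarrow> 0" by (rule filterlim_compose[OF exp_op_derivative[OF u]])
  then have "(\<lambda>n. t * (?q (?h n) + L2_norm \<mu> (jump_op u))) \<longlonglongrightarrow> t * (0 + L2_norm \<mu> (jump_op u))"
    by (intro tendsto_intros)
  moreover have "L2_norm \<mu> (\<lambda>x. exp_op t u x - u x) \<le> t * (?q (?h n) + L2_norm \<mu> (jump_op u))" for n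
  proof -
    have h: "0 < ?h n" using t by simp
    have "L2_norm \<mu> (\<lambda>x. exp_op t u x - u x) \<le> real (Suc n) * L2_norm \<mu> (\<lambda>x. exp_op (?h n) u x - u x)"
      using exp_op_telescope[OF less_imp_le[OF h] u, of "Suc n"] by simp
    also have "(\<lambda>x. exp_op (?h n) u x - u x) = (\<lambda>x. of_real (?h n) * (((exp_op (?h n) u x - u x) / of_real
        (?h n) + jump_op u x) - jump_op u x))"
    proof -
      have "z = of_real q * ((z / of_real q + w) - w)" if "0 < q" for q :: real and z w :: complex
        using that by simp
      from this[OF h] show ?thesis by blast
    qed
    also have "real (Suc n) * L2_norm \<mu> \<dots> = t * L2_norm \<mu> (\<lambda>x. ((exp_op (?h n) u x - u x) / of_real (?h n)
        + jump_op u x) + - jump_op u x)"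
    proof -
      have "real (Suc n) * (cmod (of_real (?h n)) * z) = t * z" for z
        unfolding norm_of_real using t by simp
      then show ?thesis unfolding L2_norm_scale by (simp only: diff_conv_add_uminus)
    qed
    also have "\<dots> \<le> t * (?q (?h n) + L2_norm \<mu> (\<lambda>x. - jump_op u x))"
      using t by (intro mult_left_mono L2_norm_triangle quotient_L2(1) L2_uminus test_L2 jump_op_test
          exp_op_test u) auto
    finally show ?thesis by (simp add: L2_norm_uminus)
  qed
  ultimately show ?thesis using LIMSEQ_le_const[of _ _ "L2_norm \<mu> (\<lambda>x. exp_op t u x - u x)"] by auto
qed

text \<open>
  The orthogonal projection of L2 onto the functions constant at scale r.
\<close>

definition avg :: "real \<Rightarrow> ('a \<Rightarrow> complex) \<Rightarrow> 'a \<Rightarrow> complex" where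
  "avg r f x = L2_inner \<mu> (indicator (cball x r)) f / of_real (measure \<mu> (cball x r))"

lemma avg_const_at_scale: "const_at_scale r (avg r f)"
  unfolding const_at_scale_def avg_def using cball_eq_of_dist_le by metis

lemma avg_test: "0 < r \<Longrightarrow> avg r f \<in> test_functions"
  using avg_const_at_scale test_function_iff by blast

lemma avg_inner:
  assumes r: "0 < r" and f: "f \<in> L2 \<mu>" and u: "const_at_scale r u"
  shows "L2_inner \<mu> u (avg r f) = L2_inner \<mu> u f"
  using u r
proof (induction rule: const_at_scale_induct)
  case (indicator x a)
  have "L2_inner \<mu> (indicator (cball x r)) (avg r f) = (LINT y|\<mu>. avg r f x * indicator (cball x r) y)"
    unfolding L2_inner_def
    by (rule Bochner_Integration.integral_cong)
      (auto simp: indicator_def const_at_scaleD[OF avg_const_at_scale, symmetric])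
  also have "\<dots> = avg r f x * of_real (measure \<mu> (cball x r))"
    by (simp add: integral_complex_indicator sets_eq)
  also have "\<dots> = L2_inner \<mu> (indicator (cball x r)) f"
    using cball_measure_pos[OF r, of x] by (simp add: avg_def)
  finally show ?case unfolding L2_inner_scale_left by simp
next
  case (add g h)
  have "g \<in> L2 \<mu>" "h \<in> L2 \<mu>" using add r test_function_iff test_L2 by blast+
  then show ?case using add test_L2[OF avg_test[OF r]] f by (simp add: L2_inner_add_left)
qed

lemma avg_best_approximation:
  assumes r: "0 < r" and f: "f \<in> L2 \<mu>" and u: "const_at_scale r u"
  shows "L2_norm \<mu> (\<lambda>x. f x - avg r f x) \<le> L2_norm \<mu> (\<lambda>x. f x - u x)"
proof -
  let ?p = "avg r f"
  have L: "?p \<in> L2 \<mu>" "u \<in> L2 \<mu>"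
    using test_L2[OF avg_test[OF r]] u r test_function_iff test_L2 by blast+
  note fp = L2_diff[OF f L(1)]
  have c: "const_at_scale r (\<lambda>x. u x - ?p x)"
    using const_at_scale_comp(2)[OF u avg_const_at_scale] .
  have "L2_inner \<mu> (\<lambda>x. u x - ?p x) (\<lambda>x. f x - ?p x) = 0"
    using avg_inner[OF r f c] by (simp add: L2_inner_diff_right L2_diff f L)
  moreover have "L2_inner \<mu> (\<lambda>x. (f x - u x) + (u x - ?p x)) (\<lambda>x. f x - ?p x) =
      L2_inner \<mu> (\<lambda>x. f x - u x) (\<lambda>x. f x - ?p x) + L2_inner \<mu> (\<lambda>x. u x - ?p x) (\<lambda>x. f x - ?p x)"
    by (intro L2_inner_add_left L2_diff f L)
  ultimately have "L2_inner \<mu> (\<lambda>x. f x - u x) (\<lambda>x. f x - ?p x) = of_real ((L2_norm \<mu> (\<lambda>x. f x - ?p x))\<^sup>2)"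
    using L2_inner_self[of \<mu> "\<lambda>x. f x - ?p x"] by simp
  then have "(L2_norm \<mu> (\<lambda>x. f x - ?p x))\<^sup>2 \<le> L2_norm \<mu> (\<lambda>x. f x - u x) * L2_norm \<mu> (\<lambda>x. f x - ?p x)"
    using L2_Cauchy_Schwarz[OF L2_diff[OF f L(2)] fp] by (simp add: norm_power)
  then show ?thesis
    using L2_norm_nonneg[of \<mu> "\<lambda>x. f x - ?p x"] L2_norm_nonneg[of \<mu> "\<lambda>x. f x - u x"]
    by (metis less_eq_real_def mult_le_cancel_right not_le power2_eq_square)
qed

text \<open>
  The projections converge strongly because every test function is fixed by all projections of small
  scale.
\<close>

lemma avg_tendsto:
  assumes f: "f \<in> L2 \<mu>"
  shows "(\<lambda>n. L2_norm \<mu> (\<lambda>x. avg (1 / real (Suc n)) f x - f x)) \<longlonglongrightarrow> 0"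
proof (rule order_tendstoI)
  fix e :: real assume "0 < e"
  then obtain u where u: "u \<in> test_functions" "L2_norm \<mu> (\<lambda>x. f x - u x) < e"
    using test_functions_dense[OF f] by blast
  obtain r where r: "0 < r" "const_at_scale r u" using test_functionE[OF u(1)] .
  have "\<forall>\<^sub>F n in sequentially. 1 / real (Suc n) < r"
    by (rule order_tendstoD(2)[OF LIMSEQ_Suc[OF lim_1_over_n] r(1)])
  then show "\<forall>\<^sub>F n in sequentially. L2_norm \<mu> (\<lambda>x. avg (1 / real (Suc n)) f x - f x) < e"
  proof eventually_elim
    case (elim n)
    have "const_at_scale (1 / real (Suc n)) u" using const_at_scale_mono[OF r(2)] elim by simp
    then have "L2_norm \<mu> (\<lambda>x. f x - avg (1 / real (Suc n)) f x) \<le> L2_norm \<mu> (\<lambda>x. f x - u x)"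
      by (intro avg_best_approximation f) simp
    then show ?case using u(2) by (simp add: L2_norm_minus_commute[of \<mu> _ f])
  qed
next
  fix a :: real assume "a < 0"
  then show "\<forall>\<^sub>F n in sequentially. a < L2_norm \<mu> (\<lambda>x. avg (1 / real (Suc n)) f x - f x)"
    by (intro always_eventually allI less_le_trans[OF _ L2_norm_nonneg])
qed

lemma vp_iff:
  "(f, g) \<in> vladimirov_pearson \<mu> s \<longleftrightarrow> f \<in> L2 \<mu> \<and> g \<in> L2 \<mu> \<and>
    (\<exists>F. (\<forall>n. F n \<in> test_functions) \<and> (\<lambda>n. L2_norm \<mu> (\<lambda>x. F n x - f x)) \<longlonglongrightarrow> 0 \<and>
      (\<lambda>n. L2_norm \<mu> (\<lambda>x. jump_op (F n) x - g x)) \<longlonglongrightarrow> 0)"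
proof -
  have "(\<exists>F G. (\<forall>n. (F n, G n) \<in> vp_initial \<mu> s \<and> F n \<in> L2 \<mu> \<and> G n \<in> L2 \<mu>) \<and>
       (\<lambda>n. L2_norm \<mu> (\<lambda>x. F n x - f x)) \<longlonglongrightarrow> 0 \<and> (\<lambda>n. L2_norm \<mu> (\<lambda>x. G n x - g x)) \<longlonglongrightarrow> 0) \<longleftrightarrow>
    (\<exists>F. (\<forall>n. F n \<in> test_functions) \<and> (\<lambda>n. L2_norm \<mu> (\<lambda>x. F n x - f x)) \<longlonglongrightarrow> 0 \<and>
      (\<lambda>n. L2_norm \<mu> (\<lambda>x. jump_op (F n) x - g x)) \<longlonglongrightarrow> 0)" (is "?A = ?B")
  proof
    assume ?A
    then obtain F G where FG: "\<And>n. (F n, G n) \<in> vp_initial \<mu> s"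
       "(\<lambda>n. L2_norm \<mu> (\<lambda>x. F n x - f x)) \<longlonglongrightarrow> 0" "(\<lambda>n. L2_norm \<mu> (\<lambda>x. G n x - g x)) \<longlonglongrightarrow> 0"
      by blast
    have "F n \<in> test_functions" "G n = jump_op (F n)" for n using FG(1)[of n] by (auto simp: vp_initial_eq)
    then show ?B using FG by auto
  next
    assume ?B
    then obtain F where F: "\<And>n. F n \<in> test_functions" "(\<lambda>n. L2_norm \<mu> (\<lambda>x. F n x - f x)) \<longlonglongrightarrow> 0"
      "(\<lambda>n. L2_norm \<mu> (\<lambda>x. jump_op (F n) x - g x)) \<longlonglongrightarrow> 0" by blast
    then show ?A
      by (intro exI[of _ F] exI[of _ "\<lambda>n. jump_op (F n)"])
        (auto simp: vp_initial_eq intro: test_L2 jump_op_test)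
  qed
  then show ?thesis unfolding vladimirov_pearson_def operator_closure_def by simp
qed

text \<open>
  The bound on the drift of test functions, applied to \<open>F n - u\<close> and passed to the limit. It controls
  the difference quotients of f by those of a test function u, uniformly in t.
\<close>

lemma heat_drift_bound:
  assumes vp: "(f, \<lambda>x. - g x) \<in> vladimirov_pearson \<mu> s" and u: "u \<in> test_functions" and t: "0 < t"
  shows "L2_norm \<mu> (\<lambda>x. (heat t f x - f x) - (exp_op t u x - u x)) \<le> t * L2_norm \<mu> (\<lambda>x. jump_op u x + g x)"
proof -
  obtain F where f: "f \<in> L2 \<mu>" and ng: "(\<lambda>x. - g x) \<in> L2 \<mu>" and F: "\<And>n. F n \<in> test_functions"
    and Ff: "(\<lambda>n. L2_norm \<mu> (\<lambda>x. F n x - f x)) \<longlonglongrightarrow> 0"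
    and Fg: "(\<lambda>n. L2_norm \<mu> (\<lambda>x. jump_op (F n) x - (- g x))) \<longlonglongrightarrow> 0"
    using vp unfolding vp_iff by blast
  have g: "g \<in> L2 \<mu>" using L2_uminus[OF ng] by simp
  have t': "0 \<le> t" using t by simp
  let ?a = "\<lambda>n. L2_norm \<mu> (\<lambda>x. F n x - f x)"
  let ?b = "\<lambda>n. L2_norm \<mu> (\<lambda>x. jump_op (F n) x - (- g x))"
  have "L2_norm \<mu> (\<lambda>x. (heat t f x - f x) - (exp_op t u x - u x)) \<le>
      2 * ?a n + t * (?b n + L2_norm \<mu> (\<lambda>x. jump_op u x + g x))" for n
  proof -
    let ?w = "\<lambda>x. F n x - u x"
    have w: "?w \<in> test_functions" by (rule test_diff[OF F u])
    note L = test_L2[OF F] test_L2[OF u] test_L2[OF exp_op_test[OF F]] test_L2[OF exp_op_test[OF u]]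
      heat_contraction(1)[OF t' f] test_L2[OF w] test_L2[OF exp_op_test[OF w]]
    have "L2_norm \<mu> (\<lambda>x. (heat t f x - f x) - (exp_op t u x - u x)) \<le>
        L2_norm \<mu> (\<lambda>x. (heat t f x - f x) - (exp_op t (F n) x - F n x)) +
        L2_norm \<mu> (\<lambda>x. (exp_op t (F n) x - F n x) - (exp_op t u x - u x))"
      by (intro L2_norm_triangle_diff L2_diff L f)
    also have "L2_norm \<mu> (\<lambda>x. (heat t f x - f x) - (exp_op t (F n) x - F n x)) =
        L2_norm \<mu> (\<lambda>x. (heat t f x - exp_op t (F n) x) + (F n x - f x))"
      by (simp add: algebra_simps)
    also have "\<dots> \<le> L2_norm \<mu> (\<lambda>x. heat t f x - exp_op t (F n) x) + ?a n"
      by (intro L2_norm_triangle L2_diff L f)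
    also have "L2_norm \<mu> (\<lambda>x. heat t f x - exp_op t (F n) x) \<le> ?a n"
      using heat_diff_contraction[OF t' f test_L2[OF F[of n]]]
      by (simp add: heat_test[OF t' F] L2_norm_minus_commute[of \<mu> f])
    also have "L2_norm \<mu> (\<lambda>x. (exp_op t (F n) x - F n x) - (exp_op t u x - u x))
        = L2_norm \<mu> (\<lambda>x. exp_op t ?w x - ?w x)"
      unfolding exp_op_diff[OF F u] by (simp add: algebra_simps)
    also have "\<dots> \<le> t * L2_norm \<mu> (jump_op ?w)" by (rule exp_op_drift_bound[OF t w])
    also have "L2_norm \<mu> (jump_op ?w) = L2_norm \<mu> (\<lambda>x. (jump_op (F n) x - (- g x)) - (jump_op u x + g x))"
      unfolding jump_op_diff[OF F u] by simp
    also have "\<dots> = L2_norm \<mu> (\<lambda>x. (jump_op (F n) x - (- g x)) + - (jump_op u x + g x))" by simp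
    also have "t * \<dots> \<le> t * (?b n + L2_norm \<mu> (\<lambda>x. - (jump_op u x + g x)))"
      by (intro mult_left_mono L2_norm_triangle L2_diff L2_uminus L2_add ng g test_L2 jump_op_test F u t')
    finally show ?thesis unfolding L2_norm_uminus by simp
  qed
  moreover have "(\<lambda>n. 2 * ?a n + t * (?b n + L2_norm \<mu> (\<lambda>x. jump_op u x + g x))) \<longlonglongrightarrow>
      2 * 0 + t * (0 + L2_norm \<mu> (\<lambda>x. jump_op u x + g x))"
    by (intro tendsto_intros Ff Fg)
  ultimately show ?thesis
    using LIMSEQ_le_const[of _ _ "L2_norm \<mu> (\<lambda>x. (heat t f x - f x) - (exp_op t u x - u x))"] by auto
qed

lemma L2_bounded_tendsto0I:
  assumes "\<And>e. 0 < e \<Longrightarrow> \<forall>\<^sub>F t in F. L2_norm \<mu> (P t) < e"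
  shows "((\<lambda>t. L2_norm \<mu> (P t)) \<longlongrightarrow> 0) F"
  by (rule order_tendstoI) (auto intro: assms always_eventually less_le_trans[OF _ L2_norm_nonneg])

text \<open>
  For f in the closure, the drift bound compares its difference quotients with those of an
  approximating test function. Conversely, symmetry gives
  \<open>L2_inner \<mu> g u = - L2_inner \<mu> f (jump_op u)\<close> for all test functions u when g is the derivative
  at f. As \<open>jump_op\<close> is symmetric and preserves functions constant at scale r,
  it maps the average of f to minus the average of g. The
  averages therefore exhibit the pair as an element of the closure.
\<close>

proposition generator_heat:
  "generator \<mu> heat = {(f, g). (f, \<lambda>x. - g x) \<in> vladimirov_pearson \<mu> s}"
proof (intro set_eqI iffI; clarify)
  fix f g assume vp: "(f, \<lambda>x. - g x) \<in> vladimirov_pearson \<mu> s"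
  obtain F where f: "f \<in> L2 \<mu>" and ng: "(\<lambda>x. - g x) \<in> L2 \<mu>" and F: "\<And>n. F n \<in> test_functions"
    and Fg: "(\<lambda>n. L2_norm \<mu> (\<lambda>x. jump_op (F n) x - (- g x))) \<longlonglongrightarrow> 0"
    using vp unfolding vp_iff by blast
  have g: "g \<in> L2 \<mu>" using L2_uminus[OF ng] by simp
  have "((\<lambda>t. L2_norm \<mu> (\<lambda>x. (heat t f x - f x) / of_real t - g x)) \<longlongrightarrow> 0) (at_right 0)"
  proof (rule L2_bounded_tendsto0I)
    fix e :: real assume "0 < e"
    then have e3: "0 < e / 3" by simp
    then have "\<forall>\<^sub>F n in sequentially. L2_norm \<mu> (\<lambda>x. jump_op (F n) x - (- g x)) < e / 3"
      by (rule order_tendstoD(2)[OF Fg])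
    then obtain n where n: "L2_norm \<mu> (\<lambda>x. jump_op (F n) x - (- g x)) < e / 3"
      by (meson eventually_happens trivial_limit_sequentially)
    let ?u = "F n"
    have "\<forall>\<^sub>F t in at_right 0. L2_norm \<mu> (\<lambda>x. (exp_op t ?u x - ?u x) / of_real t + jump_op ?u x) < e / 3"
      by (rule order_tendstoD(2)[OF exp_op_derivative[OF F] e3])
    moreover have "\<forall>\<^sub>F t in at_right 0. (0::real) < t" by (rule eventually_at_right_less)
    ultimately show "\<forall>\<^sub>F t in at_right 0. L2_norm \<mu> (\<lambda>x. (heat t f x - f x) / of_real t - g x) < e"
    proof eventually_elim
      case (elim t)
      then have t: "0 < t" "0 \<le> t" by auto
      let ?X = "\<lambda>x. (1 / of_real t) * ((heat t f x - f x) - (exp_op t ?u x - ?u x))"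
      let ?Y = "\<lambda>x. (exp_op t ?u x - ?u x) / of_real t + jump_op ?u x"
      let ?Z = "\<lambda>x. - (jump_op ?u x - (- g x))"
      have X: "?X \<in> L2 \<mu>" and Y: "?Y \<in> L2 \<mu>" and Z: "?Z \<in> L2 \<mu>"
        by (intro L2_scale L2_diff heat_contraction(1) t f test_L2 exp_op_test F quotient_L2(1) L2_uminus
            jump_op_test ng)+
      have "(\<lambda>x. (heat t f x - f x) / of_real t - g x) = (\<lambda>x. ?X x + (?Y x + ?Z x))"
        by (auto simp: fun_eq_iff diff_divide_distrib)
      then have "L2_norm \<mu> (\<lambda>x. (heat t f x - f x) / of_real t - g x) \<le>
          L2_norm \<mu> ?X + (L2_norm \<mu> ?Y + L2_norm \<mu> ?Z)"
        using L2_norm_triangle[OF X L2_add[OF Y Z]] L2_norm_triangle[OF Y Z] by simp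
      also have "L2_norm \<mu> ?X \<le> L2_norm \<mu> (\<lambda>x. jump_op ?u x + g x)"
        using heat_drift_bound[OF vp F t(1), of n] t(1) unfolding L2_norm_scale
        by (simp add: norm_divide divide_le_eq mult.commute)
      also have "L2_norm \<mu> ?Z = L2_norm \<mu> (\<lambda>x. jump_op ?u x - (- g x))" by (rule L2_norm_uminus)
      finally show ?case using n elim(1) by simp
    qed
  qed
  then show "(f, g) \<in> generator \<mu> heat" unfolding generator_def using f g by simp
next
  fix f g assume "(f, g) \<in> generator \<mu> heat"
  then have f: "f \<in> L2 \<mu>" and g: "g \<in> L2 \<mu>"
    and lim: "((\<lambda>t. L2_norm \<mu> (\<lambda>x. (heat t f x - f x) / of_real t - g x)) \<longlongrightarrow> 0) (at_right 0)"
    by (auto simp: generator_def)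
  let ?h = "\<lambda>n. 1 / real (Suc n)"
  have h: "filterlim ?h (at_right 0) sequentially"
    unfolding filterlim_at using LIMSEQ_Suc[OF lim_1_over_n] by simp
  have weak: "L2_inner \<mu> g u = - L2_inner \<mu> f (jump_op u)" if u: "u \<in> test_functions" for u
  proof -
    have const: "(\<lambda>n::nat. L2_norm \<mu> (\<lambda>x. k x - k x)) \<longlonglongrightarrow> 0" for k
      by (simp add: L2_norm_def)
    have hn: "0 \<le> ?h n" for n by simp
    have "(\<lambda>n. L2_inner \<mu> (\<lambda>x. (heat (?h n) f x - f x) / of_real (?h n)) u) \<longlonglongrightarrow> L2_inner \<mu> g u"
      by (intro L2_inner_tendsto[OF _ _ _ _ filterlim_compose[OF lim h] const]
          quotient_L2(2)[OF _ _ g] heat_contraction(1) hn f g test_L2 u)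
    moreover have "(\<lambda>n. L2_inner \<mu> f (\<lambda>x. (exp_op (?h n) u x - u x) / of_real (?h n)))
        \<longlonglongrightarrow> L2_inner \<mu> f (\<lambda>x. - jump_op u x)"
    proof (intro L2_inner_tendsto[OF _ _ _ _ const])
      show "(\<lambda>n. L2_norm \<mu> (\<lambda>x. (exp_op (?h n) u x - u x) / of_real (?h n) - - jump_op u x)) \<longlonglongrightarrow> 0"
        using filterlim_compose[OF exp_op_derivative[OF u] h] by simp
    qed (intro quotient_L2(2)[OF _ _ g] f test_L2 exp_op_test u L2_uminus jump_op_test)+
    moreover have "L2_inner \<mu> (\<lambda>x. (heat (?h n) f x - f x) / of_real (?h n)) u =
        L2_inner \<mu> f (\<lambda>x. (exp_op (?h n) u x - u x) / of_real (?h n))" for n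
    proof -
      have "L2_inner \<mu> (\<lambda>x. (1 / of_real (?h n)) * (heat (?h n) f x - f x)) u =
        L2_inner \<mu> f (\<lambda>x. (1 / of_real (?h n)) * (exp_op (?h n) u x - u x))"
        unfolding L2_inner_scale_left L2_inner_scale_right
          L2_inner_diff_left[OF heat_contraction(1)[OF hn f] f test_L2[OF u]]
          L2_inner_diff_right[OF f test_L2[OF exp_op_test[OF u]] test_L2[OF u]]
          heat_symmetric[OF hn f u] by simp
      then show ?thesis by (simp only: times_divide_eq_left mult_1_left)
    qed
    ultimately have "L2_inner \<mu> g u = L2_inner \<mu> f (\<lambda>x. - jump_op u x)" using LIMSEQ_unique by simp
    then show ?thesis using L2_inner_scale_right[of \<mu> f "-1" "jump_op u"] by simp
  qed
  (* the function below is constant at scale r and orthogonal to all such functions, itself included *)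
  have Davg: "L2_norm \<mu> (\<lambda>x. jump_op (avg r f) x + avg r g x) = 0" if r: "0 < r" for r
  proof -
    let ?w = "\<lambda>x. jump_op (avg r f) x + avg r g x"
    have wc: "const_at_scale r ?w"
      using const_at_scale_comp(2)[OF jump_op_const_at_scale[OF r avg_const_at_scale] avg_const_at_scale] .
    then have w: "?w \<in> test_functions" using r test_function_iff by blast
    have "L2_inner \<mu> ?w ?w = L2_inner \<mu> ?w (jump_op (avg r f)) + L2_inner \<mu> ?w (avg r g)"
      by (intro L2_inner_add_right test_L2 w jump_op_test avg_test r)
    also have "L2_inner \<mu> ?w (jump_op (avg r f)) = L2_inner \<mu> (jump_op ?w) (avg r f)"
      by (rule jump_op_symmetric[OF w avg_test[OF r], symmetric])
    also have "\<dots> = L2_inner \<mu> (jump_op ?w) f"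
      by (rule avg_inner[OF r f jump_op_const_at_scale[OF r wc]])
    also have "L2_inner \<mu> ?w (avg r g) = L2_inner \<mu> ?w g" by (rule avg_inner[OF r g wc])
    also have "L2_inner \<mu> (jump_op ?w) f + L2_inner \<mu> ?w g = cnj (L2_inner \<mu> f (jump_op ?w) + L2_inner \<mu> g ?w)"
      by (simp add: L2_inner_cnj)
    also have "\<dots> = 0" using weak[OF w] by simp
    finally show ?thesis unfolding L2_inner_self by simp
  qed
  let ?F = "\<lambda>n. avg (?h n) f"
  have "(\<lambda>n. L2_norm \<mu> (\<lambda>x. jump_op (?F n) x - - g x)) \<longlonglongrightarrow> 0"
  proof (rule Lim_null_comparison[OF _ avg_tendsto[OF g]], rule always_eventually, rule allI)
    fix n
    have hn: "0 < ?h n" by simp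
    have "L2_norm \<mu> (\<lambda>x. jump_op (?F n) x - - g x) =
        L2_norm \<mu> (\<lambda>x. (jump_op (?F n) x + avg (?h n) g x) + (g x - avg (?h n) g x))" by simp
    also have "\<dots> \<le> L2_norm \<mu> (\<lambda>x. jump_op (?F n) x + avg (?h n) g x) + L2_norm \<mu> (\<lambda>x. g x - avg (?h n) g x)"
      by (intro L2_norm_triangle L2_add L2_diff test_L2 jump_op_test avg_test g hn)
    finally show "norm (L2_norm \<mu> (\<lambda>x. jump_op (?F n) x - - g x)) \<le> L2_norm \<mu> (\<lambda>x. avg (?h n) g x - g x)"
      using Davg[OF hn] by (simp add: L2_norm_minus_commute[of \<mu> g])
  qed
  then show "(f, \<lambda>x. - g x) \<in> vladimirov_pearson \<mu> s"
    unfolding vp_iff using f L2_uminus[OF g] avg_test avg_tendsto[OF f]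
    by (intro conjI exI[of _ ?F]) auto
qed

proposition heat_L2_semigroup: "L2_semigroup \<mu> heat"
  unfolding L2_semigroup_def
proof (intro conjI allI impI ballI)
  show "heat t f \<in> L2 \<mu>" if "0 \<le> t" "f \<in> L2 \<mu>" for t f using that by (rule heat_contraction)
  show "AE x in \<mu>. heat t (\<lambda>y. a * f y + b * g y) x = a * heat t f x + b * heat t g x"
    if "0 \<le> t" "f \<in> L2 \<mu>" "g \<in> L2 \<mu>" for t f g a b using that by (rule heat_lincomb)
  show "\<exists>K. \<forall>f\<in>L2 \<mu>. L2_norm \<mu> (heat t f) \<le> K * L2_norm \<mu> f" if "0 \<le> t" for t
    using heat_contraction(2)[OF that] by (intro exI[of _ 1]) simp
  show "AE x in \<mu>. heat 0 f x = f x" if "f \<in> L2 \<mu>" for f using that by (rule heat_0)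
  show "AE x in \<mu>. heat (t + t') f x = heat t (heat t' f) x"
    if "0 \<le> t" "0 \<le> t'" "f \<in> L2 \<mu>" for t t' f using that by (rule heat_semigroup)
  show "((\<lambda>t. L2_norm \<mu> (\<lambda>x. heat t f x - f x)) \<longlongrightarrow> 0) (at_right 0)" if f: "f \<in> L2 \<mu>" for f
  proof (rule L2_bounded_tendsto0I)
    fix e :: real assume "0 < e"
    then have e3: "0 < e / 3" by simp
    then obtain u where u: "u \<in> test_functions" "L2_norm \<mu> (\<lambda>x. f x - u x) < e / 3"
      using test_functions_dense[OF f] by blast
    have "\<forall>\<^sub>F t in at_right 0. L2_norm \<mu> (\<lambda>x. exp_op t u x - u x) < e / 3"
      by (rule order_tendstoD(2)[OF exp_op_continuous_0[OF u(1)] e3])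
    moreover have "\<forall>\<^sub>F t in at_right 0. (0::real) < t" by (rule eventually_at_right_less)
    ultimately show "\<forall>\<^sub>F t in at_right 0. L2_norm \<mu> (\<lambda>x. heat t f x - f x) < e"
    proof eventually_elim
      case (elim t)
      then have t: "0 \<le> t" by simp
      note L = heat_contraction(1)[OF t f] test_L2[OF u(1)] test_L2[OF exp_op_test[OF u(1)]]
      have "L2_norm \<mu> (\<lambda>x. heat t f x - f x) \<le> L2_norm \<mu> (\<lambda>x. heat t f x - exp_op t u x)
          + L2_norm \<mu> (\<lambda>x. exp_op t u x - f x)"
        by (intro L2_norm_triangle_diff L f)
      also have "L2_norm \<mu> (\<lambda>x. exp_op t u x - f x) \<le> L2_norm \<mu> (\<lambda>x. exp_op t u x - u x)
          + L2_norm \<mu> (\<lambda>x. u x - f x)"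
        by (intro L2_norm_triangle_diff L f)
      also have "L2_norm \<mu> (\<lambda>x. heat t f x - exp_op t u x) \<le> L2_norm \<mu> (\<lambda>x. f x - u x)"
        using heat_diff_contraction[OF t f test_L2[OF u(1)]] by (simp add: heat_test[OF t u(1)])
      also have "L2_norm \<mu> (\<lambda>x. u x - f x) = L2_norm \<mu> (\<lambda>x. f x - u x)" by (rule L2_norm_minus_commute)
      finally show ?case using u(2) elim(1) by simp
    qed
  qed
qed

section \<open>Uniqueness of the semigroup\<close>

text \<open>
  By Baire's theorem on the time axis, the times with operator norm at most n are dense in some
  interval, for some n. Strong continuity from the right extends the bound to the whole interval. This takes
  the place of the uniform boundedness principle.
\<close>

lemma semigroup_locally_bounded:
  assumes T: "L2_semigroup \<mu> T" and d: "0 < d"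
  obtains a b :: real and K where "0 < a" "a < b" "b < d"
    "\<And>t f. a \<le> t \<Longrightarrow> t < b \<Longrightarrow> f \<in> L2 \<mu> \<Longrightarrow> L2_norm \<mu> (T t f) \<le> K * L2_norm \<mu> f"
proof -
  have TL: "T t f \<in> L2 \<mu>" if "0 \<le> t" "f \<in> L2 \<mu>" for t f using T that by (auto simp: L2_semigroup_def)
  define A where "A = (\<lambda>n::nat. {t. 0 \<le> t \<and> (\<forall>f\<in>L2 \<mu>. L2_norm \<mu> (T t f) \<le> real n * L2_norm \<mu> f)})"
  have cover: "\<exists>n. t \<in> A n" if "0 \<le> t" for t
  proof -
    have "\<forall>t\<ge>0. \<exists>K. \<forall>f\<in>L2 \<mu>. L2_norm \<mu> (T t f) \<le> K * L2_norm \<mu> f"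
      using T by (simp add: L2_semigroup_def)
    then obtain K where K: "\<And>f. f \<in> L2 \<mu> \<Longrightarrow> L2_norm \<mu> (T t f) \<le> K * L2_norm \<mu> f"
      using \<open>0 \<le> t\<close> by blast
    obtain n :: nat where n: "K \<le> real n" using real_arch_simple by blast
    have "L2_norm \<mu> (T t f) \<le> real n * L2_norm \<mu> f" if "f \<in> L2 \<mu>" for f
      using K[OF that] mult_right_mono[OF n L2_norm_nonneg, of \<mu> f] by linarith
    then show ?thesis using \<open>0 \<le> t\<close> by (auto simp: A_def)
  qed
  have "\<exists>n. interior (closure (A n)) \<inter> {0<..<d} \<noteq> {}"
  proof (rule ccontr)
    assume no: "\<not> ?thesis"
    (* a compact interval inside the open interval from 0 to d, as a complete space for Baire's theorem *)
    define S where "S = {d/4..d/2}"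
    define U where "U = (\<lambda>n. S - closure (A n))"
    have "S \<subseteq> closure (\<Inter>(range U))"
    proof (rule Baire)
      show "closed S" by (simp add: S_def)
      show "countable (range U)" by simp
      fix V assume "V \<in> range U"
      then obtain n where V: "V = U n" by auto
      have "openin (top_of_set S) V"
        unfolding V U_def by (metis Diff_eq closed_closure openin_open_Int open_Compl)
      moreover have "S \<subseteq> closure V"
      proof -
        have "{d/4<..<d/2} \<subseteq> closure V"
        proof
          fix x assume x: "x \<in> {d/4<..<d/2}"
          show "x \<in> closure V"
            unfolding closure_iff_nhds_not_empty
          proof (intro allI impI)
            fix W B assume "B \<subseteq> W" "x \<in> B" "open B"
            let ?B = "B \<inter> {d/4<..<d/2}"
            have "open ?B" "x \<in> ?B" using \<open>open B\<close> \<open>x \<in> B\<close> x by auto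
            moreover have "x \<in> {0<..<d}" using x d by auto
            then have "x \<notin> interior (closure (A n))" using no by blast
            ultimately have "\<not> ?B \<subseteq> closure (A n)" using interior_maximal by blast
            then obtain y where "y \<in> ?B" "y \<notin> closure (A n)" by blast
            then have "y \<in> V \<inter> W" using \<open>B \<subseteq> W\<close> by (auto simp: V U_def S_def)
            then show "V \<inter> W \<noteq> {}" by blast
          qed
        qed
        then have "closure {d/4<..<d/2} \<subseteq> closure V" by (rule closure_minimal) simp
        then show ?thesis using d by (simp add: S_def)
      qed
      ultimately show "openin (top_of_set S) V \<and> S \<subseteq> closure V" by blast
    qed
    moreover have "\<Inter>(range U) = {}"
    proof -
      have "False" if t: "\<And>n. t \<in> U n" for t
      proof -
        have "t \<in> S" using t by (auto simp: U_def)
        then have "0 \<le> t" using d by (simp add: S_def)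
        then obtain n where "t \<in> A n" using cover by blast
        then have "t \<in> closure (A n)" using closure_subset by blast
        then show False using t[of n] by (simp add: U_def)
      qed
      then show ?thesis by blast
    qed
    ultimately have "S = {}" by simp
    then show False using d by (simp add: S_def)
  qed
  then obtain n c where c: "c \<in> interior (closure (A n))" "0 < c" "c < d" by auto
  then obtain e where e: "0 < e" "ball c e \<subseteq> interior (closure (A n))"
    using open_contains_ball[of "interior (closure (A n))"] by auto
  define b where "b = min ((c + d) / 2) (c + e)"
  have b: "c < b" "b < d" using c e by (auto simp: b_def min_def)
  have "L2_norm \<mu> (T t f) \<le> real n * L2_norm \<mu> f" if t: "c \<le> t" "t < b" and f: "f \<in> L2 \<mu>" for t f
  proof -
    have t0: "0 \<le> t" using t c by simp
    have cl: "t' \<in> closure (A n)" if "t \<le> t'" "t' < b" for t'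
    proof -
      have "t' \<in> ball c e" using that t by (auto simp: b_def dist_real_def)
      then show ?thesis using e(2) interior_subset by blast
    qed
    (* t itself need not be a time with bound n, but such times exist arbitrarily close to its right *)
    have near: "\<exists>h>0. h < q \<and> t + h \<in> A n" if q: "0 < q" for q
    proof -
      define m where "m = min q (b - t)"
      have m: "0 < m" "m \<le> q" "m \<le> b - t" using q t by (auto simp: m_def)
      then have "t + m / 2 \<in> closure (A n)" by (intro cl) (auto simp: field_simps)
      then obtain y where y: "y \<in> A n" "dist y (t + m / 2) < m / 2"
        using m(1) unfolding closure_approachable by (meson half_gt_zero)
      then have "\<bar>y - (t + m / 2)\<bar> < m / 2" by (simp only: dist_real_def)
      then have "0 < y - t" "y - t < m" unfolding abs_less_iff by linarith+
      then show ?thesis using y(1) m(2) by (intro exI[of _ "y - t"]) auto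
    qed
    show ?thesis
    proof (rule field_le_epsilon)
      fix q :: real assume q: "0 < q"
      have "((\<lambda>h. L2_norm \<mu> (\<lambda>x. T h (T t f) x - T t f x)) \<longlongrightarrow> 0) (at_right 0)"
        using T TL[OF t0 f] by (auto simp: L2_semigroup_def)
      then have "\<forall>\<^sub>F h in at_right 0. L2_norm \<mu> (\<lambda>x. T h (T t f) x - T t f x) < q"
        using q by (rule order_tendstoD(2))
      then obtain p where p: "0 < p" "\<And>h. 0 < h \<Longrightarrow> h < p \<Longrightarrow> L2_norm \<mu> (\<lambda>x. T h (T t f) x - T t f x) < q"
        unfolding eventually_at_right_field by auto
      obtain h where h: "0 < h" "h < p" "t + h \<in> A n" using near[OF p(1)] by blast
      have L: "T t f \<in> L2 \<mu>" "T h (T t f) \<in> L2 \<mu>" "T (t + h) f \<in> L2 \<mu>"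
        using TL t0 f h(1) by auto
      have "AE x in \<mu>. T (h + t) f x = T h (T t f) x"
        using T t0 h(1) f by (auto simp: L2_semigroup_def)
      then have "L2_norm \<mu> (T h (T t f)) = L2_norm \<mu> (T (t + h) f)"
        using L by (intro L2_norm_cong_AE) (auto simp: add.commute dest: L2_measurable)
      also have "\<dots> \<le> real n * L2_norm \<mu> f" using h(3) f by (auto simp: A_def)
      finally have "L2_norm \<mu> (T h (T t f)) \<le> real n * L2_norm \<mu> f" .
      moreover have "L2_norm \<mu> (T t f) \<le> L2_norm \<mu> (\<lambda>x. T t f x - T h (T t f) x) + L2_norm \<mu> (T h (T t f))"
        by (rule L2_norm_le_diff[OF L(1,2)])
      ultimately show "L2_norm \<mu> (T t f) \<le> real n * L2_norm \<mu> f + q"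
        using p(2)[OF h(1,2)] by (simp add: L2_norm_minus_commute[of \<mu> "T t f"])
    qed
  qed
  then show ?thesis using that[of c b "real n"] c(2) b by blast
qed

lemma L2_semigroupD:
  assumes "L2_semigroup \<mu> T"
  shows "\<And>t f. 0 \<le> t \<Longrightarrow> f \<in> L2 \<mu> \<Longrightarrow> T t f \<in> L2 \<mu>"
    and "\<And>t f g a b. 0 \<le> t \<Longrightarrow> f \<in> L2 \<mu> \<Longrightarrow> g \<in> L2 \<mu> \<Longrightarrow>
      AE x in \<mu>. T t (\<lambda>y. a * f y + b * g y) x = a * T t f x + b * T t g x"
    and "\<And>f. f \<in> L2 \<mu> \<Longrightarrow> AE x in \<mu>. T 0 f x = f x"
    and "\<And>t t' f. 0 \<le> t \<Longrightarrow> 0 \<le> t' \<Longrightarrow> f \<in> L2 \<mu> \<Longrightarrow> AE x in \<mu>. T (t + t') f x = T t (T t' f) x"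
    and "\<And>f. f \<in> L2 \<mu> \<Longrightarrow> ((\<lambda>t. L2_norm \<mu> (\<lambda>x. T t f x - f x)) \<longlongrightarrow> 0) (at_right 0)"
  using assms unfolding L2_semigroup_def by simp_all

lemma L2_semigroup_bounded_op:
  assumes T: "L2_semigroup \<mu> T" and t: "0 \<le> t"
  shows "L2_bounded_op (T t)"
  unfolding L2_bounded_op_def
proof (intro conjI ballI)
  show "T t f \<in> L2 \<mu>" if "f \<in> L2 \<mu>" for f by (rule L2_semigroupD(1)[OF T t that])
  show "AE x in \<mu>. T t (\<lambda>y. f y - g y) x = T t f x - T t g x" if "f \<in> L2 \<mu>" "g \<in> L2 \<mu>" for f g
    using L2_semigroupD(2)[OF T t that, of 1 "-1"] by simp
  show "\<exists>K. \<forall>f\<in>L2 \<mu>. L2_norm \<mu> (T t f) \<le> K * L2_norm \<mu> f"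
    using T t by (simp add: L2_semigroup_def)
qed

lemma vp_test: "u \<in> test_functions \<Longrightarrow> (u, jump_op u) \<in> vladimirov_pearson \<mu> s"
  unfolding vp_iff by (intro conjI test_L2 jump_op_test exI[of _ "\<lambda>_. u"]) (auto simp: L2_norm_def)

lemma semigroup_shift:
  assumes T: "L2_semigroup \<mu> T" and phi: "\<phi> \<in> L2 \<mu>" and t: "0 \<le> t" and h: "0 \<le> h"
  shows "L2_norm \<mu> (\<lambda>x. c * T (t + h) \<phi> x - T t \<phi> x) = L2_norm \<mu> (T t (\<lambda>x. c * T h \<phi> x - \<phi> x))"
proof -
  note TL = L2_semigroupD(1)[OF T]
  have "AE x in \<mu>. T (t + h) \<phi> x = T t (T h \<phi>) x" by (rule L2_semigroupD(4)[OF T t h phi])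
  moreover have "AE x in \<mu>. T t (\<lambda>x. c * T h \<phi> x + - 1 * \<phi> x) x = c * T t (T h \<phi>) x + - 1 * T t \<phi> x"
    by (rule L2_semigroupD(2)[OF T t TL[OF h phi] phi])
  ultimately have "AE x in \<mu>. c * T (t + h) \<phi> x - T t \<phi> x = T t (\<lambda>x. c * T h \<phi> x - \<phi> x) x"
    by eventually_elim simp
  then show ?thesis
    by (rule L2_norm_cong_AE)
      (intro L2_measurable L2_diff L2_scale TL t h phi add_nonneg_nonneg)+
qed

text \<open>
  The orbit of the eigenfunction starts with velocity \<open>- l\<close> times the eigenfunction, which the
  factor \<open>exp (h * l)\<close> cancels to first order.
\<close>

lemma rescaled_remainder:
  assumes T: "L2_semigroup \<mu> T"
    and gen: "generator \<mu> T = {(f, g). (f, \<lambda>x. - g x) \<in> vladimirov_pearson \<mu> s}"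
    and phi: "eigenfunction l \<phi>"
  shows "((\<lambda>h. L2_norm \<mu> (\<lambda>x. of_real (exp (h * l)) * T h \<phi> x - \<phi> x) / h) \<longlongrightarrow> 0) (at_right 0)"
proof -
  note TL = L2_semigroupD(1)[OF T]
  have pL: "\<phi> \<in> L2 \<mu>" by (rule test_L2[OF eigenfunction_test[OF phi]])
  have "(\<phi>, jump_op \<phi>) \<in> vladimirov_pearson \<mu> s" by (rule vp_test[OF eigenfunction_test[OF phi]])
  then have "(\<phi>, \<lambda>x. - (of_real l * \<phi> x)) \<in> generator \<mu> T"
    unfolding gen using phi by (simp add: eigenfunction_def)
  then have q: "((\<lambda>h. L2_norm \<mu> (\<lambda>x. (T h \<phi> x - \<phi> x) / of_real h + of_real l * \<phi> x)) \<longlongrightarrow> 0) (at_right 0)"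
    by (simp add: generator_def)
  let ?q = "\<lambda>h. L2_norm \<mu> (\<lambda>x. (T h \<phi> x - \<phi> x) / of_real h + of_real l * \<phi> x)"
  let ?c = "\<lambda>h::real. (complex_of_real (exp (- h * l)) - 1) / of_real h + of_real l"
  have "((\<lambda>h. exp (h * l) * (?q h + L2_norm \<mu> (\<lambda>x. ?c h * \<phi> x))) \<longlongrightarrow> exp (0 * l) * (0 + 0)) (at_right 0)"
    by (intro tendsto_intros q L2_norm_smult_limit exp_difference_quotient)
  then have lim: "((\<lambda>h. exp (h * l) * (?q h + L2_norm \<mu> (\<lambda>x. ?c h * \<phi> x))) \<longlongrightarrow> 0) (at_right 0)"
    by simp
  show ?thesis
  proof (rule Lim_null_comparison[OF _ lim])
    have "\<forall>\<^sub>F h in at_right 0. (0::real) < h" by (rule eventually_at_right_less)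
    then show "\<forall>\<^sub>F h in at_right 0. norm (L2_norm \<mu> (\<lambda>x. of_real (exp (h * l)) * T h \<phi> x - \<phi> x) / h)
        \<le> exp (h * l) * (?q h + L2_norm \<mu> (\<lambda>x. ?c h * \<phi> x))"
    proof eventually_elim
      case (elim h)
      let ?A = "\<lambda>x. (T h \<phi> x - \<phi> x) / of_real h + of_real l * \<phi> x"
      have A: "?A \<in> L2 \<mu>" using elim by (intro quotient_L2(1) TL pL L2_scale) simp
      have B: "(\<lambda>x. ?c h * \<phi> x) \<in> L2 \<mu>" by (rule L2_scale[OF pL])
      have e: "complex_of_real (exp (h * l)) * of_real (exp (- h * l)) = 1"
        by (simp add: exp_minus flip: of_real_mult)
      have "of_real (exp (h * l)) * T h \<phi> x - \<phi> x = of_real (h * exp (h * l)) * (?A x - ?c h * \<phi> x)" for x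
      proof -
        have h0: "complex_of_real h \<noteq> 0" using elim by simp
        have "?A x - ?c h * \<phi> x = (T h \<phi> x - of_real (exp (- h * l)) * \<phi> x) / of_real h"
          by (simp add: diff_divide_distrib algebra_simps)
        then have "of_real (h * exp (h * l)) * (?A x - ?c h * \<phi> x) =
            of_real (exp (h * l)) * (T h \<phi> x - of_real (exp (- h * l)) * \<phi> x)"
          using h0 by simp
        also have "\<dots> = of_real (exp (h * l)) * T h \<phi> x - (of_real (exp (h * l)) * of_real (exp (- h * l))) *
            \<phi> x"
          by (simp add: algebra_simps)
        finally show ?thesis unfolding e by simp
      qed
      then have "L2_norm \<mu> (\<lambda>x. of_real (exp (h * l)) * T h \<phi> x - \<phi> x) =
          h * exp (h * l) * L2_norm \<mu> (\<lambda>x. ?A x - ?c h * \<phi> x)"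
        using elim by (simp only: L2_norm_scale) (simp add: norm_mult)
      then have "L2_norm \<mu> (\<lambda>x. of_real (exp (h * l)) * T h \<phi> x - \<phi> x) / h =
          exp (h * l) * L2_norm \<mu> (\<lambda>x. ?A x - ?c h * \<phi> x)"
        using elim by simp
      moreover have "L2_norm \<mu> (\<lambda>x. ?A x - ?c h * \<phi> x) \<le> ?q h + L2_norm \<mu> (\<lambda>x. ?c h * \<phi> x)"
        using L2_norm_triangle[OF A L2_uminus[OF B]] unfolding L2_norm_uminus diff_conv_add_uminus .
      moreover have "0 \<le> L2_norm \<mu> (\<lambda>x. of_real (exp (h * l)) * T h \<phi> x - \<phi> x) / h"
        using elim by simp
      ultimately show ?case by (simp only: real_norm_def abs_of_nonneg) (intro mult_left_mono; simp)
    qed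
  qed
qed

text \<open>
  On an interval where the semigroup is bounded, the rescaled orbit of an eigenfunction moves
  by less than any multiple of the elapsed time, hence not at all.
\<close>

lemma rescaled_orbit_constant:
  assumes T: "L2_semigroup \<mu> T"
    and gen: "generator \<mu> T = {(f, g). (f, \<lambda>x. - g x) \<in> vladimirov_pearson \<mu> s}"
    and phi: "eigenfunction l \<phi>"
    and ab: "0 < a" "a < b"
    and K: "\<And>t f. a \<le> t \<Longrightarrow> t < b \<Longrightarrow> f \<in> L2 \<mu> \<Longrightarrow> L2_norm \<mu> (T t f) \<le> K * L2_norm \<mu> f"
    and q: "0 < q" "a + q < b"
  shows "AE x in \<mu>. T (a + q) \<phi> x = of_real (exp (- q * l)) * T a \<phi> x"
proof -
  note TL = L2_semigroupD(1)[OF T]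
  have pL: "\<phi> \<in> L2 \<mu>" by (rule test_L2[OF eigenfunction_test[OF phi]])
  define Y where "Y = (\<lambda>q x. of_real (exp (q * l)) * T (a + q) \<phi> x)"
  define r where "r = (\<lambda>h. L2_norm \<mu> (\<lambda>x. of_real (exp (h * l)) * T h \<phi> x - \<phi> x))"
  define M where "M = exp (q * \<bar>l\<bar>) * max K 0"
  have M: "0 \<le> M" by (simp add: M_def)
  have YL: "Y p \<in> L2 \<mu>" if "0 \<le> p" for p
    unfolding Y_def using ab that by (intro L2_scale TL pL) simp
  have step: "L2_norm \<mu> (\<lambda>x. Y (p + h) x - Y p x) \<le> M * r h" if p: "0 \<le> p" "p \<le> q" and h: "0 \<le> h" for p h
  proof -
    have "(\<lambda>x. Y (p + h) x - Y p x) =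
        (\<lambda>x. of_real (exp (p * l)) * (of_real (exp (h * l)) * T (a + p + h) \<phi> x - T (a + p) \<phi> x))"
      by (simp add: Y_def distrib_right exp_add add.assoc right_diff_distrib mult.assoc)
    then have "L2_norm \<mu> (\<lambda>x. Y (p + h) x - Y p x) =
        exp (p * l) * L2_norm \<mu> (T (a + p) (\<lambda>x. of_real (exp (h * l)) * T h \<phi> x - \<phi> x))"
      using semigroup_shift[OF T pL, of "a + p" h] p h ab by (simp only: L2_norm_scale) simp
    also have "\<dots> \<le> exp (p * l) * (K * r h)"
      unfolding r_def
      by (intro mult_left_mono K L2_diff L2_scale TL pL h) (use p q in auto)
    also have "exp (p * l) * (K * r h) \<le> exp (q * \<bar>l\<bar>) * (max K 0 * r h)"
    proof (rule mult_mono)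
      have "p * l \<le> p * \<bar>l\<bar>" using p by (intro mult_left_mono) auto
      also have "\<dots> \<le> q * \<bar>l\<bar>" using p by (intro mult_right_mono) auto
      finally show "exp (p * l) \<le> exp (q * \<bar>l\<bar>)" by simp
      show "K * r h \<le> max K 0 * r h" by (intro mult_right_mono) (auto simp: r_def)
      show "0 \<le> K * r h"
        using K[OF _ _ L2_diff[OF L2_scale[OF TL[OF h pL]] pL], of a "of_real (exp (h * l))"] ab
          L2_norm_nonneg[of \<mu> "T a (\<lambda>x. of_real (exp (h * l)) * T h \<phi> x - \<phi> x)"]
        unfolding r_def by linarith
    qed simp
    finally show ?thesis by (simp add: M_def mult.assoc)
  qed
  have tele: "L2_norm \<mu> (\<lambda>x. Y (real k * h) x - Y 0 x) \<le> real k * (M * r h)"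
    if h: "0 \<le> h" "real k * h \<le> q" for k h
    using h(2)
  proof (induction k)
    case 0
    then show ?case by (simp add: L2_norm_def)
  next
    case (Suc k)
    have kh: "0 \<le> real k * h" "real k * h \<le> q" using Suc.prems h(1) by (auto simp: distrib_right)
    have "L2_norm \<mu> (\<lambda>x. Y (real (Suc k) * h) x - Y 0 x) \<le>
        L2_norm \<mu> (\<lambda>x. Y (real (Suc k) * h) x - Y (real k * h) x) + L2_norm \<mu> (\<lambda>x. Y (real k * h) x - Y 0 x)"
      using kh h(1) by (intro L2_norm_triangle_diff YL) auto
    also have "L2_norm \<mu> (\<lambda>x. Y (real (Suc k) * h) x - Y (real k * h) x) \<le> M * r h"
      using step[OF kh h(1)] by (simp add: distrib_right add.commute)
    also have "L2_norm \<mu> (\<lambda>x. Y (real k * h) x - Y 0 x) \<le> real k * (M * r h)"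
      by (rule Suc.IH[OF kh(2)])
    finally show ?case by (simp add: distrib_right)
  qed
  let ?h = "\<lambda>n. q / real (Suc n)"
  have "filterlim ?h (at_right 0) sequentially"
    unfolding filterlim_at
  proof
    show "\<forall>\<^sub>F n in sequentially. ?h n \<in> {0<..} \<and> ?h n \<noteq> 0"
      using q by (intro always_eventually allI) simp
    show "?h \<longlonglongrightarrow> 0"
      using tendsto_mult_right_zero[OF LIMSEQ_Suc[OF lim_1_over_n], of q] by simp
  qed
  then have "(\<lambda>n. r (?h n) / ?h n) \<longlonglongrightarrow> 0"
    unfolding r_def by (rule filterlim_compose[OF rescaled_remainder[OF T gen phi]])
  then have "(\<lambda>n. q * M * (r (?h n) / ?h n)) \<longlonglongrightarrow> 0" by (rule tendsto_mult_right_zero)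
  moreover have "L2_norm \<mu> (\<lambda>x. Y q x - Y 0 x) \<le> q * M * (r (?h n) / ?h n)" for n
  proof -
    have "real (Suc n) * ?h n = q" by simp
    then have "L2_norm \<mu> (\<lambda>x. Y q x - Y 0 x) \<le> real (Suc n) * (M * r (?h n))"
      using tele[of "?h n" "Suc n"] q(1) by simp
    also have "\<dots> = q * M * (r (?h n) / ?h n)" using q(1) by (simp add: field_simps)
    finally show ?thesis .
  qed
  ultimately have "L2_norm \<mu> (\<lambda>x. Y q x - Y 0 x) \<le> 0" by (intro LIMSEQ_le_const) auto
  then have "L2_norm \<mu> (\<lambda>x. Y q x - Y 0 x) = 0" by (simp add: order_antisym)
  then have "AE x in \<mu>. Y q x = Y 0 x" using q(1) by (intro L2_norm_diff_zero_AE YL) auto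
  then show ?thesis
  proof eventually_elim
    case (elim x)
    have e: "complex_of_real (exp (- q * l)) * of_real (exp (q * l)) = 1"
      by (simp add: exp_minus flip: of_real_mult)
    have "of_real (exp (- q * l)) * (of_real (exp (q * l)) * T (a + q) \<phi> x) = of_real (exp (- q * l)) * T a \<phi> x"
      using elim by (simp add: Y_def)
    then show ?case unfolding mult.assoc[symmetric] e by simp
  qed
qed

text \<open>
  Beyond the interval of boundedness the orbit is continued by the semigroup law. The bound holds
  only on intervals away from zero, so the starting point is a small positive time a.
\<close>

lemma L2_semigroup_eigenfunction_orbit:
  assumes T: "L2_semigroup \<mu> T"
    and gen: "generator \<mu> T = {(f, g). (f, \<lambda>x. - g x) \<in> vladimirov_pearson \<mu> s}"
    and phi: "eigenfunction l \<phi>" and d: "0 < d"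
  obtains a where "0 < a" "a < d"
    "\<And>q. 0 \<le> q \<Longrightarrow> AE x in \<mu>. T (a + q) \<phi> x = of_real (exp (- q * l)) * T a \<phi> x"
proof -
  note TL = L2_semigroupD(1)[OF T]
  have pL: "\<phi> \<in> L2 \<mu>" by (rule test_L2[OF eigenfunction_test[OF phi]])
  obtain a b K where ab: "0 < a" "a < b" "b < d"
    and K: "\<And>t f. a \<le> t \<Longrightarrow> t < b \<Longrightarrow> f \<in> L2 \<mu> \<Longrightarrow> L2_norm \<mu> (T t f) \<le> K * L2_norm \<mu> f"
    using semigroup_locally_bounded[OF T d] by metis
  have multi: "AE x in \<mu>. T (a + real n * h) \<phi> x = of_real (exp (- (real n * h) * l)) * T a \<phi> x"
    if h: "0 < h" "a + h < b" for n h
  proof (induction n)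
    case 0
    then show ?case by simp
  next
    case (Suc n)
    let ?p = "real n * h"
    have p: "0 \<le> ?p" using h by simp
    have aL: "T a \<phi> \<in> L2 \<mu>" "T (a + h) \<phi> \<in> L2 \<mu>" using ab h by (auto intro!: TL pL)
    have "AE x in \<mu>. T (?p + (a + h)) \<phi> x = T ?p (T (a + h) \<phi>) x"
      using p ab h by (intro L2_semigroupD(4)[OF T] pL) auto
    moreover have "AE x in \<mu>. T ?p (T (a + h) \<phi>) x = T ?p (\<lambda>x. of_real (exp (- h * l)) * T a \<phi> x) x"
      by (intro L2_bounded_op_cong[OF L2_semigroup_bounded_op[OF T p]] aL L2_scale
          rescaled_orbit_constant[OF T gen phi ab(1,2) K h])
    moreover have "AE x in \<mu>. T ?p (\<lambda>x. of_real (exp (- h * l)) * T a \<phi> x + 0 * T a \<phi> x) x =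
        of_real (exp (- h * l)) * T ?p (T a \<phi>) x + 0 * T ?p (T a \<phi>) x"
      by (rule L2_semigroupD(2)[OF T p aL(1) aL(1)])
    moreover have "AE x in \<mu>. T (?p + a) \<phi> x = T ?p (T a \<phi>) x"
      using p ab by (intro L2_semigroupD(4)[OF T] pL) auto
    ultimately show ?case using Suc
    proof eventually_elim
      case (elim x)
      have 1: "a + real (Suc n) * h = ?p + (a + h)" by (simp add: algebra_simps)
      have 2: "complex_of_real (exp (- (real (Suc n) * h) * l))
          = of_real (exp (- h * l)) * of_real (exp (- ?p * l))"
        by (simp add: algebra_simps exp_add[symmetric] flip: of_real_mult)
      show ?case unfolding 1 2 using elim by (simp add: add.commute mult.assoc)
    qed
  qed
  have "AE x in \<mu>. T (a + q) \<phi> x = of_real (exp (- q * l)) * T a \<phi> x" if q: "0 \<le> q" for q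
  proof (cases "q = 0")
    case True
    then show ?thesis by simp
  next
    case False
    then have q0: "0 < q" using q by simp
    obtain n where n: "q / (b - a) < real n" using reals_Archimedean2 by blast
    have "0 < q / (b - a)" using q0 ab by simp
    then have n0: "0 < real n" using n by linarith
    have "q / real n < b - a" using n n0 ab by (simp add: divide_less_eq mult.commute)
    then have "AE x in \<mu>. T (a + real n * (q / real n)) \<phi> x
        = of_real (exp (- (real n * (q / real n)) * l)) * T a \<phi> x"
      using q0 n0 by (intro multi) auto
    then show ?thesis using n0 by simp
  qed
  then show ?thesis using that[of a] ab by auto
qed

text \<open>
  The small starting times of the previous lemma are sent to zero, which gives the exponential law for
  eigenfunctions; bounded operators agreeing on test functions agree.
\<close>

proposition L2_semigroup_unique:
  assumes T: "L2_semigroup \<mu> T"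
    and gen: "generator \<mu> T = {(f, g). (f, \<lambda>x. - g x) \<in> vladimirov_pearson \<mu> s}"
    and t: "0 \<le> t" and f: "f \<in> L2 \<mu>"
  shows "AE x in \<mu>. T t f x = heat t f x"
proof (rule L2_bounded_op_eq[OF L2_semigroup_bounded_op[OF T t] heat_bounded_op[OF t] _ f])
  note TL = L2_semigroupD(1)[OF T]
  fix u :: "'a \<Rightarrow> complex" assume u: "u \<in> test_functions"
  then have "AE x in \<mu>. T t u x = exp_op t u x"
  proof (induction rule: eigenfunction_induct)
    case (eigenfunction l \<phi>)
    have pL: "\<phi> \<in> L2 \<mu>" by (rule test_L2[OF eigenfunction_test[OF eigenfunction]])
    show ?case
    proof (cases "t = 0")
      case True
      then show ?thesis using L2_semigroupD(3)[OF T pL] exp_op_0[OF eigenfunction_test[OF eigenfunction]]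
          by simp
    next
      case False
      then have t0: "0 < t" using t by simp
      let ?r = "\<lambda>a. L2_norm \<mu> (\<lambda>x. of_real (exp (a * l)) * T a \<phi> x - \<phi> x)"
      have "((\<lambda>a. a * (?r a / a)) \<longlongrightarrow> 0 * 0) (at_right 0)"
        by (intro tendsto_mult rescaled_remainder[OF T gen eigenfunction] tendsto_ident_at)
      moreover have "\<forall>\<^sub>F a in at_right 0. a * (?r a / a) = ?r a"
        using eventually_at_right_less[of "0::real"] by eventually_elim simp
      ultimately have r0: "(?r \<longlongrightarrow> 0) (at_right 0)"
        by (simp add: tendsto_cong)
      have "L2_norm \<mu> (\<lambda>x. T t \<phi> x - of_real (exp (- t * l)) * \<phi> x) \<le> 0"
      proof (rule field_le_epsilon)
        fix e :: real assume e: "0 < e"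
        have "0 < e / exp (- t * l)" using e by simp
        then have "\<forall>\<^sub>F a in at_right 0. ?r a < e / exp (- t * l)" by (rule order_tendstoD(2)[OF r0])
        then obtain p where p: "0 < p" "\<And>a. 0 < a \<Longrightarrow> a < p \<Longrightarrow> ?r a < e / exp (- t * l)"
          unfolding eventually_at_right_field by auto
        have "0 < min p t" using p(1) t0 by simp
        then obtain a where a: "0 < a" "a < min p t"
          "\<And>q. 0 \<le> q \<Longrightarrow> AE x in \<mu>. T (a + q) \<phi> x = of_real (exp (- q * l)) * T a \<phi> x"
          using L2_semigroup_eigenfunction_orbit[OF T gen eigenfunction] by metis
        have "AE x in \<mu>. T (a + (t - a)) \<phi> x = of_real (exp (- (t - a) * l)) * T a \<phi> x"
          by (rule a(3)) (use a in simp)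
        then have "AE x in \<mu>. T t \<phi> x - of_real (exp (- t * l)) * \<phi> x =
            of_real (exp (- t * l)) * (of_real (exp (a * l)) * T a \<phi> x - \<phi> x)"
        proof eventually_elim
          case (elim x)
          have "complex_of_real (exp (- (t - a) * l)) = of_real (exp (- t * l)) * of_real (exp (a * l))"
            by (simp add: exp_add[symmetric] algebra_simps flip: of_real_mult)
          then show ?case using elim by (simp add: right_diff_distrib mult.assoc)
        qed
        then have "L2_norm \<mu> (\<lambda>x. T t \<phi> x - of_real (exp (- t * l)) * \<phi> x) =
            L2_norm \<mu> (\<lambda>x. of_real (exp (- t * l)) * (of_real (exp (a * l)) * T a \<phi> x - \<phi> x))"
          using a(1) t by (intro L2_norm_cong_AE L2_measurable L2_diff L2_scale TL pL) auto
        also have "\<dots> = exp (- t * l) * ?r a" unfolding L2_norm_scale by simp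
        also have "\<dots> \<le> exp (- t * l) * (e / exp (- t * l))"
          using p(2)[of a] a by (intro mult_left_mono) auto
        finally show "L2_norm \<mu> (\<lambda>x. T t \<phi> x - of_real (exp (- t * l)) * \<phi> x) \<le> 0 + e" by simp
      qed
      then have "L2_norm \<mu> (\<lambda>x. T t \<phi> x - of_real (exp (- t * l)) * \<phi> x) = 0"
        by (simp add: order_antisym)
      then show ?thesis
        unfolding exp_op_eigenfunction[OF eigenfunction] by (intro L2_norm_diff_zero_AE TL t pL L2_scale)
    qed
  next
    case (add g h)
    have "AE x in \<mu>. T t (\<lambda>y. 1 * g y + 1 * h y) x = 1 * T t g x + 1 * T t h x"
      by (intro L2_semigroupD(2)[OF T t] test_L2 add)
    then show ?case using add(3,4)
      by eventually_elim (simp add: exp_op_add[OF add(1,2)])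
  qed
  then show "AE x in \<mu>. T t u x = heat t u x" by (simp add: heat_test[OF t u])
qed

proposition vp_semigroup_eq_heat:
  assumes "0 \<le> t" "f \<in> L2 \<mu>"
  shows "AE x in \<mu>. vp_semigroup \<mu> s t f x = heat t f x"
proof -
  have "L2_semigroup \<mu> (vp_semigroup \<mu> s) \<and>
     generator \<mu> (vp_semigroup \<mu> s) = {(f, g). (f, \<lambda>x. - g x) \<in> vladimirov_pearson \<mu> s}"
    unfolding vp_semigroup_def by (rule someI[of _ heat]) (use heat_L2_semigroup generator_heat in blast)
  then show ?thesis using L2_semigroup_unique assms by blast
qed

text \<open>
  For continuous f and g, both sides of the identity are continuous and agree almost everywhere,
  hence everywhere, since nonempty open sets have positive measure.
\<close>

proposition heat_kernel_represents_semigroup: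
  assumes t: "0 \<le> t"
  shows "kernel_represents \<mu> (heat_kernel t) (sobolev \<mu> s) (vp_semigroup \<mu> s t)"
  unfolding kernel_represents_def
proof (intro conjI ballI allI impI)
  fix f assume "f \<in> sobolev \<mu> s"
  then have f: "f \<in> L2 \<mu>" by (simp add: sobolev_def)
  show "AE x in \<mu>. integrable (heat_kernel t x) f \<and> (LINT y|heat_kernel t x. f y) = vp_semigroup \<mu> s t f x"
    using heat_kernel_integrable_AE[OF t f] vp_semigroup_eq_heat[OF t f]
    by eventually_elim (simp add: heat_def)
  fix g x
  assume cont: "continuous_on UNIV f \<and> continuous_on UNIV g \<and> (AE x in \<mu>. vp_semigroup \<mu> s t f x = g x)"
  then show "integrable (heat_kernel t x) f" using heat_continuous(2)[OF t] by blast
  have "AE x in \<mu>. vp_semigroup \<mu> s t f x = g x" using cont by blast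
  then have "AE x in \<mu>. heat t f x = g x"
    using vp_semigroup_eq_heat[OF t f] by eventually_elim simp
  then have "heat t f = g" using cont continuous_AE_eq[OF heat_continuous(1)[OF t]] by blast
  then show "(LINT y|heat_kernel t x. f y) = g x" by (simp add: heat_def fun_eq_iff)
qed

end

theorem corollary4p4:
  fixes \<mu> :: "'a::ultrametric_cantor_set measure" and s :: real
  assumes "equitising TYPE('a)"
    and "zeta_regular TYPE('a)"
    and "connes_measure \<mu>"
    and "measure_support \<mu> = UNIV"
    and "equity_measure \<mu>"
  shows "\<exists>p :: real \<Rightarrow> 'a \<Rightarrow> 'a measure.
    (\<forall>t\<ge>0. \<forall>x. sets (p t x) = sets borel) \<and>
    (\<forall>t\<ge>0. kernel_represents \<mu> (p t) (sobolev \<mu> s) (vp_semigroup \<mu> s t))"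
proof -
  interpret prob_space \<mu> using assms(3) by (simp add: connes_measure_def)
  interpret pearson_form \<mu> s
    by unfold_locales (use assms(3,4) in \<open>simp_all add: connes_measure_def\<close>)
  show ?thesis
    by (rule exI[of _ heat_kernel]) (use heat_kernel_sets heat_kernel_represents_semigroup in blast)
qed

end
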